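(* Let the initial law of $X_0$ be fixed, let $c:\mathcal X\times\mathcal U\to\mathbb R$ be a Borel measurable one-stage cost such that the conditional expectations involved are well defined, and set $g(I,u)=\int_{\mathcal X}c(x,u)\,\mu(dx)$ for $I=(j,\mu)\in\mathcal I$. Then the partially observable control model and the completely observable information-state model with state space $\mathcal I$, admissible action sets $\mathcal U(I)$, transition kernel $\mathcal K$ and one-stage cost $g$ satisfy the following properties. (i) Every admissible observation-history policy induces an admissible information-history policy producing the same joint law of $(Y_0,\pi_0,U_0,Y_1,\pi_1,U_1,\dots)$. Conversely, every admissible information-history policy can be implemented as an observation-history policy through the recursive filter. (ii) Under corresponding policies, the information state evolves according to $\mathcal K$ and, for every finite horizon $N$, $$\mathbb E\Bigl[\sum_{t=0}^{N-1}c(X_t,U_t)\Bigr]=\mathbb E\Bigl[\sum_{t=0}^{N-1}g(I_t,U_t)\Bigr],$$ whenever either side is well defined. (iii) For every discount factor $\alpha\in(0,1)$, $$\mathbb E\Bigl[\sum_{t=0}^{\infty}\alpha^t c(X_t,U_t)\Bigr]=\mathbb E\Bigl[\sum_{t=0}^{\infty}\alpha^t g(I_t,U_t)\Bigr],$$ provided the positive and negative parts are integrable; in particular, the identity holds when $c$ is bounded or nonnegative. (iv) The two models have the same optimal value under the corresponding finite-horizon or discounted criteria. Hence solving the completely observable control problem on $\mathcal I$ is equivalent to solving the original partially observable problem.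
   Context: Model. $\mathcal X$ (states), $\mathcal U$ (actions), $\mathsf E$, $\mathsf V$ (noises) are standard Borel spaces; $\mathcal P(\mathcal X)$ is the set of probability measures on $\mathcal X$ with the $\sigma$-field generated by the evaluations $\mu\mapsto\mu(C)$. $G:\mathcal X\times\mathcal U\times\mathsf E\times\mathsf V\to\mathcal X$ is Borel measurable and $X_{t+1}=G(X_t,U_t,\eta_{t+1},\varepsilon_{t+1})$, where $(\eta_t)_{t\ge1}$ is i.i.d. with law $\nu_\eta$, $(\varepsilon_t)_{t\ge1}$ is i.i.d. with law $\nu_\varepsilon$, and $X_0$, $(\eta_t)_t$, $(\varepsilon_t)_t$ are mutually independent. $Q(C\mid x,u)=\int_{\mathsf E}\int_{\mathsf V}\mathbf 1_C(G(x,u,e,v))\,\nu_\varepsilon(dv)\,\nu_\eta(de)$. $\mathcal U(x)\subseteq\mathcal U$ is the nonempty set of admissible actions at the hidden state $x$. Observations. $A_1,\dots,A_m$ is a finite measurable partition of $\mathcal X$; $O_j=\bigcup_{i\in J_j}A_i$ for $j=1,\dots,r$, with $J_1,\dots,J_r\subseteq\{1,\dots,m\}$ nonempty and pairwise disjoint; $O_{r+1}=\mathcal X\setminus\bigcup_{j\le r}O_j$. $\mathsf J=\{j\in\{1,\dots,r+1\}:O_j\neq\varnothing\}$. $Y_t=j\iff X_t\in O_j$. Controls are nonanticipative: they are selected on the basis of $(Y_0,U_0,\dots,U_{t-1},Y_t)$ only. $\mathcal H_t=\sigma(Y_0,U_0,\dots,U_{t-1},Y_t)$ and $\pi_t$ is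 the regular conditional law of $X_t$ given $\mathcal H_t$. Filter operators. For $\mu\in\mathcal P(\mathcal X)$, $u\in\mathcal U$, $k\in\mathsf J$: $(\mathcal L_u\mu)(C)=\int_{\mathcal X}Q(C\mid x,u)\,\mu(dx)$; $p_k(\mu,u)=(\mathcal L_u\mu)(O_k)$. Fix $\rho_k\in\mathcal P(\mathcal X)$ with $\rho_k(O_k)=1$; $\Phi_k(\mu,u)(C)=(\mathcal L_u\mu)(C\cap O_k)/p_k(\mu,u)$ if $p_k(\mu,u)>0$ and $\Phi_k(\mu,u)=\rho_k$ otherwise. The recursive filter is $\pi_{t+1}=\Phi_{Y_{t+1}}(\pi_t,U_t)$, with $\pi_0$ the conditional law of $X_0$ given $Y_0$. Information-state model. $\mathcal P_j=\{\mu\in\mathcal P(\mathcal X):\mu(O_j)=1\}$, $\mathcal I=\bigcup_{j\in\mathsf J}(\{j\}\times\mathcal P_j)$ with the trace $\sigma$-field; $I_t=(Y_t,\pi_t)$. For $I=(j,\mu)$: $\mathcal U(I)=\{u\in\mathcal U:\mu(\{x:u\in\mathcal U(x)\})=1\}$ and $\mathcal K(D\mid I,u)=\sum_{k\in\mathsf J}p_k(\mu,u)\mathbf 1_D\bigl((k,\Phi_k(\mu,u))\bigr)$. The initial distribution is the law of $I_0=(Y_0,\pi_0)$. Policies. The observable history is $H_t^{\mathrm o}=(Y_0,U_0,\dots,U_{t-1},Y_t)$ and the information history is $H_t^{\mathrm I}=(I_0,U_0,\dots,U_{t-1},I_t)$. An observation-history (resp. information-history) policy is a sequence of stochastic kernels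 $\gamma_t$ on $\mathcal U$ given $H_t^{\mathrm o}$ (resp. given $H_t^{\mathrm I}$); it is admissible if $U_t\in\mathcal U(I_t)$ almost surely. Under a policy, conditionally on the past (including $X_0,\dots,X_t$), $U_t$ has law $\gamma_t(\cdot\mid\text{history})$ and then $X_{t+1}\sim Q(\cdot\mid X_t,U_t)$. The optimal value is the infimum of the expected total finite-horizon (resp. discounted) cost over admissible policies.
   Formalization: In (ii) and finite-horizon (iv), "well defined" is read as: each c(X_t,U_t) has a positive or negative part of finite expectation, and in one model the summed positive or summed negative stage-cost parts do too; existence of the expectation of the sum alone does not suffice. *)

theory Defs
  imports "HOL-Probability.Probability"
begin

section \<open>Standard Borel spaces, conditional laws, extended-valued integrals\<close>

definition standard_borel :: "'a measure \<Rightarrow> bool" where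
  "standard_borel S \<longleftrightarrow>
     (\<exists>T. completely_metrizable_space T \<and> separable_space T \<and> topspace T = space S \<and>
          sets S = sigma_sets (topspace T) {W. openin T W})"

text \<open>\<open>\<kappa>\<close> is a regular conditional law of the \<open>S\<close>-valued random element \<open>Z\<close> given the
  sub-\<open>\<sigma>\<close>-field \<open>F\<close>, under the probability measure \<open>P\<close>.\<close>

definition regular_cond_law ::
  "'w measure \<Rightarrow> 'w measure \<Rightarrow> 's measure \<Rightarrow> ('w \<Rightarrow> 's) \<Rightarrow> ('w \<Rightarrow> 's measure) \<Rightarrow> bool" where
  "regular_cond_law P F S Z \<kappa> \<longleftrightarrow>
     subalgebra P F \<and> Z \<in> measurable P S \<and> \<kappa> \<in> measurable F (prob_algebra S) \<and>
     (\<forall>C\<in>sets S. AE \<omega> in P. real_cond_exp P F (\<lambda>\<omega>. indicator C (Z \<omega>)) \<omega> = measure (\<kappa> \<omega>) C)"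

text \<open>Positive part minus negative part; meaningful when \<open>ext_integral_defined\<close> holds, that is,
  when the two parts are not both infinite.\<close>

definition ext_integral :: "'w measure \<Rightarrow> ('w \<Rightarrow> ereal) \<Rightarrow> ereal" where
  "ext_integral P f =
     enn2ereal (\<integral>\<^sup>+\<omega>. e2ennreal (f \<omega>) \<partial>P) - enn2ereal (\<integral>\<^sup>+\<omega>. e2ennreal (- f \<omega>) \<partial>P)"

definition ext_integral_defined :: "'w measure \<Rightarrow> ('w \<Rightarrow> ereal) \<Rightarrow> bool" where
  "ext_integral_defined P f \<longleftrightarrow>
     (\<integral>\<^sup>+\<omega>. e2ennreal (f \<omega>) \<partial>P) < \<infinity> \<or> (\<integral>\<^sup>+\<omega>. e2ennreal (- f \<omega>) \<partial>P) < \<infinity>"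


section \<open>Histories, policies and trajectory laws\<close>

text \<open>A history up to time \<open>t\<close> is the pair of \<open>(z\<^sub>0, \<dots>, z\<^sub>t)\<close> and \<open>(u\<^sub>0, \<dots>, u\<^sub>t\<^sub>-\<^sub>1)\<close>.\<close>

type_synonym ('z, 'u) hist = "(nat \<Rightarrow> 'z) \<times> (nat \<Rightarrow> 'u)"

type_synonym ('z, 'u) policy = "nat \<Rightarrow> ('z, 'u) hist \<Rightarrow> 'u measure"

definition hist_space :: "'z measure \<Rightarrow> 'u measure \<Rightarrow> nat \<Rightarrow> ('z, 'u) hist measure" where
  "hist_space Z U t = PiM {..t} (\<lambda>_. Z) \<Otimes>\<^sub>M PiM {..<t} (\<lambda>_. U)"

definition policies :: "'z measure \<Rightarrow> 'u measure \<Rightarrow> ('z, 'u) policy set" where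
  "policies Z U = {\<gamma>. \<forall>t. \<gamma> t \<in> measurable (hist_space Z U t) (prob_algebra U)}"

text \<open>The history visible to the controller along the trajectory \<open>\<omega>\<close> of (state, action) pairs, when
  the state \<open>s\<close> is seen as \<open>f s\<close>.\<close>

definition hist_of :: "('s \<Rightarrow> 'z) \<Rightarrow> nat \<Rightarrow> (nat \<Rightarrow> 's \<times> 'u) \<Rightarrow> ('z, 'u) hist" where
  "hist_of f t \<omega> = ((\<lambda>i\<in>{..t}. f (fst (\<omega> i))), (\<lambda>i\<in>{..<t}. snd (\<omega> i)))"

text \<open>Conditional law of the pair (state, action) at time \<open>n\<close> given the earlier pairs \<open>\<omega>\<close>: the state
  \<open>s\<close> is drawn from the initial law or from the transition kernel, then the action from the policy.\<close>

definition step_kernel ::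
  "'s measure \<Rightarrow> 'u measure \<Rightarrow> 's measure \<Rightarrow> ('s \<times> 'u \<Rightarrow> 's measure) \<Rightarrow> ('s \<Rightarrow> 'z) \<Rightarrow>
   ('z, 'u) policy \<Rightarrow> nat \<Rightarrow> (nat \<Rightarrow> 's \<times> 'u) \<Rightarrow> ('s \<times> 'u) measure" where
  "step_kernel S U s0 T f \<gamma> n \<omega> =
     (case n of 0 \<Rightarrow> s0 | Suc k \<Rightarrow> T (\<omega> k)) \<bind>
       (\<lambda>s. \<gamma> n ((\<lambda>i\<in>{..n}. f (if i = n then s else fst (\<omega> i))), (\<lambda>i\<in>{..<n}. snd (\<omega> i))) \<bind>
         (\<lambda>u. return (S \<Otimes>\<^sub>M U) (s, u)))"

text \<open>The Ionescu-Tulcea measure of these kernels on the space of all trajectories.\<close>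

definition path_law ::
  "'s measure \<Rightarrow> 'u measure \<Rightarrow> 's measure \<Rightarrow> ('s \<times> 'u \<Rightarrow> 's measure) \<Rightarrow> ('s \<Rightarrow> 'z) \<Rightarrow>
   ('z, 'u) policy \<Rightarrow> (nat \<Rightarrow> 's \<times> 'u) measure" where
  "path_law S U s0 T f \<gamma> =
     projective_family.lim UNIV
       (Ionescu_Tulcea.CI (step_kernel S U s0 T f \<gamma>) (\<lambda>_. S \<Otimes>\<^sub>M U)) (\<lambda>_. S \<Otimes>\<^sub>M U)"


section \<open>The partially observable model\<close>

text \<open>The two noise spaces are the measurable spaces underlying \<open>eta_law\<close> and \<open>eps_law\<close>.
  \<open>cell i\<close>, \<open>1 \<le> i \<le> n_cells\<close>, are the partition sets; \<open>cell_idx j\<close>, \<open>1 \<le> j \<le> n_obs\<close>, are the index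
  sets of the unions forming the first \<open>n_obs\<close> observation sets.\<close>

record ('x, 'u, 'e, 'v) po_model =
  states :: "'x measure"
  actions :: "'u measure"
  eta_law :: "'e measure"
  eps_law :: "'v measure"
  dynamics :: "'x \<times> 'u \<times> 'e \<times> 'v \<Rightarrow> 'x"
  feasible :: "'x \<Rightarrow> 'u set"
  n_cells :: nat
  cell :: "nat \<Rightarrow> 'x set"
  n_obs :: nat
  cell_idx :: "nat \<Rightarrow> nat set"
  ref_law :: "nat \<Rightarrow> 'x measure"
  init_law :: "'x measure"

definition obs_set :: "('x, 'u, 'e, 'v) po_model \<Rightarrow> nat \<Rightarrow> 'x set" where
  "obs_set M j =
     (if j \<le> n_obs M then (\<Union>i\<in>cell_idx M j. cell M i)
      else space (states M) - (\<Union>l\<in>{1..n_obs M}. \<Union>i\<in>cell_idx M l. cell M i))"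

definition obs_labels :: "('x, 'u, 'e, 'v) po_model \<Rightarrow> nat set" where
  "obs_labels M = {j \<in> {1..Suc (n_obs M)}. obs_set M j \<noteq> {}}"

definition obs :: "('x, 'u, 'e, 'v) po_model \<Rightarrow> 'x \<Rightarrow> nat" where
  "obs M x = (THE j. j \<in> {1..Suc (n_obs M)} \<and> x \<in> obs_set M j)"

definition valid_po_model :: "('x, 'u, 'e, 'v) po_model \<Rightarrow> bool" where
  "valid_po_model M \<longleftrightarrow>
     standard_borel (states M) \<and> standard_borel (actions M) \<and>
     standard_borel (eta_law M) \<and> standard_borel (eps_law M) \<and>
     prob_space (eta_law M) \<and> prob_space (eps_law M) \<and>
     dynamics M \<in> measurable (states M \<Otimes>\<^sub>M actions M \<Otimes>\<^sub>M eta_law M \<Otimes>\<^sub>M eps_law M) (states M) \<and>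
     (\<forall>x\<in>space (states M). feasible M x \<subseteq> space (actions M) \<and> feasible M x \<noteq> {}) \<and>
     (\<forall>i\<in>{1..n_cells M}. cell M i \<in> sets (states M)) \<and>
     disjoint_family_on (cell M) {1..n_cells M} \<and>
     (\<Union>i\<in>{1..n_cells M}. cell M i) = space (states M) \<and>
     (\<forall>j\<in>{1..n_obs M}. cell_idx M j \<subseteq> {1..n_cells M} \<and> cell_idx M j \<noteq> {}) \<and>
     disjoint_family_on (cell_idx M) {1..n_obs M} \<and>
     (\<forall>k\<in>obs_labels M. ref_law M k \<in> space (prob_algebra (states M)) \<and>
        measure (ref_law M k) (obs_set M k) = 1) \<and>
     init_law M \<in> space (prob_algebra (states M))"

definition trans_kernel :: "('x, 'u, 'e, 'v) po_model \<Rightarrow> 'x \<times> 'u \<Rightarrow> 'x measure" where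
  "trans_kernel M = (\<lambda>(x, u).
     eta_law M \<bind> (\<lambda>e. eps_law M \<bind> (\<lambda>v. return (states M) (dynamics M (x, u, e, v)))))"

abbreviation obs_space :: "('x, 'u, 'e, 'v) po_model \<Rightarrow> nat measure" where
  "obs_space M \<equiv> count_space (obs_labels M)"

definition obs_policies :: "('x, 'u, 'e, 'v) po_model \<Rightarrow> (nat, 'u) policy set" where
  "obs_policies M = policies (obs_space M) (actions M)"

definition obs_law ::
  "('x, 'u, 'e, 'v) po_model \<Rightarrow> (nat, 'u) policy \<Rightarrow> (nat \<Rightarrow> 'x \<times> 'u) measure" where
  "obs_law M \<gamma> = path_law (states M) (actions M) (init_law M) (trans_kernel M) (obs M) \<gamma>"

text \<open>\<open>\<H>\<^sub>t = \<sigma>(Y\<^sub>0, U\<^sub>0, \<dots>, U\<^sub>t\<^sub>-\<^sub>1, Y\<^sub>t)\<close>, and the same \<open>\<sigma>\<close>-field enlarged by \<open>U\<^sub>t\<close>.\<close>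

definition obs_field ::
  "('x, 'u, 'e, 'v) po_model \<Rightarrow> (nat, 'u) policy \<Rightarrow> nat \<Rightarrow> (nat \<Rightarrow> 'x \<times> 'u) measure" where
  "obs_field M \<gamma> t =
     vimage_algebra (space (obs_law M \<gamma>)) (hist_of (obs M) t)
       (hist_space (obs_space M) (actions M) t)"

definition obs_act_field ::
  "('x, 'u, 'e, 'v) po_model \<Rightarrow> (nat, 'u) policy \<Rightarrow> nat \<Rightarrow> (nat \<Rightarrow> 'x \<times> 'u) measure" where
  "obs_act_field M \<gamma> t =
     vimage_algebra (space (obs_law M \<gamma>)) (\<lambda>\<omega>. (hist_of (obs M) t \<omega>, snd (\<omega> t)))
       (hist_space (obs_space M) (actions M) t \<Otimes>\<^sub>M actions M)"


section \<open>The recursive filter\<close>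

definition predict :: "('x, 'u, 'e, 'v) po_model \<Rightarrow> 'u \<Rightarrow> 'x measure \<Rightarrow> 'x measure" where
  "predict M u \<mu> = \<mu> \<bind> (\<lambda>x. trans_kernel M (x, u))"

definition obs_prob :: "('x, 'u, 'e, 'v) po_model \<Rightarrow> nat \<Rightarrow> 'x measure \<Rightarrow> 'u \<Rightarrow> real" where
  "obs_prob M k \<mu> u = measure (predict M u \<mu>) (obs_set M k)"

text \<open>\<open>uniform_measure \<nu> B\<close> is the conditional measure \<open>C \<mapsto> \<nu> (B \<inter> C) / \<nu> B\<close>.\<close>

definition filter_step ::
  "('x, 'u, 'e, 'v) po_model \<Rightarrow> nat \<Rightarrow> 'x measure \<Rightarrow> 'u \<Rightarrow> 'x measure" where
  "filter_step M k \<mu> u =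
     (if obs_prob M k \<mu> u > 0 then uniform_measure (predict M u \<mu>) (obs_set M k) else ref_law M k)"

text \<open>A version of the conditional law of \<open>X\<^sub>0\<close> given \<open>Y\<^sub>0 = k\<close>; on null labels the reference law is
  used, so that the initial information state always lies in the state space \<open>info_space\<close>.\<close>

definition init_filter :: "('x, 'u, 'e, 'v) po_model \<Rightarrow> nat \<Rightarrow> 'x measure" where
  "init_filter M k =
     (if measure (init_law M) (obs_set M k) > 0
      then uniform_measure (init_law M) (obs_set M k) else ref_law M k)"

primrec filt :: "('x, 'u, 'e, 'v) po_model \<Rightarrow> nat \<Rightarrow> (nat, 'u) hist \<Rightarrow> 'x measure" where
  "filt M 0 h = init_filter M (fst h 0)"
| "filt M (Suc t) h = filter_step M (fst h (Suc t)) (filt M t h) (snd h t)"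


section \<open>The information-state model\<close>

type_synonym 'x info = "nat \<times> 'x measure"

definition info_states :: "('x, 'u, 'e, 'v) po_model \<Rightarrow> 'x info set" where
  "info_states M =
     (SIGMA j : obs_labels M. {\<mu> \<in> space (prob_algebra (states M)). measure \<mu> (obs_set M j) = 1})"

definition info_space :: "('x, 'u, 'e, 'v) po_model \<Rightarrow> 'x info measure" where
  "info_space M = restrict_space (obs_space M \<Otimes>\<^sub>M prob_algebra (states M)) (info_states M)"

definition info_feasible :: "('x, 'u, 'e, 'v) po_model \<Rightarrow> 'x info \<Rightarrow> 'u set" where
  "info_feasible M = (\<lambda>(j, \<mu>).
     {u \<in> space (actions M). measure \<mu> {x \<in> space (states M). u \<in> feasible M x} = 1})"

definition info_kernel :: "('x, 'u, 'e, 'v) po_model \<Rightarrow> 'x info \<times> 'u \<Rightarrow> 'x info measure" where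
  "info_kernel M = (\<lambda>((j, \<mu>), u).
     measure_of (space (info_space M)) (sets (info_space M))
       (\<lambda>D. \<Sum>k\<in>obs_labels M. ennreal (obs_prob M k \<mu> u) * indicator D (k, filter_step M k \<mu> u)))"

definition info_cost ::
  "('x \<times> 'u \<Rightarrow> real) \<Rightarrow> 'x info \<times> 'u \<Rightarrow> ereal" where
  "info_cost c = (\<lambda>((j, \<mu>), u). ext_integral \<mu> (\<lambda>x. ereal (c (x, u))))"

text \<open>\<open>I\<^sub>t = (Y\<^sub>t, \<pi>\<^sub>t)\<close> as a function of the observable history.\<close>

definition info_of :: "('x, 'u, 'e, 'v) po_model \<Rightarrow> nat \<Rightarrow> (nat, 'u) hist \<Rightarrow> 'x info" where
  "info_of M t h = (fst h t, filt M t h)"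

definition info_init :: "('x, 'u, 'e, 'v) po_model \<Rightarrow> 'x info measure" where
  "info_init M = distr (init_law M) (info_space M) (\<lambda>x. (obs M x, init_filter M (obs M x)))"

definition info_policies :: "('x, 'u, 'e, 'v) po_model \<Rightarrow> ('x info, 'u) policy set" where
  "info_policies M = policies (info_space M) (actions M)"

definition info_law ::
  "('x, 'u, 'e, 'v) po_model \<Rightarrow> ('x info, 'u) policy \<Rightarrow> (nat \<Rightarrow> 'x info \<times> 'u) measure" where
  "info_law M \<delta> = path_law (info_space M) (actions M) (info_init M) (info_kernel M) (\<lambda>I. I) \<delta>"

text \<open>The joint law of \<open>(Y\<^sub>0, \<pi>\<^sub>0, U\<^sub>0, Y\<^sub>1, \<pi>\<^sub>1, U\<^sub>1, \<dots>)\<close> in the partially observable model.\<close>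

definition obs_info_law ::
  "('x, 'u, 'e, 'v) po_model \<Rightarrow> (nat, 'u) policy \<Rightarrow> (nat \<Rightarrow> 'x info \<times> 'u) measure" where
  "obs_info_law M \<gamma> =
     distr (obs_law M \<gamma>) (PiM UNIV (\<lambda>_. info_space M \<Otimes>\<^sub>M actions M))
       (\<lambda>\<omega> t. (info_of M t (hist_of (obs M) t \<omega>), snd (\<omega> t)))"

text \<open>\<open>U\<^sub>t \<in> \<U>(I\<^sub>t)\<close> almost surely for all \<open>t\<close>, as a property of the joint law of the information
  states and actions; no measurability of the graph of \<open>info_feasible\<close> is presupposed.\<close>

definition admissible_law ::
  "('x, 'u, 'e, 'v) po_model \<Rightarrow> (nat \<Rightarrow> 'x info \<times> 'u) measure \<Rightarrow> bool" where
  "admissible_law M L \<longleftrightarrow> (\<forall>t. AE \<omega> in L. snd (\<omega> t) \<in> info_feasible M (fst (\<omega> t)))"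

definition obs_admissible :: "('x, 'u, 'e, 'v) po_model \<Rightarrow> (nat, 'u) policy set" where
  "obs_admissible M = {\<gamma> \<in> obs_policies M. admissible_law M (obs_info_law M \<gamma>)}"

definition info_admissible :: "('x, 'u, 'e, 'v) po_model \<Rightarrow> ('x info, 'u) policy set" where
  "info_admissible M = {\<delta> \<in> info_policies M. admissible_law M (info_law M \<delta>)}"

text \<open>An observation-history policy becomes an information-history policy by ignoring the measure
  components; an information-history policy is run on observations by inserting the filter.\<close>

definition induced :: "(nat, 'u) policy \<Rightarrow> ('x info, 'u) policy" where
  "induced \<gamma> t h = \<gamma> t ((\<lambda>i\<in>{..t}. fst (fst h i)), snd h)"

definition implement ::
  "('x, 'u, 'e, 'v) po_model \<Rightarrow> ('x info, 'u) policy \<Rightarrow> (nat, 'u) policy" where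
  "implement M \<delta> t h = \<delta> t ((\<lambda>i\<in>{..t}. info_of M i h), snd h)"

definition corresponding ::
  "('x, 'u, 'e, 'v) po_model \<Rightarrow> (nat, 'u) policy \<Rightarrow> ('x info, 'u) policy \<Rightarrow> bool" where
  "corresponding M \<gamma> \<delta> \<longleftrightarrow>
     \<gamma> \<in> obs_admissible M \<and> \<delta> = induced \<gamma> \<or> \<delta> \<in> info_admissible M \<and> \<gamma> = implement M \<delta>"


section \<open>Expected total costs\<close>

definition finite_cost :: "(nat \<Rightarrow> 'z) measure \<Rightarrow> ('z \<Rightarrow> ereal) \<Rightarrow> nat \<Rightarrow> ereal" where
  "finite_cost L f N = ext_integral L (\<lambda>\<omega>. \<Sum>t<N. f (\<omega> t))"

definition discounted_cost :: "(nat \<Rightarrow> 'z) measure \<Rightarrow> ('z \<Rightarrow> ereal) \<Rightarrow> real \<Rightarrow> ereal" where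
  "discounted_cost L f \<alpha> = ext_integral L (\<lambda>\<omega>. \<Sum>t. ereal (\<alpha> ^ t) * f (\<omega> t))"

text \<open>The expected total cost over \<open>N\<close> stages is well defined: the accumulated positive parts or the
  accumulated negative parts of the stage costs have finite expectation. (Quasi-integrability of the
  sum alone would allow cancellation between different stages with infinite expectations.)\<close>

definition finite_cost_defined :: "(nat \<Rightarrow> 'z) measure \<Rightarrow> ('z \<Rightarrow> ereal) \<Rightarrow> nat \<Rightarrow> bool" where
  "finite_cost_defined L f N \<longleftrightarrow>
     (\<integral>\<^sup>+\<omega>. (\<Sum>t<N. e2ennreal (f (\<omega> t))) \<partial>L) < \<infinity> \<or>
     (\<integral>\<^sup>+\<omega>. (\<Sum>t<N. e2ennreal (- f (\<omega> t))) \<partial>L) < \<infinity>"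

definition discounted_parts_integrable ::
  "(nat \<Rightarrow> 'z) measure \<Rightarrow> ('z \<Rightarrow> ereal) \<Rightarrow> real \<Rightarrow> bool" where
  "discounted_parts_integrable L f \<alpha> \<longleftrightarrow>
     (\<integral>\<^sup>+\<omega>. (\<Sum>t. ennreal (\<alpha> ^ t) * e2ennreal (f (\<omega> t))) \<partial>L) < \<infinity> \<and>
     (\<integral>\<^sup>+\<omega>. (\<Sum>t. ennreal (\<alpha> ^ t) * e2ennreal (- f (\<omega> t))) \<partial>L) < \<infinity>"

text \<open>The first condition says that the conditional expectations of \<open>c(X\<^sub>t, U\<^sub>t)\<close>, \<open>t < N\<close>, are well
  defined; the second that the expected total cost is well defined in one of the two models.\<close>

definition finite_condition ::
  "('x, 'u, 'e, 'v) po_model \<Rightarrow> ('x \<times> 'u \<Rightarrow> real) \<Rightarrow> nat \<Rightarrow>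
   (nat, 'u) policy \<Rightarrow> ('x info, 'u) policy \<Rightarrow> bool" where
  "finite_condition M c N \<gamma> \<delta> \<longleftrightarrow>
     (\<forall>t<N. ext_integral_defined (obs_law M \<gamma>) (\<lambda>\<omega>. ereal (c (\<omega> t)))) \<and>
     (finite_cost_defined (obs_law M \<gamma>) (\<lambda>z. ereal (c z)) N \<or>
      finite_cost_defined (info_law M \<delta>) (info_cost c) N)"

definition discounted_condition ::
  "('x, 'u, 'e, 'v) po_model \<Rightarrow> ('x \<times> 'u \<Rightarrow> real) \<Rightarrow> real \<Rightarrow> (nat, 'u) policy \<Rightarrow> bool" where
  "discounted_condition M c \<alpha> \<gamma> \<longleftrightarrow>
     discounted_parts_integrable (obs_law M \<gamma>) (\<lambda>z. ereal (c z)) \<alpha> \<or>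
     (\<exists>B. \<forall>z\<in>space (states M \<Otimes>\<^sub>M actions M). \<bar>c z\<bar> \<le> B) \<or>
     (\<forall>z\<in>space (states M \<Otimes>\<^sub>M actions M). 0 \<le> c z)"

end

theory Submission
  imports Defs
begin

text \<open>The filter \<open>\<pi>\<^sub>t\<close> is a function of the observable history, and it is the conditional law of the
  hidden state \<open>X\<^sub>t\<close> given that history. Everything else follows from this and from the fact that the
  action is drawn from a law depending on the history alone.

  That the filter is the conditional law is proved by induction on time (\<open>filter_is_correct\<close>). The
  hypothesis is an identity between integrals of arbitrary nonnegative functions of history and
  state. Since the action carries no further information about the state, given history and action the
  next state has the predicted law \<open>predict M u \<mu>\<close> (\<open>prediction_correct\<close>), and conditioning the predicted
  law on the new label is the filter step by Bayes' formula (\<open>bayes_observation\<close>). The reference laws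
  enter only at labels that have probability zero under the predicted law.

  The next information state is a function of the predicted law and of the label of the new state.
  The image of the predicted law under this function is the information kernel
  (\<open>info_kernel_eq_distr\<close>), so the information state moves according to that kernel whatever the policy
  is (\<open>next_info_state\<close>). A trajectory law built by the Ionescu-Tulcea construction is determined by
  the conditional laws of its states and of its actions (\<open>path_law_unique\<close>). The filtered process of a
  partially observable model has the state kernel of the information-state model, and its actions follow
  every information policy that chooses the same laws along filtered histories; so its law is the one of
  the information-state model under that policy (\<open>obs_info_law_eq_info_law\<close>). A policy and its
  induced policy, or an information policy and its implementation, choose the same laws in this sense.

  For the costs, the positive part and the negative part of each stage cost are averaged over the filter
  separately, where the tower property is an identity between integrals of nonnegative functions
  (\<open>nn_integral_mean_cost\<close>). The conditions on the cost say, directly or after an argument about cancellation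
  in the averaged cost (\<open>finite_condition_parts\<close>), that one of the two accumulated parts has finite
  expectation; then the signed sums are determined by the expected parts (\<open>ext_integral_weighted\<close>), which
  agree in the two models. Equal costs of corresponding policies give equal infima.\<close>

section \<open>Controlled processes and their trajectory laws\<close>

text \<open>The history visible at time \<open>n\<close>, as the step kernel assembles it: the pairs before time \<open>n\<close> are
given by \<open>w\<close>, and the state \<open>s\<close> at time \<open>n\<close> has been drawn while its action has not.\<close>

definition past_hist ::
  "('s \<Rightarrow> 'z) \<Rightarrow> nat \<Rightarrow> (nat \<Rightarrow> 's \<times> 'u) \<Rightarrow> 's \<Rightarrow> ('z, 'u) hist" where
  "past_hist f n w s =
     ((\<lambda>i\<in>{..n}. f (if i = n then s else fst (w i))), (\<lambda>i\<in>{..<n}. snd (w i)))"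

lemma hist_of_eq_past_hist:
  "hist_of f n \<omega> = past_hist f n (restrict \<omega> {0..<n}) (fst (\<omega> n))"
  unfolding hist_of_def past_hist_def by (auto simp: fun_eq_iff)

lemma measurable_past_hist:
  assumes [measurable]: "f \<in> S \<rightarrow>\<^sub>M Z"
  shows "(\<lambda>(w, s). past_hist f n w s) \<in> PiM {0..<n} (\<lambda>_. S \<Otimes>\<^sub>M U) \<Otimes>\<^sub>M S \<rightarrow>\<^sub>M hist_space Z U n"
proof -
  have fst_w: "(\<lambda>x. f (if i = n then snd x else fst (fst x i)))
      \<in> PiM {0..<n} (\<lambda>_. S \<Otimes>\<^sub>M U) \<Otimes>\<^sub>M S \<rightarrow>\<^sub>M Z" if "i \<in> {..n}" for i
    using that by (cases "i = n") auto
  have snd_w: "(\<lambda>x. snd (fst x i))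
      \<in> PiM {0..<n} (\<lambda>_. S \<Otimes>\<^sub>M U) \<Otimes>\<^sub>M S \<rightarrow>\<^sub>M U" if "i \<in> {..<n}" for i
    using that by auto
  show ?thesis
    unfolding hist_space_def past_hist_def split_def
    by (intro measurable_Pair measurable_restrict fst_w snd_w)
qed

text \<open>Stated over an arbitrary index set \<open>J\<close>, because histories are read off from whole trajectories and
also from initial segments \<open>{0..<Suc n}\<close> of them.\<close>

lemma measurable_hist_of:
  assumes f[measurable]: "f \<in> S \<rightarrow>\<^sub>M Z" and J: "{..n} \<subseteq> J"
  shows "hist_of f n \<in> PiM J (\<lambda>_. S \<Otimes>\<^sub>M U) \<rightarrow>\<^sub>M hist_space Z U n"
proof -
  have "(\<lambda>\<omega>. \<omega> i) \<in> PiM J (\<lambda>_. S \<Otimes>\<^sub>M U) \<rightarrow>\<^sub>M S \<Otimes>\<^sub>M U" if "i \<le> n" for i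
    using that J by (intro measurable_component_singleton) auto
  then show ?thesis
    unfolding hist_space_def hist_of_def
    by (intro measurable_Pair measurable_restrict) auto
qed

definition extend_hist :: "nat \<Rightarrow> ('z, 'u) hist \<Rightarrow> 'u \<Rightarrow> 'z \<Rightarrow> ('z, 'u) hist" where
  "extend_hist n h u z = ((fst h)(Suc n := z), (snd h)(n := u))"

lemma measurable_extend_hist:
  "(\<lambda>(h, u, z). extend_hist n h u z)
     \<in> hist_space Z U n \<Otimes>\<^sub>M U \<Otimes>\<^sub>M Z \<rightarrow>\<^sub>M hist_space Z U (Suc n)"
  unfolding extend_hist_def hist_space_def split_def
  by (intro measurable_Pair measurable_fun_upd[where J="{..n}"] measurable_fun_upd[where J="{..<n}"])
     (auto simp: atMost_Suc lessThan_Suc)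

text \<open>The recursion that drives the induction over time: a history grows by one action and one label.\<close>

lemma hist_of_Suc:
  "hist_of f (Suc n) \<omega> = extend_hist n (hist_of f n \<omega>) (snd (\<omega> n)) (f (fst (\<omega> (Suc n))))"
  unfolding hist_of_def extend_hist_def by (auto simp: fun_eq_iff)

lemma nn_integral_kernel_measurable:
  assumes "(\<lambda>(x, y). F x y) \<in> borel_measurable (A \<Otimes>\<^sub>M B)" "L \<in> A \<rightarrow>\<^sub>M prob_algebra B"
  shows "(\<lambda>x. \<integral>\<^sup>+y. F x y \<partial>L x) \<in> borel_measurable A"
  using nn_integral_measurable_subprob_algebra2[OF assms(1) measurable_prob_algebraD[OF assms(2)]] .

text \<open>Both models of the theorem are instances of one scheme: a state process with initial law \<open>s0\<close> and
transition kernel \<open>T\<close>, steered by a policy \<open>\<gamma>\<close> that sees each state through \<open>f\<close>. In the partially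
observable model \<open>f\<close> is the observation label, in the information-state model it is the identity.\<close>

locale controlled_process =
  fixes S :: "'s measure" and U :: "'u measure" and s0 :: "'s measure"
    and T :: "'s \<times> 'u \<Rightarrow> 's measure" and f :: "'s \<Rightarrow> 'z" and Z :: "'z measure"
    and \<gamma> :: "('z, 'u) policy"
  assumes init: "s0 \<in> space (prob_algebra S)"
    and trans: "T \<in> S \<Otimes>\<^sub>M U \<rightarrow>\<^sub>M prob_algebra S"
    and view: "f \<in> S \<rightarrow>\<^sub>M Z"
    and policy: "\<gamma> \<in> policies Z U"
begin

abbreviation past :: "nat \<Rightarrow> (nat \<Rightarrow> 's \<times> 'u) measure" where
  "past n \<equiv> PiM {0..<n} (\<lambda>_. S \<Otimes>\<^sub>M U)"

abbreviation paths :: "(nat \<Rightarrow> 's \<times> 'u) measure" where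
  "paths \<equiv> PiM UNIV (\<lambda>_. S \<Otimes>\<^sub>M U)"

text \<open>The step kernel draws a state and then an action. Its two halves are separated here, since all later
arguments condition on one of the two draws at a time.\<close>

definition state_kernel :: "nat \<Rightarrow> (nat \<Rightarrow> 's \<times> 'u) \<Rightarrow> 's measure" where
  "state_kernel n w = (case n of 0 \<Rightarrow> s0 | Suc k \<Rightarrow> T (w k))"

definition act_kernel :: "nat \<Rightarrow> (nat \<Rightarrow> 's \<times> 'u) \<Rightarrow> 's \<Rightarrow> 'u measure" where
  "act_kernel n w s = \<gamma> n (past_hist f n w s)"

lemma measurable_state_kernel[measurable]: "state_kernel n \<in> past n \<rightarrow>\<^sub>M prob_algebra S"
proof (cases n)
  case 0 then show ?thesis unfolding state_kernel_def by (simp add: init)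
next
  case (Suc k)
  then show ?thesis
    unfolding state_kernel_def
    by (auto intro!: measurable_compose[OF _ trans] measurable_component_singleton)
qed

lemma measurable_policy: "\<gamma> n \<in> hist_space Z U n \<rightarrow>\<^sub>M prob_algebra U"
  using policy by (simp add: policies_def)

lemma measurable_act_kernel[measurable]:
  "(\<lambda>(w, s). act_kernel n w s) \<in> past n \<Otimes>\<^sub>M S \<rightarrow>\<^sub>M prob_algebra U"
  unfolding act_kernel_def
  using measurable_compose[OF measurable_past_hist[OF view] measurable_policy] by (simp add: split_def)

lemma step_kernel_eq:
  "step_kernel S U s0 T f \<gamma> n w =
     state_kernel n w \<bind> (\<lambda>s. act_kernel n w s \<bind> (\<lambda>u. return (S \<Otimes>\<^sub>M U) (s, u)))"
  unfolding step_kernel_def state_kernel_def act_kernel_def past_hist_def ..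

lemma measurable_act_bind[measurable]:
  "(\<lambda>(w, s). act_kernel n w s \<bind> (\<lambda>u. return (S \<Otimes>\<^sub>M U) (s, u)))
     \<in> past n \<Otimes>\<^sub>M S \<rightarrow>\<^sub>M prob_algebra (S \<Otimes>\<^sub>M U)"
proof -
  have "(\<lambda>x. act_kernel n (fst x) (snd x) \<bind> (\<lambda>u. return (S \<Otimes>\<^sub>M U) (snd x, u)))
      \<in> past n \<Otimes>\<^sub>M S \<rightarrow>\<^sub>M prob_algebra (S \<Otimes>\<^sub>M U)"
    by (rule measurable_bind_prob_space2[where N=U])
       (use measurable_act_kernel in \<open>simp_all add: split_def\<close>)
  then show ?thesis by (simp add: split_def)
qed

lemma measurable_step_kernel:
  "step_kernel S U s0 T f \<gamma> n \<in> past n \<rightarrow>\<^sub>M prob_algebra (S \<Otimes>\<^sub>M U)"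
  unfolding step_kernel_eq[abs_def]
  by (rule measurable_bind_prob_space2[where N=S]) measurable

lemma nn_integral_step_kernel:
  assumes w: "w \<in> space (past n)" and F[measurable]: "F \<in> borel_measurable (S \<Otimes>\<^sub>M U)"
  shows "(\<integral>\<^sup>+z. F z \<partial>step_kernel S U s0 T f \<gamma> n w) =
    (\<integral>\<^sup>+s. \<integral>\<^sup>+u. F (s, u) \<partial>act_kernel n w s \<partial>state_kernel n w)"
proof -
  have sk: "state_kernel n w \<in> space (prob_algebra S)"
    using measurable_space[OF measurable_state_kernel w] .
  then have sk': "sets (state_kernel n w) = sets S" "space (state_kernel n w) = space S"
    by (auto simp: space_prob_algebra dest: sets_eq_imp_space_eq)
  have ak: "act_kernel n w s \<in> space (prob_algebra U)" if "s \<in> space S" for s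
    using measurable_space[OF measurable_act_kernel, of "(w, s)"] w that
    by (simp add: space_pair_measure)
  then have ak': "sets (act_kernel n w s) = sets U" if "s \<in> space S" for s
    using that by (auto simp: space_prob_algebra)
  have m: "(\<lambda>s. act_kernel n w s \<bind> (\<lambda>u. return (S \<Otimes>\<^sub>M U) (s, u)))
      \<in> S \<rightarrow>\<^sub>M prob_algebra (S \<Otimes>\<^sub>M U)"
    using measurable_compose[OF measurable_Pair1'[OF w] measurable_act_bind] by simp
  have ret: "(\<lambda>u. return (S \<Otimes>\<^sub>M U) (s, u)) \<in> act_kernel n w s \<rightarrow>\<^sub>M subprob_algebra (S \<Otimes>\<^sub>M U)"
    if "s \<in> space S" for s
    using that by (simp add: measurable_cong_sets[OF ak' refl])
  have inner: "(\<integral>\<^sup>+z. F z \<partial>(act_kernel n w s \<bind> (\<lambda>u. return (S \<Otimes>\<^sub>M U) (s, u)))) =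
      (\<integral>\<^sup>+u. F (s, u) \<partial>act_kernel n w s)" if s: "s \<in> space S" for s
  proof -
    have "(\<integral>\<^sup>+z. F z \<partial>(act_kernel n w s \<bind> (\<lambda>u. return (S \<Otimes>\<^sub>M U) (s, u)))) =
        (\<integral>\<^sup>+u. \<integral>\<^sup>+z. F z \<partial>return (S \<Otimes>\<^sub>M U) (s, u) \<partial>act_kernel n w s)"
      by (rule nn_integral_bind[OF F ret[OF s]])
    also have "\<dots> = (\<integral>\<^sup>+u. F (s, u) \<partial>act_kernel n w s)"
      using s sets_eq_imp_space_eq[OF ak'[OF s]]
      by (intro nn_integral_cong nn_integral_return) (auto simp: space_pair_measure)
    finally show ?thesis .
  qed
  have "(\<integral>\<^sup>+z. F z \<partial>step_kernel S U s0 T f \<gamma> n w) =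
      (\<integral>\<^sup>+s. \<integral>\<^sup>+z. F z \<partial>(act_kernel n w s \<bind> (\<lambda>u. return (S \<Otimes>\<^sub>M U) (s, u))) \<partial>state_kernel n w)"
    unfolding step_kernel_eq
    by (subst nn_integral_bind[where B="S \<Otimes>\<^sub>M U"])
       (auto simp: measurable_cong_sets[OF sk'(1) refl] intro: measurable_prob_algebraD[OF m])
  also have "\<dots> = (\<integral>\<^sup>+s. \<integral>\<^sup>+u. F (s, u) \<partial>act_kernel n w s \<partial>state_kernel n w)"
    using sk' by (intro nn_integral_cong inner) simp
  finally show ?thesis .
qed

sublocale IT: Ionescu_Tulcea "step_kernel S U s0 T f \<gamma>" "\<lambda>_. S \<Otimes>\<^sub>M U"
proof (rule Ionescu_Tulcea.intro)
  show "step_kernel S U s0 T f \<gamma> i \<in> past i \<rightarrow>\<^sub>M subprob_algebra (S \<Otimes>\<^sub>M U)" for i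
    by (rule measurable_prob_algebraD[OF measurable_step_kernel])
  show "prob_space (step_kernel S U s0 T f \<gamma> i x)" if "x \<in> space (past i)" for i x
    using measurable_space[OF measurable_step_kernel that] by (simp add: space_prob_algebra)
qed

definition L :: "(nat \<Rightarrow> 's \<times> 'u) measure" where
  "L = path_law S U s0 T f \<gamma>"

lemma sets_L: "sets L = sets paths"
  unfolding L_def path_law_def by simp

lemma space_L: "space L = space paths"
  by (rule sets_eq_imp_space_eq[OF sets_L])

lemma measurable_L_iff: "measurable L A = measurable paths A"
  by (rule measurable_cong_sets[OF sets_L refl])

lemma undefined_in_past0: "(\<lambda>_. undefined) \<in> space (past 0)"
  by (simp add: space_PiM)

text \<open>The Ionescu-Tulcea measure enters the arguments through its finite-dimensional marginals, which are
the iterated kernel compositions \<open>IT.C\<close>.\<close>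

lemma distr_L: "distr L (past n) (\<lambda>\<omega>. restrict \<omega> {0..<n}) = IT.C 0 n (\<lambda>_. undefined)"
proof -
  have up: "IT.up_to {0..<n} = n"
    unfolding IT.up_to_def by (rule Least_equality) (auto simp: not_le[symmetric] intro: leI)
  have "distr L (past n) (\<lambda>\<omega>. restrict \<omega> {0..<n}) = IT.CI {0..<n}"
    unfolding L_def path_law_def by (rule IT.distr_lim) simp
  also have "\<dots> = distr (IT.C 0 n (\<lambda>_. undefined)) (past n) (\<lambda>\<omega>. restrict \<omega> {0..<n})"
    by (simp add: IT.CI_def up)
  also have "\<dots> = distr (IT.C 0 n (\<lambda>_. undefined)) (IT.C 0 n (\<lambda>_. undefined)) (\<lambda>\<omega>. \<omega>)"
    using IT.sets_C[OF undefined_in_past0, of n] IT.space_C[OF undefined_in_past0, of n]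
    by (intro distr_cong) (auto simp: space_PiM)
  finally show ?thesis by (simp add: distr_id2)
qed

lemma prob_space_L: "prob_space L"
proof (rule prob_space_distrD)
  show "(\<lambda>\<omega>. restrict \<omega> {0..<0}) \<in> L \<rightarrow>\<^sub>M past 0"
    unfolding measurable_L_iff by (rule measurable_restrict_subset) simp
  show "prob_space (distr L (past 0) (\<lambda>\<omega>. restrict \<omega> {0..<0}))"
    unfolding distr_L using undefined_in_past0 by (rule IT.prob_space_C)
qed

lemma measurable_restrict_past[measurable]: "(\<lambda>\<omega>. restrict \<omega> {0..<n}) \<in> paths \<rightarrow>\<^sub>M past n"
  by (rule measurable_restrict_subset) simp

lemma measurable_restrict_L: "(\<lambda>\<omega>. restrict \<omega> {0..<n}) \<in> L \<rightarrow>\<^sub>M past n"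
  unfolding measurable_L_iff by (rule measurable_restrict_past)

lemma measurable_fun_upd_past:
  "(\<lambda>(w, z). w(n := z)) \<in> past n \<Otimes>\<^sub>M (S \<Otimes>\<^sub>M U) \<rightarrow>\<^sub>M past (Suc n)"
  unfolding split_def
  by (rule measurable_fun_upd[where J="{0..<n}"]) (auto simp: atLeastLessThanSuc)

text \<open>One more factor in the iterated composition is one more integration against the step kernel; in
the marginal on \<open>{0..<Suc n}\<close> this factor is the last one.\<close>

lemma L_disintegration:
  assumes F[measurable]: "F \<in> borel_measurable (past n \<Otimes>\<^sub>M (S \<Otimes>\<^sub>M U))"
  shows "(\<integral>\<^sup>+\<omega>. F (restrict \<omega> {0..<n}, \<omega> n) \<partial>L) =
    (\<integral>\<^sup>+\<omega>. \<integral>\<^sup>+z. F (restrict \<omega> {0..<n}, z) \<partial>step_kernel S U s0 T f \<gamma> n (restrict \<omega> {0..<n}) \<partial>L)"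
proof -
  let ?C = "\<lambda>n. IT.C 0 n (\<lambda>_. undefined)"
  note sC = IT.sets_C[OF undefined_in_past0, simplified]
  note spC = IT.space_C[OF undefined_in_past0, simplified]
  have mG: "(\<lambda>w. F (restrict w {0..<n}, w n)) \<in> borel_measurable (past (Suc n))"
  proof -
    have "(\<lambda>w. (restrict w {0..<n}, w n)) \<in> past (Suc n) \<rightarrow>\<^sub>M past n \<Otimes>\<^sub>M (S \<Otimes>\<^sub>M U)"
      by (intro measurable_Pair measurable_restrict_subset measurable_component_singleton) auto
    then show ?thesis by measurable
  qed
  have "(\<integral>\<^sup>+\<omega>. F (restrict \<omega> {0..<n}, \<omega> n) \<partial>L) =
      (\<integral>\<^sup>+\<omega>. (\<lambda>w. F (restrict w {0..<n}, w n)) (restrict \<omega> {0..<Suc n}) \<partial>L)"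
    by (intro nn_integral_cong arg_cong[where f=F]) (auto simp: fun_eq_iff)
  also have "\<dots> = (\<integral>\<^sup>+w. F (restrict w {0..<n}, w n) \<partial>distr L (past (Suc n)) (\<lambda>\<omega>. restrict \<omega> {0..<Suc n}))"
    using mG by (intro nn_integral_distr[symmetric] measurable_restrict_L) simp
  also have "\<dots> = (\<integral>\<^sup>+w. F (restrict w {0..<n}, w n) \<partial>(?C n \<bind> IT.eP n))"
    unfolding distr_L by simp
  also have "\<dots> = (\<integral>\<^sup>+w. \<integral>\<^sup>+v. F (restrict v {0..<n}, v n) \<partial>IT.eP n w \<partial>?C n)"
    by (rule nn_integral_bind[OF mG], subst measurable_cong_sets[OF sC refl]) (rule IT.measurable_eP)
  also have "\<dots> = (\<integral>\<^sup>+w. \<integral>\<^sup>+z. F (w, z) \<partial>step_kernel S U s0 T f \<gamma> n w \<partial>?C n)"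
  proof (rule nn_integral_cong)
    fix w assume "w \<in> space (?C n)"
    then have w: "w \<in> space (past n)" by (simp add: spC)
    have "restrict (w(n := z)) {0..<n} = w" for z
      using w by (auto simp: space_PiM PiE_iff extensional_def fun_eq_iff)
    then show "(\<integral>\<^sup>+v. F (restrict v {0..<n}, v n) \<partial>IT.eP n w) = (\<integral>\<^sup>+z. F (w, z) \<partial>step_kernel S U s0 T f \<gamma> n w)"
      by (subst IT.nn_integral_eP[OF w mG]) simp
  qed
  also have "\<dots> = (\<integral>\<^sup>+\<omega>. \<integral>\<^sup>+z. F (restrict \<omega> {0..<n}, z) \<partial>step_kernel S U s0 T f \<gamma> n (restrict \<omega> {0..<n}) \<partial>L)"
    unfolding distr_L[symmetric]
    by (rule nn_integral_distr[OF measurable_restrict_L])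
       (auto intro!: nn_integral_kernel_measurable measurable_step_kernel)
  finally show ?thesis .
qed

text \<open>Given the past and the current state, the action has the law chosen by the policy. After the state
and the action have been integrated in this order, averaging over the action once more changes
nothing, so the disintegration can be applied to \<open>F\<close> and to its average \<open>G\<close> with equal results.\<close>

lemma nn_integral_action:
  assumes F[measurable]: "F \<in> borel_measurable (past n \<Otimes>\<^sub>M S \<Otimes>\<^sub>M U)"
  shows "(\<integral>\<^sup>+\<omega>. F (restrict \<omega> {0..<n}, fst (\<omega> n), snd (\<omega> n)) \<partial>L) =
    (\<integral>\<^sup>+\<omega>. \<integral>\<^sup>+u. F (restrict \<omega> {0..<n}, fst (\<omega> n), u) \<partial>\<gamma> n (hist_of f n \<omega>) \<partial>L)"
proof -
  \<comment> \<open>\<open>G\<close> disregards the action stored in \<open>z\<close> and averages over a fresh one.\<close>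
  define G where "G = (\<lambda>(w, z::'s \<times> 'u). \<integral>\<^sup>+u. F (w, fst z, u) \<partial>act_kernel n w (fst z))"
  have G[measurable]: "G \<in> borel_measurable (past n \<Otimes>\<^sub>M (S \<Otimes>\<^sub>M U))"
  proof -
    have "(\<lambda>x. \<integral>\<^sup>+u. F (fst x, fst (snd x), u) \<partial>act_kernel n (fst x) (fst (snd x)))
        \<in> borel_measurable (past n \<Otimes>\<^sub>M (S \<Otimes>\<^sub>M U))"
      using measurable_compose[OF _ measurable_act_kernel, of "\<lambda>x. (fst x, fst (snd x))"]
      by (intro nn_integral_kernel_measurable[where B=U]) auto
    then show ?thesis unfolding G_def by (simp add: split_def)
  qed
  have eq: "(\<integral>\<^sup>+z. F (w, z) \<partial>step_kernel S U s0 T f \<gamma> n w) = (\<integral>\<^sup>+z. G (w, z) \<partial>step_kernel S U s0 T f \<gamma> n w)"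
    if w: "w \<in> space (past n)" for w
  proof -
    have sk: "state_kernel n w \<in> space (prob_algebra S)"
      using measurable_space[OF measurable_state_kernel w] .
    have "(\<integral>\<^sup>+u. G (w, s, u) \<partial>act_kernel n w s) = (\<integral>\<^sup>+u. F (w, s, u) \<partial>act_kernel n w s)"
      if "s \<in> space (state_kernel n w)" for s
    proof -
      have "s \<in> space S" using that sk by (auto simp: space_prob_algebra dest: sets_eq_imp_space_eq)
      then have "prob_space (act_kernel n w s)"
        using measurable_space[OF measurable_act_kernel, of "(w, s)"] w
        by (simp add: space_pair_measure space_prob_algebra)
      then show ?thesis unfolding G_def by (simp add: prob_space.emeasure_space_1)
    qed
    then show ?thesis
      using w by (subst (1 2) nn_integral_step_kernel) (auto cong: nn_integral_cong)
  qed
  have "(\<integral>\<^sup>+\<omega>. F (restrict \<omega> {0..<n}, fst (\<omega> n), snd (\<omega> n)) \<partial>L) = (\<integral>\<^sup>+\<omega>. F (restrict \<omega> {0..<n}, \<omega> n) \<partial>L)"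
    by simp
  also have "\<dots> = (\<integral>\<^sup>+\<omega>. G (restrict \<omega> {0..<n}, \<omega> n) \<partial>L)"
    unfolding L_disintegration[OF F] L_disintegration[OF G]
    by (intro nn_integral_cong eq measurable_space[OF measurable_restrict_past])
       (simp add: space_L)
  also have "\<dots> = (\<integral>\<^sup>+\<omega>. \<integral>\<^sup>+u. F (restrict \<omega> {0..<n}, fst (\<omega> n), u) \<partial>\<gamma> n (hist_of f n \<omega>) \<partial>L)"
    unfolding G_def act_kernel_def hist_of_eq_past_hist by simp
  finally show ?thesis .
qed

text \<open>Given the past, the next state has the law \<open>state_kernel\<close>: the action kernel has total mass one, so
it disappears from the disintegration of a function of the state alone.\<close>

lemma nn_integral_state:
  assumes F[measurable]: "F \<in> borel_measurable (past n \<Otimes>\<^sub>M S)"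
  shows "(\<integral>\<^sup>+\<omega>. F (restrict \<omega> {0..<n}, fst (\<omega> n)) \<partial>L) =
    (\<integral>\<^sup>+\<omega>. \<integral>\<^sup>+s. F (restrict \<omega> {0..<n}, s) \<partial>state_kernel n (restrict \<omega> {0..<n}) \<partial>L)"
proof -
  have eq: "(\<integral>\<^sup>+z. F (w, fst z) \<partial>step_kernel S U s0 T f \<gamma> n w) = (\<integral>\<^sup>+s. F (w, s) \<partial>state_kernel n w)"
    if w: "w \<in> space (past n)" for w
  proof -
    have sk: "state_kernel n w \<in> space (prob_algebra S)"
      using measurable_space[OF measurable_state_kernel w] .
    have "(\<integral>\<^sup>+u. F (w, s) \<partial>act_kernel n w s) = F (w, s)"
      if "s \<in> space (state_kernel n w)" for s
    proof -
      have "s \<in> space S" using that sk by (auto simp: space_prob_algebra dest: sets_eq_imp_space_eq)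
      then have "prob_space (act_kernel n w s)"
        using measurable_space[OF measurable_act_kernel, of "(w, s)"] w
        by (simp add: space_pair_measure space_prob_algebra)
      then show ?thesis by (simp add: prob_space.emeasure_space_1)
    qed
    then show ?thesis
      using w by (subst nn_integral_step_kernel) (auto intro!: nn_integral_cong)
  qed
  have "(\<integral>\<^sup>+\<omega>. F (restrict \<omega> {0..<n}, fst (\<omega> n)) \<partial>L) =
      (\<integral>\<^sup>+\<omega>. (\<lambda>(w, z). F (w, fst z)) (restrict \<omega> {0..<n}, \<omega> n) \<partial>L)"
    by simp
  also have "\<dots> = (\<integral>\<^sup>+\<omega>. \<integral>\<^sup>+s. F (restrict \<omega> {0..<n}, s) \<partial>state_kernel n (restrict \<omega> {0..<n}) \<partial>L)"
    by (subst L_disintegration)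
       (auto intro!: nn_integral_cong eq measurable_space[OF measurable_restrict_past] simp: space_L)
  finally show ?thesis .
qed

text \<open>The two conditional laws in the form used for filtering, where the past enters only through the
visible history.\<close>

lemma nn_integral_action_hist:
  assumes F[measurable]: "F \<in> borel_measurable (hist_space Z U n \<Otimes>\<^sub>M S \<Otimes>\<^sub>M U)"
  shows "(\<integral>\<^sup>+\<omega>. F (hist_of f n \<omega>, fst (\<omega> n), snd (\<omega> n)) \<partial>L) =
    (\<integral>\<^sup>+\<omega>. \<integral>\<^sup>+u. F (hist_of f n \<omega>, fst (\<omega> n), u) \<partial>\<gamma> n (hist_of f n \<omega>) \<partial>L)"
proof -
  have "(\<lambda>x. past_hist f n (fst x) (fst (snd x))) \<in> past n \<Otimes>\<^sub>M S \<Otimes>\<^sub>M U \<rightarrow>\<^sub>M hist_space Z U n"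
    using measurable_compose[OF _ measurable_past_hist[OF view], of "\<lambda>x. (fst x, fst (snd x))"
        "past n \<Otimes>\<^sub>M S \<Otimes>\<^sub>M U" n U] by simp
  then have "(\<lambda>(w, s, u). F (past_hist f n w s, s, u)) \<in> borel_measurable (past n \<Otimes>\<^sub>M S \<Otimes>\<^sub>M U)"
    by (simp add: split_def)
  from nn_integral_action[OF this] show ?thesis
    by (simp add: hist_of_eq_past_hist split_beta')
qed

lemma nn_integral_next_state_hist:
  assumes F[measurable]: "F \<in> borel_measurable (hist_space Z U n \<Otimes>\<^sub>M U \<Otimes>\<^sub>M S)"
  shows "(\<integral>\<^sup>+\<omega>. F (hist_of f n \<omega>, snd (\<omega> n), fst (\<omega> (Suc n))) \<partial>L) =
    (\<integral>\<^sup>+\<omega>. \<integral>\<^sup>+s. F (hist_of f n \<omega>, snd (\<omega> n), s) \<partial>T (\<omega> n) \<partial>L)"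
proof -
  have [measurable]: "hist_of f n \<in> past (Suc n) \<rightarrow>\<^sub>M hist_space Z U n"
    by (rule measurable_hist_of[OF view]) auto
  have [measurable]: "(\<lambda>w. w n) \<in> past (Suc n) \<rightarrow>\<^sub>M S \<Otimes>\<^sub>M U"
    by (rule measurable_component_singleton) simp
  have "(\<lambda>(w, s). F (hist_of f n w, snd (w n), s)) \<in> borel_measurable (past (Suc n) \<Otimes>\<^sub>M S)"
    unfolding split_def by measurable
  moreover have "hist_of f n (restrict \<omega> {0..<Suc n}) = hist_of f n \<omega>" for \<omega> :: "nat \<Rightarrow> 's \<times> 'u"
    by (auto simp: hist_of_def fun_eq_iff)
  ultimately show ?thesis
    using nn_integral_state[of "\<lambda>(w, s). F (hist_of f n w, snd (w n), s)" "Suc n"]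
    by (simp add: state_kernel_def)
qed

text \<open>The conditional laws of states and actions characterize the trajectory law: together they give the
disintegration along the step kernel, which determines the marginals on \<open>{0..<n}\<close> by induction, and
these determine a measure on the infinite product. This is how a process built from one model is
recognized as the process of the other model.\<close>

lemma path_law_unique:
  assumes N: "prob_space N" and sets_N: "sets N = sets paths"
    and state: "\<And>n F. F \<in> borel_measurable (past n \<Otimes>\<^sub>M S) \<Longrightarrow>
      (\<integral>\<^sup>+\<omega>. F (restrict \<omega> {0..<n}, fst (\<omega> n)) \<partial>N) =
      (\<integral>\<^sup>+\<omega>. \<integral>\<^sup>+s. F (restrict \<omega> {0..<n}, s) \<partial>state_kernel n (restrict \<omega> {0..<n}) \<partial>N)"
    and action: "\<And>n F. F \<in> borel_measurable (past n \<Otimes>\<^sub>M S \<Otimes>\<^sub>M U) \<Longrightarrow>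
      (\<integral>\<^sup>+\<omega>. F (restrict \<omega> {0..<n}, fst (\<omega> n), snd (\<omega> n)) \<partial>N) =
      (\<integral>\<^sup>+\<omega>. \<integral>\<^sup>+u. F (restrict \<omega> {0..<n}, fst (\<omega> n), u) \<partial>\<gamma> n (hist_of f n \<omega>) \<partial>N)"
  shows "N = path_law S U s0 T f \<gamma>"
proof -
  let ?K = "step_kernel S U s0 T f \<gamma>"
  note meas_N = measurable_cong_sets[OF sets_N refl]
  have space_N: "space N = space paths" by (rule sets_eq_imp_space_eq[OF sets_N])
  have disint: "(\<integral>\<^sup>+\<omega>. F (restrict \<omega> {0..<n}, \<omega> n) \<partial>N) =
      (\<integral>\<^sup>+\<omega>. \<integral>\<^sup>+z. F (restrict \<omega> {0..<n}, z) \<partial>?K n (restrict \<omega> {0..<n}) \<partial>N)"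
    if F[measurable]: "F \<in> borel_measurable (past n \<Otimes>\<^sub>M S \<Otimes>\<^sub>M U)" for n F
  proof -
    define G where "G = (\<lambda>(w, s). \<integral>\<^sup>+u. F (w, s, u) \<partial>act_kernel n w s)"
    have G[measurable]: "G \<in> borel_measurable (past n \<Otimes>\<^sub>M S)"
      using nn_integral_kernel_measurable[of "\<lambda>x u. F (fst x, snd x, u)" "past n \<Otimes>\<^sub>M S" U
          "\<lambda>x. act_kernel n (fst x) (snd x)"] measurable_act_kernel[of n]
      unfolding G_def split_def by simp
    have "(\<integral>\<^sup>+\<omega>. F (restrict \<omega> {0..<n}, \<omega> n) \<partial>N) =
        (\<integral>\<^sup>+\<omega>. G (restrict \<omega> {0..<n}, fst (\<omega> n)) \<partial>N)"
      using action[OF F] unfolding G_def act_kernel_def hist_of_eq_past_hist by simp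
    also have "\<dots> = (\<integral>\<^sup>+\<omega>. \<integral>\<^sup>+z. F (restrict \<omega> {0..<n}, z) \<partial>?K n (restrict \<omega> {0..<n}) \<partial>N)"
      unfolding state[OF G]
    proof (rule nn_integral_cong)
      fix \<omega> assume "\<omega> \<in> space N"
      then have w: "restrict \<omega> {0..<n} \<in> space (past n)"
        using measurable_space[OF measurable_restrict_past] by (simp add: space_N)
      show "(\<integral>\<^sup>+s. G (restrict \<omega> {0..<n}, s) \<partial>state_kernel n (restrict \<omega> {0..<n})) =
          (\<integral>\<^sup>+z. F (restrict \<omega> {0..<n}, z) \<partial>?K n (restrict \<omega> {0..<n}))"
        using w by (subst nn_integral_step_kernel[OF w]) (auto simp: G_def)
    qed
    finally show ?thesis .
  qed
  have marg: "distr N (past n) (\<lambda>\<omega>. restrict \<omega> {0..<n}) = IT.C 0 n (\<lambda>_. undefined)" for n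
  proof (induction n)
    case 0
    have "distr N (past 0) (\<lambda>\<omega>. restrict \<omega> {0..<0}) = distr N (past 0) (\<lambda>\<omega>. (\<lambda>_. undefined))"
      by (rule distr_cong) (auto simp: restrict_def)
    then show ?case
      using prob_space.distr_const[OF N undefined_in_past0] by simp
  next
    case (Suc n)
    show ?case
    proof (rule measure_eqI)
      show "sets (distr N (past (Suc n)) (\<lambda>\<omega>. restrict \<omega> {0..<Suc n})) = sets (IT.C 0 (Suc n) (\<lambda>_. undefined))"
        using IT.sets_C[OF undefined_in_past0, of "Suc n"] by simp
      fix A assume "A \<in> sets (distr N (past (Suc n)) (\<lambda>\<omega>. restrict \<omega> {0..<Suc n}))"
      then have A[measurable]: "A \<in> sets (past (Suc n))" by simp
      have upd[measurable]: "(\<lambda>(w, z). indicator A (w(n := z)) :: ennreal)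
          \<in> borel_measurable (past n \<Otimes>\<^sub>M (S \<Otimes>\<^sub>M U))"
        using measurable_compose[OF measurable_fun_upd_past borel_measurable_indicator[OF A]]
        by (simp add: split_def)
      have "emeasure (distr N (past (Suc n)) (\<lambda>\<omega>. restrict \<omega> {0..<Suc n})) A =
          (\<integral>\<^sup>+\<omega>. indicator A (restrict \<omega> {0..<Suc n}) \<partial>N)"
        by (subst nn_integral_indicator[symmetric], simp, subst nn_integral_distr) (simp_all add: meas_N)
      also have "\<dots> = (\<integral>\<^sup>+\<omega>. (\<lambda>(w, z). indicator A (w(n := z))) (restrict \<omega> {0..<n}, \<omega> n) \<partial>N)"
        by (auto intro!: nn_integral_cong arg_cong[where f="indicator A"] simp: fun_eq_iff)
      also have "\<dots> = (\<integral>\<^sup>+\<omega>. (\<lambda>w. \<integral>\<^sup>+z. indicator A (w(n := z)) \<partial>?K n w) (restrict \<omega> {0..<n}) \<partial>N)"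
        by (subst disint[OF upd]) simp
      also have "\<dots> = (\<integral>\<^sup>+w. \<integral>\<^sup>+z. indicator A (w(n := z)) \<partial>?K n w \<partial>IT.C 0 n (\<lambda>_. undefined))"
        unfolding Suc[symmetric]
      proof (rule nn_integral_distr[symmetric])
        show "(\<lambda>\<omega>. restrict \<omega> {0..<n}) \<in> N \<rightarrow>\<^sub>M past n"
          unfolding meas_N by (rule measurable_restrict_past)
        show "(\<lambda>w. \<integral>\<^sup>+z. indicator A (w(n := z)) \<partial>?K n w) \<in> borel_measurable (distr N (past n) (\<lambda>\<omega>. restrict \<omega> {0..<n}))"
          using nn_integral_kernel_measurable[OF upd measurable_step_kernel] by simp
      qed
      also have "\<dots> = (\<integral>\<^sup>+w. emeasure (IT.eP n w) A \<partial>IT.C 0 n (\<lambda>_. undefined))"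
        using IT.space_C[OF undefined_in_past0, of n]
        by (intro nn_integral_cong)
           (auto simp: IT.nn_integral_eP[symmetric] IT.sets_eP simp flip: nn_integral_indicator)
      also have "\<dots> = emeasure (IT.C 0 (Suc n) (\<lambda>_. undefined)) A"
      proof -
        have "IT.eP n \<in> IT.C 0 n (\<lambda>_. undefined) \<rightarrow>\<^sub>M subprob_algebra (past (Suc n))"
          using IT.sets_C[OF undefined_in_past0, of n]
          by (subst measurable_cong_sets[of _ "past n"]) (simp, rule refl, rule IT.measurable_eP)
        moreover have "space (IT.C 0 n (\<lambda>_. undefined)) \<noteq> {}"
          using prob_space.not_empty[OF IT.prob_space_C[OF undefined_in_past0]] .
        ultimately show ?thesis
          by (simp add: emeasure_bind[where N="past (Suc n)"])
      qed
      finally show "emeasure (distr N (past (Suc n)) (\<lambda>\<omega>. restrict \<omega> {0..<Suc n})) A =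
          emeasure (IT.C 0 (Suc n) (\<lambda>_. undefined)) A" .
    qed
  qed
  have "N = L"
  proof (rule measure_eqI_PiM_infinite[OF sets_N sets_L])
    show "finite_measure N" using N by (simp add: prob_space_def)
    fix A :: "nat \<Rightarrow> ('s \<times> 'u) set" and J :: "nat set"
    assume J: "finite J" and A: "\<And>i. i \<in> J \<Longrightarrow> A i \<in> sets (S \<Otimes>\<^sub>M U)"
    \<comment> \<open>Every cylinder set is a preimage under the restriction to some initial segment.\<close>
    obtain n where n: "J \<subseteq> {0..<n}"
      using J by (metis atLeast0LessThan finite_nat_iff_bounded)
    let ?X = "prod_emb {0..<n} (\<lambda>_. S \<Otimes>\<^sub>M U) J (Pi\<^sub>E J A)"
    have X: "?X \<in> sets (past n)"
      using J A n by (intro sets_PiM_I) auto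
    have "prod_emb UNIV (\<lambda>_. S \<Otimes>\<^sub>M U) J (Pi\<^sub>E J A) = prod_emb UNIV (\<lambda>_. S \<Otimes>\<^sub>M U) {0..<n} ?X"
      using n by (simp add: prod_emb_trans)
    then show "emeasure N (prod_emb UNIV (\<lambda>_. S \<Otimes>\<^sub>M U) J (Pi\<^sub>E J A)) =
        emeasure L (prod_emb UNIV (\<lambda>_. S \<Otimes>\<^sub>M U) J (Pi\<^sub>E J A))"
      using emeasure_distr_restrict[OF subset_UNIV sets_N X] emeasure_distr_restrict[OF subset_UNIV sets_L X]
      by (simp add: marg distr_L)
  qed
  then show ?thesis by (simp add: L_def)
qed

end

section \<open>Integrals against kernels and regular conditional laws\<close>

lemma in_prob_algebraD:
  assumes "\<nu> \<in> space (prob_algebra A)"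
  shows "prob_space \<nu>" "sets \<nu> = sets A" "space \<nu> = space A" "measurable \<nu> B = measurable A B"
  using assms by (auto simp: space_prob_algebra dest: sets_eq_imp_space_eq intro: measurable_cong_sets)

lemma nn_integral_bind_prob:
  assumes A: "A \<in> space (prob_algebra N)" and B: "B \<in> N \<rightarrow>\<^sub>M prob_algebra K"
    and F: "F \<in> borel_measurable K"
  shows "(\<integral>\<^sup>+x. F x \<partial>(A \<bind> B)) = (\<integral>\<^sup>+y. \<integral>\<^sup>+x. F x \<partial>B y \<partial>A)"
  using measurable_prob_algebraD[OF B]
  by (intro nn_integral_bind[OF F]) (simp add: in_prob_algebraD[OF A])

lemma nn_integral_swap_prob:
  assumes A: "A \<in> space (prob_algebra N)" and B: "B \<in> space (prob_algebra K)"
    and F: "(\<lambda>(x, y). F x y) \<in> borel_measurable (N \<Otimes>\<^sub>M K)"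
  shows "(\<integral>\<^sup>+x. \<integral>\<^sup>+y. F x y \<partial>B \<partial>A) = (\<integral>\<^sup>+y. \<integral>\<^sup>+x. F x y \<partial>A \<partial>B)"
proof -
  interpret A: prob_space A by (rule in_prob_algebraD[OF A])
  interpret B: prob_space B by (rule in_prob_algebraD[OF B])
  interpret pair_sigma_finite A B ..
  have "(\<lambda>(x, y). F x y) \<in> borel_measurable (A \<Otimes>\<^sub>M B)"
    using F measurable_cong_sets[OF sets_pair_measure_cong[OF in_prob_algebraD(2)[OF A] in_prob_algebraD(2)[OF B]] refl]
    by blast
  then show ?thesis using Fubini' by (simp add: split_def)
qed

text \<open>For the \<open>\<sigma>\<close>-field generated by a random element \<open>h\<close>, a kernel evaluated at \<open>h\<close> is a regular
conditional law as soon as it gives the right integrals over products of indicators, because every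
set of that \<open>\<sigma>\<close>-field is the preimage of a set under \<open>h\<close>.\<close>

lemma regular_cond_lawI:
  assumes P: "prob_space P" and h[measurable]: "h \<in> P \<rightarrow>\<^sub>M H" and Z[measurable]: "Z \<in> P \<rightarrow>\<^sub>M S"
    and \<kappa>: "\<kappa> \<in> H \<rightarrow>\<^sub>M prob_algebra S"
    and eq: "\<And>B C. B \<in> sets H \<Longrightarrow> C \<in> sets S \<Longrightarrow>
      (\<integral>\<^sup>+\<omega>. indicator B (h \<omega>) * indicator C (Z \<omega>) \<partial>P) =
      (\<integral>\<^sup>+\<omega>. indicator B (h \<omega>) * emeasure (\<kappa> (h \<omega>)) C \<partial>P)"
  shows "regular_cond_law P (vimage_algebra (space P) h H) S Z (\<lambda>\<omega>. \<kappa> (h \<omega>))"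
proof -
  let ?F = "vimage_algebra (space P) h H"
  interpret prob_space P by fact
  have hs: "h \<in> space P \<rightarrow> space H" using measurable_space[OF h] by auto
  have sub: "subalgebra P ?F"
    using h hs by (auto simp: subalgebra_def sets_vimage_algebra2 measurable_sets)
  interpret finite_measure_subalgebra P ?F
    by unfold_locales (rule sub)
  have hF: "h \<in> ?F \<rightarrow>\<^sub>M H"
    using hs by (rule measurable_vimage_algebra1)
  have AE: "AE \<omega> in P. real_cond_exp P ?F (\<lambda>\<omega>. indicator C (Z \<omega>)) \<omega> = measure (\<kappa> (h \<omega>)) C"
    if C[measurable]: "C \<in> sets S" for C
  proof (rule real_cond_exp_charact)
    have m: "(\<lambda>x. measure (\<kappa> x) C) \<in> borel_measurable H"
      using measurable_compose[OF \<kappa> measurable_measure_prob_algebra[OF C]] .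
    have mP[measurable]: "(\<lambda>\<omega>. measure (\<kappa> (h \<omega>)) C) \<in> borel_measurable P"
      using measurable_compose[OF h m] .
    show "(\<lambda>\<omega>. measure (\<kappa> (h \<omega>)) C) \<in> borel_measurable ?F"
      using measurable_compose[OF hF m] .
    have pk: "prob_space (\<kappa> (h \<omega>))" if "\<omega> \<in> space P" for \<omega>
      using measurable_space[OF \<kappa> measurable_space[OF h that]] by (simp add: space_prob_algebra)
    show "integrable P (\<lambda>\<omega>. indicator C (Z \<omega>) :: real)"
      by (rule integrable_const_bound[where B=1]) (auto simp: indicator_def)
    show "integrable P (\<lambda>\<omega>. measure (\<kappa> (h \<omega>)) C)"
      by (rule integrable_const_bound[where B=1]) (auto intro!: AE_I2 prob_space.prob_le_1 pk)
    fix A assume "A \<in> sets ?F"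
    then obtain B where B[measurable]: "B \<in> sets H" and A: "A = h -` B \<inter> space P"
      using hs by (auto simp: sets_vimage_algebra2)
    have "(\<integral>\<omega>. indicator A \<omega> * indicator C (Z \<omega>) \<partial>P) = (\<integral>\<omega>. indicator A \<omega> * measure (\<kappa> (h \<omega>)) C \<partial>P)"
    proof (subst (1 2) integral_eq_nn_integral)
      show "(\<lambda>\<omega>. indicator A \<omega> * indicator C (Z \<omega>) :: real) \<in> borel_measurable P"
        "(\<lambda>\<omega>. indicator A \<omega> * measure (\<kappa> (h \<omega>)) C) \<in> borel_measurable P"
        unfolding A by measurable
      have 1: "(\<integral>\<^sup>+\<omega>. ennreal (indicator A \<omega> * indicator C (Z \<omega>)) \<partial>P) =
          (\<integral>\<^sup>+\<omega>. indicator B (h \<omega>) * indicator C (Z \<omega>) \<partial>P)"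
        by (rule nn_integral_cong) (auto simp: A indicator_def)
      have 2: "(\<integral>\<^sup>+\<omega>. ennreal (indicator A \<omega> * measure (\<kappa> (h \<omega>)) C) \<partial>P) =
          (\<integral>\<^sup>+\<omega>. indicator B (h \<omega>) * emeasure (\<kappa> (h \<omega>)) C \<partial>P)"
        using pk by (intro nn_integral_cong)
          (auto simp: A indicator_def prob_space_def finite_measure.emeasure_eq_measure)
      show "enn2real (\<integral>\<^sup>+\<omega>. ennreal (indicator A \<omega> * indicator C (Z \<omega>)) \<partial>P) =
          enn2real (\<integral>\<^sup>+\<omega>. ennreal (indicator A \<omega> * measure (\<kappa> (h \<omega>)) C) \<partial>P)"
        unfolding 1 2 eq[OF B C] ..
    qed (auto simp: indicator_def)
    then show "(\<integral>\<omega>\<in>A. indicator C (Z \<omega>) \<partial>P) = (\<integral>\<omega>\<in>A. measure (\<kappa> (h \<omega>)) C \<partial>P)"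
      by (simp add: set_lebesgue_integral_def)
  qed
  show ?thesis
    unfolding regular_cond_law_def
    using sub Z AE measurable_compose[OF hF \<kappa>] by blast
qed

section \<open>Observation labels and prediction\<close>

locale observed_model =
  fixes M :: "('x, 'u, 'e, 'v) po_model"
  assumes valid: "valid_po_model M"
begin

abbreviation "S \<equiv> states M"
abbreviation "U \<equiv> actions M"
abbreviation "Y \<equiv> obs_space M"
abbreviation "H \<equiv> hist_space (obs_space M) (actions M)"

lemma init_law_in: "init_law M \<in> space (prob_algebra S)"
  using valid by (simp add: valid_po_model_def)

lemma ref_law_in: "k \<in> obs_labels M \<Longrightarrow> ref_law M k \<in> space (prob_algebra S)"
  and ref_law_obs_set: "k \<in> obs_labels M \<Longrightarrow> measure (ref_law M k) (obs_set M k) = 1"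
  using valid by (auto simp: valid_po_model_def)

lemma finite_obs_labels: "finite (obs_labels M)"
  by (simp add: obs_labels_def)

lemma obs_set_sets[measurable]:
  assumes "j \<in> {1..Suc (n_obs M)}" shows "obs_set M j \<in> sets S"
proof -
  have cells: "(\<Union>i\<in>cell_idx M l. cell M i) \<in> sets S" if "l \<in> {1..n_obs M}" for l
  proof (rule sets.finite_UN)
    have "cell_idx M l \<subseteq> {1..n_cells M}" using valid that by (auto simp: valid_po_model_def)
    then show "finite (cell_idx M l)" "\<And>i. i \<in> cell_idx M l \<Longrightarrow> cell M i \<in> sets S"
      using valid finite_subset by (auto simp: valid_po_model_def)
  qed
  show ?thesis
    unfolding obs_set_def using assms cells by auto
qed

lemma obs_labels_sets: "k \<in> obs_labels M \<Longrightarrow> obs_set M k \<in> sets S"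
  by (rule obs_set_sets) (simp add: obs_labels_def)

text \<open>The unions over disjoint index sets of disjoint cells are disjoint, and the last observation set is
the complement of the others; hence each state carries exactly one label.\<close>

lemma obs_set_unique:
  assumes x: "x \<in> space S"
  shows "\<exists>!j. j \<in> {1..Suc (n_obs M)} \<and> x \<in> obs_set M j"
proof -
  have idx: "cell_idx M j \<subseteq> {1..n_cells M}" if "j \<in> {1..n_obs M}" for j
    using valid that by (auto simp: valid_po_model_def)
  have disj_idx: "cell_idx M j \<inter> cell_idx M k = {}" if "j \<in> {1..n_obs M}" "k \<in> {1..n_obs M}" "j \<noteq> k" for j k
    using valid that by (auto simp: valid_po_model_def disjoint_family_on_def)
  have disj_cell: "cell M i \<inter> cell M l = {}" if "i \<in> {1..n_cells M}" "l \<in> {1..n_cells M}" "i \<noteq> l" for i l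
    using valid that by (auto simp: valid_po_model_def disjoint_family_on_def)
  have disj: "obs_set M j \<inter> obs_set M k = {}" if "j \<in> {1..n_obs M}" "k \<in> {1..n_obs M}" "j \<noteq> k" for j k
  proof (rule ccontr)
    assume "obs_set M j \<inter> obs_set M k \<noteq> {}"
    moreover have "obs_set M j = (\<Union>i\<in>cell_idx M j. cell M i)" "obs_set M k = (\<Union>i\<in>cell_idx M k. cell M i)"
      using that by (auto simp: obs_set_def)
    ultimately obtain y i l where y: "i \<in> cell_idx M j" "y \<in> cell M i" "l \<in> cell_idx M k" "y \<in> cell M l"
      by auto
    then have "i = l" using disj_cell[of i l] idx that by blast
    then show False using disj_idx[OF that] y by blast
  qed
  show ?thesis
  proof (cases "\<exists>j\<in>{1..n_obs M}. x \<in> obs_set M j")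
    case True
    then obtain j where j: "j \<in> {1..n_obs M}" "x \<in> obs_set M j" by blast
    then have "x \<notin> obs_set M (Suc (n_obs M))" by (auto simp: obs_set_def)
    then show ?thesis
      using j disj by (intro ex1I[of _ j]) (auto simp: le_Suc_eq)
  next
    case False
    then have "x \<in> obs_set M (Suc (n_obs M))"
      using x by (auto simp: obs_set_def)
    with False show ?thesis
      by (intro ex1I[of _ "Suc (n_obs M)"]) (auto simp: le_Suc_eq)
  qed
qed

lemma obs_eq_iff:
  assumes "x \<in> space S" "j \<in> {1..Suc (n_obs M)}"
  shows "obs M x = j \<longleftrightarrow> x \<in> obs_set M j"
  unfolding obs_def using theI'[OF obs_set_unique[OF assms(1)]] obs_set_unique[OF assms(1)] assms(2)
  by blast

lemma obs_in_labels: assumes x: "x \<in> space S" shows "obs M x \<in> obs_labels M"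
  using theI'[OF obs_set_unique[OF x]] unfolding obs_def[symmetric] obs_labels_def by auto

lemma obs_eq_iff_label:
  assumes "x \<in> space S" "k \<in> obs_labels M"
  shows "obs M x = k \<longleftrightarrow> x \<in> obs_set M k"
  using assms(2) by (intro obs_eq_iff assms(1)) (simp add: obs_labels_def)

lemma measurable_obs[measurable]: "obs M \<in> S \<rightarrow>\<^sub>M Y"
proof -
  have "obs M -` {k} \<inter> space S = obs_set M k" if k: "k \<in> obs_labels M" for k
    using obs_eq_iff_label[OF _ k] sets.sets_into_space[OF obs_labels_sets[OF k]] by auto
  then show ?thesis
    by (auto simp: measurable_count_space_eq2_countable finite_obs_labels countable_finite
        obs_labels_sets obs_in_labels)
qed

lemma measurable_trans_kernel[measurable]: "trans_kernel M \<in> S \<Otimes>\<^sub>M U \<rightarrow>\<^sub>M prob_algebra S"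
proof -
  have [measurable]: "dynamics M \<in> S \<Otimes>\<^sub>M U \<Otimes>\<^sub>M eta_law M \<Otimes>\<^sub>M eps_law M \<rightarrow>\<^sub>M S"
    and "eta_law M \<in> space (prob_algebra (eta_law M))" "eps_law M \<in> space (prob_algebra (eps_law M))"
    using valid by (simp_all add: valid_po_model_def space_prob_algebra)
  then show ?thesis
    unfolding trans_kernel_def split_def
    by (intro measurable_bind_prob_space2[where N="eta_law M"] measurable_const)
       (auto simp: split_def intro!: measurable_bind_prob_space2[where N="eps_law M"])
qed

lemma measurable_predict[measurable]:
  "(\<lambda>(\<mu>, u). predict M u \<mu>) \<in> prob_algebra S \<Otimes>\<^sub>M U \<rightarrow>\<^sub>M prob_algebra S"
  unfolding predict_def split_def
  by (rule measurable_bind_prob_space2[where N=S]) (simp_all add: split_def)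

lemma predict_in:
  assumes "\<mu> \<in> space (prob_algebra S)" "u \<in> space U"
  shows "predict M u \<mu> \<in> space (prob_algebra S)"
  using measurable_space[OF measurable_predict, of "(\<mu>, u)"] assms by (simp add: space_pair_measure)

lemma nn_integral_predict:
  assumes \<mu>: "\<mu> \<in> space (prob_algebra S)" and u: "u \<in> space U" and F: "F \<in> borel_measurable S"
  shows "(\<integral>\<^sup>+s. F s \<partial>predict M u \<mu>) = (\<integral>\<^sup>+x. \<integral>\<^sup>+s. F s \<partial>trans_kernel M (x, u) \<partial>\<mu>)"
  unfolding predict_def
  by (rule nn_integral_bind_prob[OF \<mu> _ F]) (use u in measurable)

section \<open>Conditioning on an observation label\<close>

text \<open>The conditional law of a state with law \<open>\<nu>\<close> given the label \<open>k\<close>, completed by the reference law on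
null labels. The initial filter and the filter step are this one operation, applied to the
initial law and to the predicted law.\<close>

definition cond_law :: "nat \<Rightarrow> 'x measure \<Rightarrow> 'x measure" where
  "cond_law k \<nu> = (if measure \<nu> (obs_set M k) > 0 then uniform_measure \<nu> (obs_set M k) else ref_law M k)"

lemma filter_step_eq: "filter_step M k \<mu> u = cond_law k (predict M u \<mu>)"
  by (simp add: filter_step_def cond_law_def obs_prob_def)

lemma init_filter_eq: "init_filter M k = cond_law k (init_law M)"
  by (simp add: init_filter_def cond_law_def)

lemma emeasure_pos_iff:
  assumes "\<nu> \<in> space (prob_algebra S)"
  shows "measure \<nu> A > 0 \<longleftrightarrow> emeasure \<nu> A \<noteq> 0" "emeasure \<nu> A \<noteq> \<infinity>"
proof -
  interpret prob_space \<nu> by (rule in_prob_algebraD[OF assms])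
  show "measure \<nu> A > 0 \<longleftrightarrow> emeasure \<nu> A \<noteq> 0" "emeasure \<nu> A \<noteq> \<infinity>"
    by (auto simp: emeasure_eq_measure zero_less_measure_iff)
qed

lemma cond_law_in:
  assumes k: "k \<in> obs_labels M" and \<nu>: "\<nu> \<in> space (prob_algebra S)"
  shows "cond_law k \<nu> \<in> space (prob_algebra S)"
  using ref_law_in[OF k] emeasure_pos_iff[OF \<nu>] \<nu>
  by (auto simp: cond_law_def space_prob_algebra intro!: prob_space_uniform_measure)

lemma cond_law_obs_set:
  assumes k: "k \<in> obs_labels M" and \<nu>: "\<nu> \<in> space (prob_algebra S)"
  shows "measure (cond_law k \<nu>) (obs_set M k) = 1"
  using ref_law_obs_set[OF k] emeasure_pos_iff[OF \<nu>, of "obs_set M k"] obs_labels_sets[OF k] \<nu>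
  by (auto simp: cond_law_def space_prob_algebra)

text \<open>There are finitely many labels, so each one can be treated separately; for a fixed label the measure
of a set is a quotient of two evaluations on the measurable region where the label has positive
probability, and constant elsewhere.\<close>

lemma measurable_cond_law[measurable]:
  "(\<lambda>(k, \<nu>). cond_law k \<nu>) \<in> Y \<Otimes>\<^sub>M prob_algebra S \<rightarrow>\<^sub>M prob_algebra S"
proof (rule measurable_pair_measure_countable1)
  show "countable (obs_labels M)" using finite_obs_labels by (rule countable_finite)
  fix k assume k: "k \<in> obs_labels M"
  note [measurable] = obs_labels_sets[OF k]
  have "cond_law k \<in> prob_algebra S \<rightarrow>\<^sub>M prob_algebra S"
  proof (rule measurable_prob_algebraI)
    show "prob_space (cond_law k \<nu>)" if "\<nu> \<in> space (prob_algebra S)" for \<nu>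
      using cond_law_in[OF k that] by (simp add: space_prob_algebra)
    show "cond_law k \<in> prob_algebra S \<rightarrow>\<^sub>M subprob_algebra S"
    proof (rule measurable_subprob_algebra)
      fix \<nu> assume \<nu>: "\<nu> \<in> space (prob_algebra S)"
      show "subprob_space (cond_law k \<nu>)" "sets (cond_law k \<nu>) = sets S"
        using cond_law_in[OF k \<nu>] by (auto simp: space_prob_algebra prob_space_imp_subprob_space)
    next
      fix C assume C[measurable]: "C \<in> sets S"
      have [measurable]: "(\<lambda>\<nu>. emeasure \<nu> A) \<in> borel_measurable (prob_algebra S)" if "A \<in> sets S" for A
        unfolding prob_algebra_def using that by (intro measurable_restrict_space1) measurable
      have "(\<lambda>\<nu>. if measure \<nu> (obs_set M k) > 0 then emeasure \<nu> (obs_set M k \<inter> C) / emeasure \<nu> (obs_set M k)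
          else emeasure (ref_law M k) C) \<in> borel_measurable (prob_algebra S)"
        by measurable
      then show "(\<lambda>\<nu>. emeasure (cond_law k \<nu>) C) \<in> borel_measurable (prob_algebra S)"
        by (rule measurable_cong[THEN iffD1, rotated])
           (auto simp: cond_law_def space_prob_algebra obs_labels_sets[OF k] C)
    qed
  qed
  then show "(\<lambda>\<nu>. case (k, \<nu>) of (k, \<nu>) \<Rightarrow> cond_law k \<nu>) \<in> prob_algebra S \<rightarrow>\<^sub>M prob_algebra S"
    by simp
qed

lemma nn_integral_split_obs:
  assumes \<nu>: "\<nu> \<in> space (prob_algebra S)" and G: "G \<in> borel_measurable (Y \<Otimes>\<^sub>M S)"
  shows "(\<integral>\<^sup>+s. G (obs M s, s) \<partial>\<nu>) = (\<Sum>k\<in>obs_labels M. \<integral>\<^sup>+s. G (k, s) * indicator (obs_set M k) s \<partial>\<nu>)"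
proof -
  have "(\<integral>\<^sup>+s. G (obs M s, s) \<partial>\<nu>) = (\<integral>\<^sup>+s. (\<Sum>k\<in>obs_labels M. G (k, s) * indicator (obs_set M k) s) \<partial>\<nu>)"
  proof (rule nn_integral_cong)
    fix s assume "s \<in> space \<nu>"
    then have s: "s \<in> space S" using in_prob_algebraD(3)[OF \<nu>] by simp
    have "(\<Sum>k\<in>obs_labels M. G (k, s) * indicator (obs_set M k) s) =
        (\<Sum>k\<in>obs_labels M. if k = obs M s then G (k, s) else 0)"
      using obs_eq_iff_label[OF s] by (intro sum.cong) (auto simp: indicator_def)
    then show "G (obs M s, s) = (\<Sum>k\<in>obs_labels M. G (k, s) * indicator (obs_set M k) s)"
      using obs_in_labels[OF s] finite_obs_labels by simp
  qed
  also have "\<dots> = (\<Sum>k\<in>obs_labels M. \<integral>\<^sup>+s. G (k, s) * indicator (obs_set M k) s \<partial>\<nu>)"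
  proof (rule nn_integral_sum)
    fix k assume k: "k \<in> obs_labels M"
    have "(\<lambda>s. G (k, s)) \<in> borel_measurable S"
      using k by (intro measurable_compose[OF _ G]) simp
    then show "(\<lambda>s. G (k, s) * indicator (obs_set M k) s) \<in> borel_measurable \<nu>"
      using obs_labels_sets[OF k] by (simp add: in_prob_algebraD(4)[OF \<nu>])
  qed
  finally show ?thesis .
qed

text \<open>Bayes' formula: resampling the state from its conditional law given its label does not change
the joint law of label and state. On the set \<open>obs_set M k\<close> the label is constant and the conditional
law is the normalized restriction of \<open>\<nu>\<close>; a null label contributes zero to both sides.\<close>

lemma bayes_observation:
  assumes \<nu>: "\<nu> \<in> space (prob_algebra S)" and G: "G \<in> borel_measurable (Y \<Otimes>\<^sub>M S)"
  shows "(\<integral>\<^sup>+s. G (obs M s, s) \<partial>\<nu>) = (\<integral>\<^sup>+s. \<integral>\<^sup>+x. G (obs M s, x) \<partial>cond_law (obs M s) \<nu> \<partial>\<nu>)"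
proof -
  define G' where "G' = (\<lambda>(k, s :: 'x). \<integral>\<^sup>+x. G (k, x) \<partial>cond_law k \<nu>)"
  have "(\<lambda>z. \<integral>\<^sup>+x. G (fst z, x) \<partial>cond_law (fst z) \<nu>) \<in> borel_measurable (Y \<Otimes>\<^sub>M S)"
  proof (rule nn_integral_kernel_measurable[where B=S])
    have "(\<lambda>p. G (fst (fst p), snd p)) \<in> borel_measurable ((Y \<Otimes>\<^sub>M S) \<Otimes>\<^sub>M S)"
      by (rule measurable_compose[OF _ G]) measurable
    then show "(\<lambda>(z, x). G (fst z, x)) \<in> borel_measurable ((Y \<Otimes>\<^sub>M S) \<Otimes>\<^sub>M S)"
      by (simp add: split_def)
    show "(\<lambda>z. cond_law (fst z) \<nu>) \<in> Y \<Otimes>\<^sub>M S \<rightarrow>\<^sub>M prob_algebra S"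
      using measurable_compose[OF _ measurable_cond_law, of "\<lambda>z. (fst z, \<nu>)"] \<nu> by simp
  qed
  then have G': "G' \<in> borel_measurable (Y \<Otimes>\<^sub>M S)"
    by (simp add: G'_def split_def)
  have "(\<integral>\<^sup>+s. G (k, s) * indicator (obs_set M k) s \<partial>\<nu>) = (\<integral>\<^sup>+s. G' (k, s) * indicator (obs_set M k) s \<partial>\<nu>)"
    if k: "k \<in> obs_labels M" for k
  proof -
    note O = obs_labels_sets[OF k, folded in_prob_algebraD(2)[OF \<nu>]]
    have Gk: "(\<lambda>s. G (k, s)) \<in> borel_measurable \<nu>"
      unfolding in_prob_algebraD(4)[OF \<nu>] using k by (intro measurable_compose[OF _ G]) simp
    have *: "(\<integral>\<^sup>+s. G' (k, s) * indicator (obs_set M k) s \<partial>\<nu>) =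
        (\<integral>\<^sup>+x. G (k, x) \<partial>cond_law k \<nu>) * emeasure \<nu> (obs_set M k)"
      using O by (simp add: G'_def nn_integral_cmult)
    show ?thesis
    proof (cases "measure \<nu> (obs_set M k) > 0")
      case True
      then have "emeasure \<nu> (obs_set M k) \<noteq> 0" "emeasure \<nu> (obs_set M k) \<noteq> \<infinity>"
        using emeasure_pos_iff[OF \<nu>] by auto
      with True show ?thesis
        unfolding * cond_law_def
        by (simp add: nn_integral_uniform_measure[OF Gk O] mult.commute[of "_ / _"] ennreal_times_divide)
           (simp add: mult.commute[of "emeasure _ _"] ennreal_mult_divide_eq)
    next
      case False
      then have "emeasure \<nu> (obs_set M k) = 0" using emeasure_pos_iff[OF \<nu>] by auto
      moreover from this have "(\<integral>\<^sup>+s. G (k, s) * indicator (obs_set M k) s \<partial>\<nu>) = 0"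
        using O Gk by (subst nn_integral_0_iff_AE)
          (auto intro!: AE_I[where N="obs_set M k"] simp: indicator_def)
      ultimately show ?thesis unfolding * by simp
    qed
  qed
  then have "(\<integral>\<^sup>+s. G (obs M s, s) \<partial>\<nu>) = (\<integral>\<^sup>+s. G' (obs M s, s) \<partial>\<nu>)"
    unfolding nn_integral_split_obs[OF \<nu> G] nn_integral_split_obs[OF \<nu> G'] by (rule sum.cong[OF refl])
  then show ?thesis by (simp add: G'_def)
qed

section \<open>Information states and the information kernel\<close>

text \<open>The update of the information state as a function of the new hidden state, after the prediction \<open>\<nu>\<close>.
In this form the law of the next information state is an image measure.\<close>

definition extended_info :: "'x measure \<Rightarrow> 'x \<Rightarrow> 'x info" where
  "extended_info \<nu> s = (obs M s, cond_law (obs M s) \<nu>)"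

abbreviation "I \<equiv> info_space M"

lemma space_info_space: "space I = info_states M"
  by (auto simp: info_space_def space_restrict_space space_pair_measure info_states_def)

lemma measurable_info_spaceI:
  assumes f: "f \<in> A \<rightarrow>\<^sub>M Y" and g: "g \<in> A \<rightarrow>\<^sub>M prob_algebra S"
    and "\<And>x. x \<in> space A \<Longrightarrow> measure (g x) (obs_set M (f x)) = 1"
  shows "(\<lambda>x. (f x, g x)) \<in> A \<rightarrow>\<^sub>M I"
  unfolding info_space_def
proof (rule measurable_restrict_space2)
  show "(\<lambda>x. (f x, g x)) \<in> space A \<rightarrow> info_states M"
    using assms(3) measurable_space[OF f] measurable_space[OF g] by (auto simp: info_states_def)
  show "(\<lambda>x. (f x, g x)) \<in> A \<rightarrow>\<^sub>M Y \<Otimes>\<^sub>M prob_algebra S"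
    using f g by (rule measurable_Pair)
qed

lemma measurable_fst_info[measurable]: "fst \<in> I \<rightarrow>\<^sub>M Y"
  and measurable_snd_info[measurable]: "snd \<in> I \<rightarrow>\<^sub>M prob_algebra S"
  unfolding info_space_def by (auto intro!: measurable_restrict_space1)

lemma measurable_extended_info[measurable]:
  "(\<lambda>(\<nu>, s). extended_info \<nu> s) \<in> prob_algebra S \<Otimes>\<^sub>M S \<rightarrow>\<^sub>M I"
  unfolding extended_info_def split_def
proof (rule measurable_info_spaceI)
  show "(\<lambda>x. cond_law (obs M (snd x)) (fst x)) \<in> prob_algebra S \<Otimes>\<^sub>M S \<rightarrow>\<^sub>M prob_algebra S"
    using measurable_compose[OF _ measurable_cond_law, of "\<lambda>x. (obs M (snd x), fst x)"] by simp
  show "measure (cond_law (obs M (snd x)) (fst x)) (obs_set M (obs M (snd x))) = 1"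
    if "x \<in> space (prob_algebra S \<Otimes>\<^sub>M S)" for x
    using that by (intro cond_law_obs_set) (auto simp: space_pair_measure obs_in_labels)
qed measurable

lemma measurable_extended_info_right:
  assumes "\<nu> \<in> space (prob_algebra S)" shows "extended_info \<nu> \<in> S \<rightarrow>\<^sub>M I"
  using measurable_compose[OF measurable_Pair1'[OF assms] measurable_extended_info] by simp

text \<open>The finite mixture of point masses that defines the information kernel is the law of the updated
information state when the hidden state follows the predicted law: the label \<open>k\<close> occurs with
probability \<open>obs_prob M k \<mu> u\<close> and determines the update. Measurability and normalization of the
kernel are inherited from this representation.\<close>

lemma info_kernel_eq_distr:
  assumes \<mu>: "\<mu> \<in> space (prob_algebra S)" and u: "u \<in> space U"
  shows "info_kernel M ((j, \<mu>), u) = distr (predict M u \<mu>) I (extended_info (predict M u \<mu>))"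
proof -
  let ?\<nu> = "predict M u \<mu>"
  let ?D = "distr ?\<nu> I (extended_info ?\<nu>)"
  note \<nu> = predict_in[OF \<mu> u]
  interpret \<nu>: prob_space ?\<nu> by (rule in_prob_algebraD[OF \<nu>])
  have emeas: "(\<Sum>k\<in>obs_labels M. ennreal (obs_prob M k \<mu> u) * indicator D (k, filter_step M k \<mu> u)) = emeasure ?D D"
    if D: "D \<in> sets I" for D
  proof -
    have mD: "(\<lambda>(k, s :: 'x). indicator D (k, cond_law k ?\<nu>) :: ennreal) \<in> borel_measurable (Y \<Otimes>\<^sub>M S)"
    proof -
      have "(\<lambda>z. (fst z, cond_law (fst z) ?\<nu>)) \<in> Y \<Otimes>\<^sub>M S \<rightarrow>\<^sub>M I"
        using measurable_compose[OF _ measurable_cond_law, of "\<lambda>z. (fst z, ?\<nu>)" "Y \<Otimes>\<^sub>M S"] \<nu>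
        by (intro measurable_info_spaceI) (auto simp: space_pair_measure cond_law_obs_set)
      from measurable_compose[OF this borel_measurable_indicator[OF D]]
      show ?thesis by (simp add: split_def)
    qed
    have "emeasure ?D D = (\<integral>\<^sup>+s. indicator D (extended_info ?\<nu> s) \<partial>?\<nu>)"
      using measurable_extended_info_right[OF \<nu>] D
      by (subst nn_integral_distr[symmetric]) (auto simp: in_prob_algebraD(4)[OF \<nu>])
    also have "\<dots> = (\<Sum>k\<in>obs_labels M. \<integral>\<^sup>+s. indicator D (k, cond_law k ?\<nu>) * indicator (obs_set M k) s \<partial>?\<nu>)"
      using nn_integral_split_obs[OF \<nu> mD] by (simp add: extended_info_def)
    also have "\<dots> = (\<Sum>k\<in>obs_labels M. ennreal (obs_prob M k \<mu> u) * indicator D (k, filter_step M k \<mu> u))"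
    proof (rule sum.cong[OF refl])
      fix k assume k: "k \<in> obs_labels M"
      show "(\<integral>\<^sup>+s. indicator D (k, cond_law k ?\<nu>) * indicator (obs_set M k) s \<partial>?\<nu>) =
          ennreal (obs_prob M k \<mu> u) * indicator D (k, filter_step M k \<mu> u)"
        using obs_labels_sets[OF k] in_prob_algebraD(2)[OF \<nu>]
        by (subst nn_integral_cmult)
           (simp_all add: filter_step_eq obs_prob_def \<nu>.emeasure_eq_measure mult.commute)
    qed
    finally show ?thesis ..
  qed
  have "info_kernel M ((j, \<mu>), u) = measure_of (space I) (sets I) (emeasure ?D)"
    unfolding info_kernel_def prod.case
    by (rule measure_of_eq) (auto simp: sets.space_closed sets.sigma_sets_eq emeas)
  also have "\<dots> = ?D"
    using measure_of_of_measure[of ?D] by simp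
  finally show ?thesis .
qed

lemma measurable_info_kernel: "info_kernel M \<in> I \<Otimes>\<^sub>M U \<rightarrow>\<^sub>M prob_algebra I"
proof -
  have p: "(\<lambda>z. predict M (snd z) (snd (fst z))) \<in> I \<Otimes>\<^sub>M U \<rightarrow>\<^sub>M prob_algebra S"
    using measurable_compose[OF _ measurable_predict, of "\<lambda>z. (snd (fst z), snd z)" "I \<Otimes>\<^sub>M U"] by simp
  have "(\<lambda>z. distr (predict M (snd z) (snd (fst z))) I (extended_info (predict M (snd z) (snd (fst z)))))
      \<in> I \<Otimes>\<^sub>M U \<rightarrow>\<^sub>M prob_algebra I"
  proof (rule measurable_distr_prob_space2[OF p])
    show "(\<lambda>(z, s). extended_info (predict M (snd z) (snd (fst z))) s) \<in> (I \<Otimes>\<^sub>M U) \<Otimes>\<^sub>M S \<rightarrow>\<^sub>M I"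
      using measurable_compose[OF _ measurable_extended_info,
          of "\<lambda>x. (predict M (snd (fst x)) (snd (fst (fst x))), snd x)" "(I \<Otimes>\<^sub>M U) \<Otimes>\<^sub>M S"]
        measurable_compose[OF measurable_fst p] by (simp add: split_def)
  qed
  then show ?thesis
  proof (rule measurable_cong[THEN iffD1, rotated])
    fix z assume z: "z \<in> space (I \<Otimes>\<^sub>M U)"
    obtain j \<mu> u where "z = ((j, \<mu>), u)" by (metis prod.collapse)
    then show "distr (predict M (snd z) (snd (fst z))) I (extended_info (predict M (snd z) (snd (fst z)))) = info_kernel M z"
      using z info_kernel_eq_distr[of \<mu> u j] by (auto simp: space_pair_measure space_info_space info_states_def)
  qed
qed

lemma info_init_eq: "info_init M = distr (init_law M) I (extended_info (init_law M))"
  unfolding info_init_def extended_info_def init_filter_eq ..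

lemma info_init_in: "info_init M \<in> space (prob_algebra I)"
  unfolding info_init_eq
  using measurable_space[OF measurable_distr_prob_space[OF measurable_extended_info_right[OF init_law_in]] init_law_in] .

lemma measurable_hist_obs: "t \<le> n \<Longrightarrow> (\<lambda>h. fst h t) \<in> H n \<rightarrow>\<^sub>M Y"
  and measurable_hist_act: "t < n \<Longrightarrow> (\<lambda>h. snd h t) \<in> H n \<rightarrow>\<^sub>M U"
  unfolding hist_space_def
  by (auto intro!: measurable_compose[OF measurable_fst measurable_component_singleton]
      measurable_compose[OF measurable_snd measurable_component_singleton])

lemma filt_Suc_eq: "filt M (Suc t) h = cond_law (fst h (Suc t)) (predict M (snd h t) (filt M t h))"
  by (simp add: filter_step_eq)

lemma measurable_filt: "t \<le> n \<Longrightarrow> filt M t \<in> H n \<rightarrow>\<^sub>M prob_algebra S"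
proof (induction t)
  case 0
  show ?case
    using measurable_compose[OF _ measurable_cond_law, of "\<lambda>h. (fst h 0, init_law M)" "H n"]
      measurable_hist_obs[OF 0] init_law_in by (simp add: init_filter_eq)
next
  case (Suc t)
  have [measurable]: "filt M t \<in> H n \<rightarrow>\<^sub>M prob_algebra S" "(\<lambda>h. fst h (Suc t)) \<in> H n \<rightarrow>\<^sub>M Y"
      "(\<lambda>h. snd h t) \<in> H n \<rightarrow>\<^sub>M U"
    using Suc by (auto intro: measurable_hist_obs measurable_hist_act)
  have [measurable]: "(\<lambda>h. predict M (snd h t) (filt M t h)) \<in> H n \<rightarrow>\<^sub>M prob_algebra S"
    using measurable_compose[OF _ measurable_predict, of "\<lambda>h. (filt M t h, snd h t)" "H n"] by simp
  show ?case
    unfolding filt_Suc_eq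
    using measurable_compose[OF _ measurable_cond_law,
        of "\<lambda>h. (fst h (Suc t), predict M (snd h t) (filt M t h))" "H n"] by simp
qed

text \<open>Conditioning on a label puts all mass on its observation set, and so does the reference law of a null
label. Hence the filter never leaves the information state space.\<close>

lemma filt_obs_set:
  assumes "t \<le> n" "h \<in> space (H n)"
  shows "measure (filt M t h) (obs_set M (fst h t)) = 1"
proof (cases t)
  case 0
  then show ?thesis
    using measurable_space[OF measurable_hist_obs assms(2), of 0] init_law_in
    by (simp add: init_filter_eq cond_law_obs_set)
next
  case (Suc r)
  have "predict M (snd h r) (filt M r h) \<in> space (prob_algebra S)"
    using assms Suc measurable_space[OF measurable_hist_act assms(2), of r]
    by (intro predict_in measurable_space[OF measurable_filt assms(2)]) auto
  moreover have "fst h (Suc r) \<in> obs_labels M"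
    using measurable_space[OF measurable_hist_obs assms(2), of "Suc r"] assms Suc by simp
  ultimately show ?thesis
    unfolding Suc filt_Suc_eq by (rule cond_law_obs_set[rotated])
qed

lemma measurable_info_of: "t \<le> n \<Longrightarrow> info_of M t \<in> H n \<rightarrow>\<^sub>M I"
  unfolding info_of_def[abs_def]
  by (intro measurable_info_spaceI measurable_hist_obs measurable_filt filt_obs_set)

lemma filt_cong:
  assumes "\<And>i. i \<le> t \<Longrightarrow> fst h i = fst h' i" "\<And>i. i < t \<Longrightarrow> snd h i = snd h' i"
  shows "filt M t h = filt M t h'"
  using assms by (induction t) auto

lemma info_of_cong:
  assumes "\<And>i. i \<le> t \<Longrightarrow> fst h i = fst h' i" "\<And>i. i < t \<Longrightarrow> snd h i = snd h' i"
  shows "info_of M t h = info_of M t h'"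
  unfolding info_of_def using filt_cong[of t h h'] assms by auto

text \<open>Only the new label and the last action enter the update of the filter.\<close>

lemma filt_extend_hist:
  "filt M (Suc n) (extend_hist n h u k) = cond_law k (predict M u (filt M n h))"
  unfolding filt_Suc_eq
  by (subst filt_cong[of n _ h]) (auto simp: extend_hist_def)

end

section \<open>Information trajectories\<close>

text \<open>The comparison of the two models evaluates the objects of the information-state model on observable
data. \<open>past_info\<close> is the argument of its step kernel, \<open>info_hist\<close> the argument of its policies, and
\<open>info_path\<close> the map under which \<open>obs_info_law\<close> is an image measure.\<close>

definition past_info :: "('x, 'u, 'e, 'v) po_model \<Rightarrow> nat \<Rightarrow> (nat, 'u) hist \<Rightarrow> nat \<Rightarrow> 'x info \<times> 'u" where
  "past_info M n h = (\<lambda>i\<in>{0..<n}. (info_of M i h, snd h i))"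

definition info_hist :: "('x, 'u, 'e, 'v) po_model \<Rightarrow> nat \<Rightarrow> (nat, 'u) hist \<Rightarrow> ('x info, 'u) hist" where
  "info_hist M t h = ((\<lambda>i\<in>{..t}. info_of M i h), snd h)"

definition info_path ::
  "('x, 'u, 'e, 'v) po_model \<Rightarrow> (nat \<Rightarrow> 'x \<times> 'u) \<Rightarrow> nat \<Rightarrow> 'x info \<times> 'u" where
  "info_path M \<omega> t = (info_of M t (hist_of (obs M) t \<omega>), snd (\<omega> t))"

context observed_model begin

lemma measurable_past_info: "past_info M n \<in> H n \<rightarrow>\<^sub>M PiM {0..<n} (\<lambda>_. I \<Otimes>\<^sub>M U)"
  unfolding past_info_def[abs_def]
  by (intro measurable_restrict measurable_Pair measurable_info_of measurable_hist_act) auto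

text \<open>The filter is causal, so information states may be read off from any later history. As a rewrite
rule this equation would apply to its own right-hand side.\<close>

lemma info_of_hist_of:
  "i \<le> t \<Longrightarrow> info_of M i (hist_of (obs M) t \<omega>) = info_of M i (hist_of (obs M) i \<omega>)"
  by (rule info_of_cong) (auto simp: hist_of_def)

lemma restrict_info_path:
  "restrict (info_path M \<omega>) {0..<n} = past_info M n (hist_of (obs M) n \<omega>)"
proof
  fix i
  show "restrict (info_path M \<omega>) {0..<n} i = past_info M n (hist_of (obs M) n \<omega>) i"
    using info_of_hist_of[of i n \<omega>]
    by (cases "i < n") (simp_all add: info_path_def past_info_def, simp add: hist_of_def)
qed

lemma restrict_info_path_Suc:
  "restrict (info_path M \<omega>) {0..<Suc n} =
     (past_info M n (hist_of (obs M) n \<omega>))(n := (info_of M n (hist_of (obs M) n \<omega>), snd (\<omega> n)))"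
  unfolding restrict_info_path[symmetric] by (auto simp: info_path_def fun_eq_iff)

lemma hist_of_info_path:
  "hist_of (\<lambda>I. I) n (info_path M \<omega>) = info_hist M n (hist_of (obs M) n \<omega>)"
proof -
  have "fst (info_path M \<omega> i) = info_of M i (hist_of (obs M) n \<omega>)" if "i \<le> n" for i
    using info_of_hist_of[OF that, of \<omega>] by (simp add: info_path_def)
  then show ?thesis
    by (auto simp: hist_of_def[of "\<lambda>I. I"] info_hist_def fun_eq_iff)
       (auto simp: hist_of_def info_path_def)
qed

lemma measurable_info_path:
  "info_path M \<in> PiM UNIV (\<lambda>_. S \<Otimes>\<^sub>M U) \<rightarrow>\<^sub>M PiM UNIV (\<lambda>_. I \<Otimes>\<^sub>M U)"
proof (rule measurable_PiM_single')
  have comp: "(\<lambda>\<omega>. info_path M \<omega> t) \<in> PiM UNIV (\<lambda>_. S \<Otimes>\<^sub>M U) \<rightarrow>\<^sub>M I \<Otimes>\<^sub>M U" for t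
  proof -
    have "hist_of (obs M) t \<in> PiM UNIV (\<lambda>_. S \<Otimes>\<^sub>M U) \<rightarrow>\<^sub>M H t"
      by (rule measurable_hist_of[OF measurable_obs]) simp
    then have "(\<lambda>\<omega>. info_of M t (hist_of (obs M) t \<omega>)) \<in> PiM UNIV (\<lambda>_. S \<Otimes>\<^sub>M U) \<rightarrow>\<^sub>M I"
      by (rule measurable_compose[OF _ measurable_info_of]) simp
    then show ?thesis
      unfolding info_path_def by measurable
  qed
  then show "(\<lambda>\<omega>. info_path M \<omega> t) \<in> PiM UNIV (\<lambda>_. S \<Otimes>\<^sub>M U) \<rightarrow>\<^sub>M I \<Otimes>\<^sub>M U" for t .
  show "info_path M \<in> space (PiM UNIV (\<lambda>_. S \<Otimes>\<^sub>M U)) \<rightarrow> (\<Pi>\<^sub>E i\<in>UNIV. space (I \<Otimes>\<^sub>M U))"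
    using measurable_space[OF comp] by auto
qed

end

section \<open>Correctness of the filter\<close>

locale observed_process = observed_model M for M :: "('x, 'u, 'e, 'v) po_model" +
  fixes \<gamma> :: "(nat, 'u) policy"
  assumes obs_policy: "\<gamma> \<in> obs_policies M"
begin

sublocale controlled_process "states M" "actions M" "init_law M" "trans_kernel M" "obs M" "obs_space M" \<gamma>
proof
  show "init_law M \<in> space (prob_algebra S)" by (rule init_law_in)
  show "trans_kernel M \<in> S \<Otimes>\<^sub>M U \<rightarrow>\<^sub>M prob_algebra S" by (rule measurable_trans_kernel)
  show "obs M \<in> S \<rightarrow>\<^sub>M Y" by (rule measurable_obs)
  show "\<gamma> \<in> policies Y U" using obs_policy by (simp add: obs_policies_def)
qed

abbreviation "hist n \<omega> \<equiv> hist_of (obs M) n \<omega>"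

lemma L_eq_obs_law: "L = obs_law M \<gamma>"
  by (simp add: L_def obs_law_def)

lemma measurable_hist[measurable]: "hist_of (obs M) n \<in> L \<rightarrow>\<^sub>M H n"
  unfolding measurable_L_iff by (rule measurable_hist_of[OF measurable_obs]) simp

lemma measurable_L_component[measurable]: "(\<lambda>\<omega>. \<omega> n) \<in> L \<rightarrow>\<^sub>M S \<Otimes>\<^sub>M U"
  unfolding measurable_L_iff by (rule measurable_component_singleton) simp

lemma hist_in: "\<omega> \<in> space L \<Longrightarrow> hist n \<omega> \<in> space (H n)"
  by (rule measurable_space[OF measurable_hist])

lemma action_in: "\<omega> \<in> space L \<Longrightarrow> snd (\<omega> n) \<in> space U"
  using measurable_space[OF measurable_L_component] by (auto simp: space_pair_measure mem_Times_iff)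

lemma filt_in: "h \<in> space (H n) \<Longrightarrow> filt M n h \<in> space (prob_algebra S)"
  by (rule measurable_space[OF measurable_filt]) simp_all

lemma policy_in: "h \<in> space (H n) \<Longrightarrow> \<gamma> n h \<in> space (prob_algebra U)"
  by (rule measurable_space[OF measurable_policy])

text \<open>The filter is the conditional law of the hidden state, in the form of an integral identity for
all nonnegative functions of history and state. This form is strong enough to be its own induction
hypothesis over time.\<close>

definition filter_correct :: "nat \<Rightarrow> bool" where
  "filter_correct n \<longleftrightarrow> (\<forall>F\<in>borel_measurable (H n \<Otimes>\<^sub>M S).
     (\<integral>\<^sup>+\<omega>. F (hist n \<omega>, fst (\<omega> n)) \<partial>L) = (\<integral>\<^sup>+\<omega>. \<integral>\<^sup>+x. F (hist n \<omega>, x) \<partial>filt M n (hist n \<omega>) \<partial>L))"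

lemma nn_integral_hist_action:
  assumes G: "G \<in> borel_measurable (H n \<Otimes>\<^sub>M U)"
  shows "(\<integral>\<^sup>+\<omega>. G (hist n \<omega>, snd (\<omega> n)) \<partial>L) = (\<integral>\<^sup>+\<omega>. \<integral>\<^sup>+u. G (hist n \<omega>, u) \<partial>\<gamma> n (hist n \<omega>) \<partial>L)"
proof -
  have "(\<lambda>(h, x, u). G (h, u)) \<in> borel_measurable (H n \<Otimes>\<^sub>M S \<Otimes>\<^sub>M U)"
    unfolding split_def by (rule measurable_compose[OF _ G]) measurable
  from nn_integral_action_hist[OF this] show ?thesis by (simp add: split_beta')
qed

lemma measurable_nn_integral_filt:
  assumes F: "F \<in> borel_measurable (H n \<Otimes>\<^sub>M U \<Otimes>\<^sub>M S)"
  shows "(\<lambda>(h, u). \<integral>\<^sup>+x. F (h, u, x) \<partial>filt M n h) \<in> borel_measurable (H n \<Otimes>\<^sub>M U)"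
  unfolding split_def
proof (rule nn_integral_kernel_measurable[where B=S])
  show "(\<lambda>(z, x). F (fst z, snd z, x)) \<in> borel_measurable ((H n \<Otimes>\<^sub>M U) \<Otimes>\<^sub>M S)"
    unfolding split_def by (rule measurable_compose[OF _ F]) measurable
  show "(\<lambda>z. filt M n (fst z)) \<in> H n \<Otimes>\<^sub>M U \<rightarrow>\<^sub>M prob_algebra S"
    by (rule measurable_compose[OF measurable_fst measurable_filt]) simp
qed

text \<open>Observing the action in addition gives no information about the hidden state, since the action is
drawn from a law that depends on the history alone. Formally, the action is integrated out, the filter
identity is applied, and the order of the integrations over state and action is exchanged.\<close>

lemma filter_with_action:
  assumes fc: "filter_correct n" and F: "F \<in> borel_measurable (H n \<Otimes>\<^sub>M U \<Otimes>\<^sub>M S)"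
  shows "(\<integral>\<^sup>+\<omega>. F (hist n \<omega>, snd (\<omega> n), fst (\<omega> n)) \<partial>L) =
    (\<integral>\<^sup>+\<omega>. \<integral>\<^sup>+x. F (hist n \<omega>, snd (\<omega> n), x) \<partial>filt M n (hist n \<omega>) \<partial>L)"
proof -
  have F1: "(\<lambda>(h, x, u). F (h, u, x)) \<in> borel_measurable (H n \<Otimes>\<^sub>M S \<Otimes>\<^sub>M U)"
    unfolding split_def by (rule measurable_compose[OF _ F]) measurable
  have F2: "(\<lambda>(h, x). \<integral>\<^sup>+u. F (h, u, x) \<partial>\<gamma> n h) \<in> borel_measurable (H n \<Otimes>\<^sub>M S)"
    unfolding split_def
  proof (rule nn_integral_kernel_measurable[where B=U])
    show "(\<lambda>(z, u). F (fst z, u, snd z)) \<in> borel_measurable ((H n \<Otimes>\<^sub>M S) \<Otimes>\<^sub>M U)"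
      unfolding split_def by (rule measurable_compose[OF _ F]) measurable
    show "(\<lambda>z. \<gamma> n (fst z)) \<in> H n \<Otimes>\<^sub>M S \<rightarrow>\<^sub>M prob_algebra U"
      by (rule measurable_compose[OF measurable_fst measurable_policy])
  qed
  have "(\<integral>\<^sup>+\<omega>. F (hist n \<omega>, snd (\<omega> n), fst (\<omega> n)) \<partial>L) =
      (\<integral>\<^sup>+\<omega>. \<integral>\<^sup>+u. F (hist n \<omega>, u, fst (\<omega> n)) \<partial>\<gamma> n (hist n \<omega>) \<partial>L)"
    using nn_integral_action_hist[OF F1] by (simp add: split_beta')
  also have "\<dots> = (\<integral>\<^sup>+\<omega>. \<integral>\<^sup>+x. \<integral>\<^sup>+u. F (hist n \<omega>, u, x) \<partial>\<gamma> n (hist n \<omega>) \<partial>filt M n (hist n \<omega>) \<partial>L)"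
    using bspec[OF fc[unfolded filter_correct_def] F2] by simp
  also have "\<dots> = (\<integral>\<^sup>+\<omega>. \<integral>\<^sup>+u. \<integral>\<^sup>+x. F (hist n \<omega>, u, x) \<partial>filt M n (hist n \<omega>) \<partial>\<gamma> n (hist n \<omega>) \<partial>L)"
  proof (rule nn_integral_cong)
    fix \<omega> assume "\<omega> \<in> space L"
    note h = hist_in[OF this, of n]
    have "(\<lambda>(x, u). F (hist n \<omega>, u, x)) \<in> borel_measurable (S \<Otimes>\<^sub>M U)"
      unfolding split_def using h by (intro measurable_compose[OF _ F]) simp
    then show "(\<integral>\<^sup>+x. \<integral>\<^sup>+u. F (hist n \<omega>, u, x) \<partial>\<gamma> n (hist n \<omega>) \<partial>filt M n (hist n \<omega>)) =
        (\<integral>\<^sup>+u. \<integral>\<^sup>+x. F (hist n \<omega>, u, x) \<partial>filt M n (hist n \<omega>) \<partial>\<gamma> n (hist n \<omega>))"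
      by (rule nn_integral_swap_prob[OF filt_in[OF h] policy_in[OF h]])
  qed
  also have "\<dots> = (\<integral>\<^sup>+\<omega>. \<integral>\<^sup>+x. F (hist n \<omega>, snd (\<omega> n), x) \<partial>filt M n (hist n \<omega>) \<partial>L)"
    using nn_integral_hist_action[OF measurable_nn_integral_filt[OF F]] by simp
  finally show ?thesis .
qed

abbreviation "prediction n \<omega> \<equiv> predict M (snd (\<omega> n)) (filt M n (hist n \<omega>))"

lemma prediction_in: "\<omega> \<in> space L \<Longrightarrow> prediction n \<omega> \<in> space (prob_algebra S)"
  by (intro predict_in filt_in hist_in action_in)

text \<open>Given history and action, the next hidden state has the predicted law: the transition kernel is
averaged over the filter.\<close>

lemma prediction_correct:
  assumes fc: "filter_correct n" and F: "F \<in> borel_measurable (H n \<Otimes>\<^sub>M U \<Otimes>\<^sub>M S)"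
  shows "(\<integral>\<^sup>+\<omega>. F (hist n \<omega>, snd (\<omega> n), fst (\<omega> (Suc n))) \<partial>L) =
    (\<integral>\<^sup>+\<omega>. \<integral>\<^sup>+s. F (hist n \<omega>, snd (\<omega> n), s) \<partial>prediction n \<omega> \<partial>L)"
proof -
  have F': "(\<lambda>(h, u, x). \<integral>\<^sup>+s. F (h, u, s) \<partial>trans_kernel M (x, u)) \<in> borel_measurable (H n \<Otimes>\<^sub>M U \<Otimes>\<^sub>M S)"
    unfolding split_def
  proof (rule nn_integral_kernel_measurable[where B=S])
    show "(\<lambda>(z, s). F (fst z, fst (snd z), s)) \<in> borel_measurable ((H n \<Otimes>\<^sub>M U \<Otimes>\<^sub>M S) \<Otimes>\<^sub>M S)"
      unfolding split_def by (rule measurable_compose[OF _ F]) measurable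
    show "(\<lambda>z. trans_kernel M (snd (snd z), fst (snd z))) \<in> H n \<Otimes>\<^sub>M U \<Otimes>\<^sub>M S \<rightarrow>\<^sub>M prob_algebra S"
      by (rule measurable_compose[OF _ measurable_trans_kernel]) measurable
  qed
  have "(\<integral>\<^sup>+\<omega>. F (hist n \<omega>, snd (\<omega> n), fst (\<omega> (Suc n))) \<partial>L) =
      (\<integral>\<^sup>+\<omega>. \<integral>\<^sup>+s. F (hist n \<omega>, snd (\<omega> n), s) \<partial>trans_kernel M (fst (\<omega> n), snd (\<omega> n)) \<partial>L)"
    using nn_integral_next_state_hist[OF F] by simp
  also have "\<dots> = (\<integral>\<^sup>+\<omega>. \<integral>\<^sup>+x. \<integral>\<^sup>+s. F (hist n \<omega>, snd (\<omega> n), s) \<partial>trans_kernel M (x, snd (\<omega> n))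
      \<partial>filt M n (hist n \<omega>) \<partial>L)"
    using filter_with_action[OF fc F'] by simp
  also have "\<dots> = (\<integral>\<^sup>+\<omega>. \<integral>\<^sup>+s. F (hist n \<omega>, snd (\<omega> n), s) \<partial>prediction n \<omega> \<partial>L)"
  proof (rule nn_integral_cong)
    fix \<omega> assume \<omega>: "\<omega> \<in> space L"
    have "(\<lambda>s. F (hist n \<omega>, snd (\<omega> n), s)) \<in> borel_measurable S"
      using hist_in[OF \<omega>] action_in[OF \<omega>] by (intro measurable_compose[OF _ F]) simp
    then show "(\<integral>\<^sup>+x. \<integral>\<^sup>+s. F (hist n \<omega>, snd (\<omega> n), s) \<partial>trans_kernel M (x, snd (\<omega> n)) \<partial>filt M n (hist n \<omega>)) =
        (\<integral>\<^sup>+s. F (hist n \<omega>, snd (\<omega> n), s) \<partial>prediction n \<omega>)"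
      by (rule nn_integral_predict[symmetric, OF filt_in[OF hist_in[OF \<omega>]] action_in[OF \<omega>]])
  qed
  finally show ?thesis .
qed

lemma nn_integral_initial_state:
  assumes F: "F \<in> borel_measurable S"
  shows "(\<integral>\<^sup>+\<omega>. F (fst (\<omega> 0)) \<partial>L) = (\<integral>\<^sup>+s. F s \<partial>init_law M)"
proof -
  have "(\<lambda>(w, s). F s) \<in> borel_measurable (past 0 \<Otimes>\<^sub>M S)"
    unfolding split_def by (rule measurable_compose[OF measurable_snd F])
  from nn_integral_state[OF this] show ?thesis
    by (simp add: state_kernel_def prob_space.emeasure_space_1[OF prob_space_L])
qed

text \<open>Induction over time. In the step, the new history is a function of the old history, the action and the
new state, so both sides of the identity can be integrated against the predicted law, where Bayes'
formula identifies them. The start is Bayes' formula for the initial law.\<close>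

lemma filter_is_correct: "filter_correct n"
proof (induction n)
  case 0
  define h0 :: "nat \<Rightarrow> (nat, 'u) hist" where "h0 k = ((\<lambda>i\<in>{..0}. k), (\<lambda>i\<in>{..<0}. undefined))" for k
  have hist0: "hist 0 \<omega> = h0 (obs M (fst (\<omega> 0)))" for \<omega>
    by (auto simp: hist_of_def h0_def fun_eq_iff)
  have filt0: "filt M 0 (h0 k) = cond_law k (init_law M)" for k
    by (simp add: h0_def init_filter_eq)
  have h0[measurable]: "h0 \<in> Y \<rightarrow>\<^sub>M H 0"
    unfolding h0_def hist_space_def by (intro measurable_Pair measurable_restrict) auto
  show ?case
    unfolding filter_correct_def
  proof
    fix F :: "_ \<Rightarrow> ennreal" assume F: "F \<in> borel_measurable (H 0 \<Otimes>\<^sub>M S)"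
    have G: "(\<lambda>(k, s). F (h0 k, s)) \<in> borel_measurable (Y \<Otimes>\<^sub>M S)"
      unfolding split_def by (rule measurable_compose[OF _ F]) measurable
    have G1: "(\<lambda>s. F (h0 (obs M s), s)) \<in> borel_measurable S"
      by (rule measurable_compose[OF _ F]) measurable
    have G2: "(\<lambda>s. \<integral>\<^sup>+x. F (h0 (obs M s), x) \<partial>filt M 0 (h0 (obs M s))) \<in> borel_measurable S"
    proof (rule nn_integral_kernel_measurable[where B=S])
      show "(\<lambda>(s, x). F (h0 (obs M s), x)) \<in> borel_measurable (S \<Otimes>\<^sub>M S)"
        unfolding split_def by (rule measurable_compose[OF _ F]) measurable
      show "(\<lambda>s. filt M 0 (h0 (obs M s))) \<in> S \<rightarrow>\<^sub>M prob_algebra S"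
        by (rule measurable_compose[OF _ measurable_filt[OF order_refl]]) measurable
    qed
    show "(\<integral>\<^sup>+\<omega>. F (hist 0 \<omega>, fst (\<omega> 0)) \<partial>L) = (\<integral>\<^sup>+\<omega>. \<integral>\<^sup>+x. F (hist 0 \<omega>, x) \<partial>filt M 0 (hist 0 \<omega>) \<partial>L)"
      unfolding hist0 nn_integral_initial_state[OF G1] nn_integral_initial_state[OF G2]
      using bayes_observation[OF init_law_in G] unfolding filt0 by simp
  qed
next
  case (Suc n)
  show ?case
    unfolding filter_correct_def
  proof
    fix F :: "_ \<Rightarrow> ennreal" assume F: "F \<in> borel_measurable (H (Suc n) \<Otimes>\<^sub>M S)"
    \<comment> \<open>The new history depends on the new state through its label only; this is what makes Bayes' formula applicable.\<close>
    define E where "E = (\<lambda>z :: (nat, 'u) hist \<times> 'u \<times> 'x. extend_hist n (fst z) (fst (snd z)) (obs M (snd (snd z))))"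
    have E[measurable]: "E \<in> H n \<Otimes>\<^sub>M U \<Otimes>\<^sub>M S \<rightarrow>\<^sub>M H (Suc n)"
      unfolding E_def
      using measurable_compose[OF _ measurable_extend_hist,
          of "\<lambda>z. (fst z, fst (snd z), obs M (snd (snd z)))" "H n \<Otimes>\<^sub>M U \<Otimes>\<^sub>M S" Y U n] by simp
    have G1: "(\<lambda>z. F (E z, snd (snd z))) \<in> borel_measurable (H n \<Otimes>\<^sub>M U \<Otimes>\<^sub>M S)"
      by (rule measurable_compose[OF _ F]) measurable
    have G2: "(\<lambda>z. \<integral>\<^sup>+x. F (E z, x) \<partial>filt M (Suc n) (E z)) \<in> borel_measurable (H n \<Otimes>\<^sub>M U \<Otimes>\<^sub>M S)"
    proof (rule nn_integral_kernel_measurable[where B=S])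
      show "(\<lambda>(z, x). F (E z, x)) \<in> borel_measurable ((H n \<Otimes>\<^sub>M U \<Otimes>\<^sub>M S) \<Otimes>\<^sub>M S)"
        unfolding split_def by (rule measurable_compose[OF _ F]) measurable
      show "(\<lambda>z. filt M (Suc n) (E z)) \<in> H n \<Otimes>\<^sub>M U \<Otimes>\<^sub>M S \<rightarrow>\<^sub>M prob_algebra S"
        by (rule measurable_compose[OF E measurable_filt[OF order_refl]])
    qed
    have histE: "hist (Suc n) \<omega> = E (hist n \<omega>, snd (\<omega> n), fst (\<omega> (Suc n)))" for \<omega>
      by (simp add: E_def hist_of_Suc)
    have "(\<integral>\<^sup>+\<omega>. F (hist (Suc n) \<omega>, fst (\<omega> (Suc n))) \<partial>L) =
        (\<integral>\<^sup>+\<omega>. \<integral>\<^sup>+s. F (E (hist n \<omega>, snd (\<omega> n), s), s) \<partial>prediction n \<omega> \<partial>L)"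
      unfolding histE using prediction_correct[OF Suc G1] by simp
    also have "\<dots> = (\<integral>\<^sup>+\<omega>. \<integral>\<^sup>+s. \<integral>\<^sup>+x. F (E (hist n \<omega>, snd (\<omega> n), s), x)
        \<partial>filt M (Suc n) (E (hist n \<omega>, snd (\<omega> n), s)) \<partial>prediction n \<omega> \<partial>L)"
    proof (rule nn_integral_cong)
      fix \<omega> assume \<omega>: "\<omega> \<in> space L"
      have "(\<lambda>(k, s). F (extend_hist n (hist n \<omega>) (snd (\<omega> n)) k, s)) \<in> borel_measurable (Y \<Otimes>\<^sub>M S)"
      proof -
        have [measurable]: "(\<lambda>z. extend_hist n (hist n \<omega>) (snd (\<omega> n)) (fst z)) \<in> Y \<Otimes>\<^sub>M S \<rightarrow>\<^sub>M H (Suc n)"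
          using measurable_compose[OF _ measurable_extend_hist,
              of "\<lambda>z. (hist n \<omega>, snd (\<omega> n), fst z)" "Y \<Otimes>\<^sub>M S" Y U n] hist_in[OF \<omega>] action_in[OF \<omega>] by simp
        show ?thesis
          unfolding split_def by (rule measurable_compose[OF _ F]) measurable
      qed
      from bayes_observation[OF prediction_in[OF \<omega>] this]
      show "(\<integral>\<^sup>+s. F (E (hist n \<omega>, snd (\<omega> n), s), s) \<partial>prediction n \<omega>) =
          (\<integral>\<^sup>+s. \<integral>\<^sup>+x. F (E (hist n \<omega>, snd (\<omega> n), s), x)
            \<partial>filt M (Suc n) (E (hist n \<omega>, snd (\<omega> n), s)) \<partial>prediction n \<omega>)"
        by (simp add: E_def filt_extend_hist del: filt.simps)
    qed
    also have "\<dots> = (\<integral>\<^sup>+\<omega>. \<integral>\<^sup>+x. F (hist (Suc n) \<omega>, x) \<partial>filt M (Suc n) (hist (Suc n) \<omega>) \<partial>L)"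
      unfolding histE using prediction_correct[OF Suc G2] by simp
    finally show "(\<integral>\<^sup>+\<omega>. F (hist (Suc n) \<omega>, fst (\<omega> (Suc n))) \<partial>L) =
        (\<integral>\<^sup>+\<omega>. \<integral>\<^sup>+x. F (hist (Suc n) \<omega>, x) \<partial>filt M (Suc n) (hist (Suc n) \<omega>) \<partial>L)" .
  qed
qed

lemma filter_regular_cond_law:
  "regular_cond_law (obs_law M \<gamma>) (obs_field M \<gamma> t) S (\<lambda>\<omega>. fst (\<omega> t)) (\<lambda>\<omega>. filt M t (hist t \<omega>))"
  unfolding obs_field_def L_eq_obs_law[symmetric]
proof (rule regular_cond_lawI[OF prob_space_L measurable_hist])
  show "filt M t \<in> H t \<rightarrow>\<^sub>M prob_algebra S" by (rule measurable_filt) simp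
  fix B C assume B[measurable]: "B \<in> sets (H t)" and C[measurable]: "C \<in> sets S"
  have "(\<lambda>(h, x). indicator B h * indicator C x :: ennreal) \<in> borel_measurable (H t \<Otimes>\<^sub>M S)"
    unfolding split_def by measurable
  from bspec[OF filter_is_correct[unfolded filter_correct_def] this]
  have "(\<integral>\<^sup>+\<omega>. indicator B (hist t \<omega>) * indicator C (fst (\<omega> t)) \<partial>L) =
      (\<integral>\<^sup>+\<omega>. \<integral>\<^sup>+x. indicator B (hist t \<omega>) * indicator C x \<partial>filt M t (hist t \<omega>) \<partial>L)"
    by simp
  also have "\<dots> = (\<integral>\<^sup>+\<omega>. indicator B (hist t \<omega>) * emeasure (filt M t (hist t \<omega>)) C \<partial>L)"
    using in_prob_algebraD(2)[OF filt_in[OF hist_in]] C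
    by (intro nn_integral_cong) (subst nn_integral_cmult_indicator, auto)
  finally show "(\<integral>\<^sup>+\<omega>. indicator B (hist t \<omega>) * indicator C (fst (\<omega> t)) \<partial>L) =
      (\<integral>\<^sup>+\<omega>. indicator B (hist t \<omega>) * emeasure (filt M t (hist t \<omega>)) C \<partial>L)" .
qed measurable

text \<open>The information state is updated by the predicted law and the label of the new hidden state.\<close>

lemma info_of_Suc:
  "info_of M (Suc t) (hist (Suc t) \<omega>) = extended_info (prediction t \<omega>) (fst (\<omega> (Suc t)))"
proof -
  have "fst (hist (Suc t) \<omega>) (Suc t) = obs M (fst (\<omega> (Suc t)))"
    by (simp add: hist_of_def)
  then show ?thesis
    unfolding info_of_def extended_info_def hist_of_Suc filt_extend_hist by (simp add: hist_of_Suc)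
qed

lemma measurable_extended_prediction:
  "(\<lambda>(h, u, s). extended_info (predict M u (filt M n h)) s) \<in> H n \<Otimes>\<^sub>M U \<Otimes>\<^sub>M S \<rightarrow>\<^sub>M I"
proof -
  have [measurable]: "filt M n \<in> H n \<rightarrow>\<^sub>M prob_algebra S" by (rule measurable_filt) simp
  have [measurable]: "(\<lambda>z. predict M (fst (snd z)) (filt M n (fst z))) \<in> H n \<Otimes>\<^sub>M U \<Otimes>\<^sub>M S \<rightarrow>\<^sub>M prob_algebra S"
    using measurable_compose[OF _ measurable_predict, of "\<lambda>z. (filt M n (fst z), fst (snd z))" "H n \<Otimes>\<^sub>M U \<Otimes>\<^sub>M S"]
    by simp
  show ?thesis
    using measurable_compose[OF _ measurable_extended_info,
        of "\<lambda>z. (predict M (fst (snd z)) (filt M n (fst z)), snd (snd z))" "H n \<Otimes>\<^sub>M U \<Otimes>\<^sub>M S"]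
    by (simp add: split_def)
qed

text \<open>Given history and action, the next information state has the law prescribed by the information kernel
at the current information state: it is a function of the new hidden state, whose law is the predicted
one, and the information kernel is the image of the predicted law.\<close>

lemma next_info_state:
  assumes F: "F \<in> borel_measurable ((H n \<Otimes>\<^sub>M U) \<Otimes>\<^sub>M I)"
  shows "(\<integral>\<^sup>+\<omega>. F ((hist n \<omega>, snd (\<omega> n)), info_of M (Suc n) (hist (Suc n) \<omega>)) \<partial>L) =
    (\<integral>\<^sup>+\<omega>. \<integral>\<^sup>+i. F ((hist n \<omega>, snd (\<omega> n)), i) \<partial>info_kernel M (info_of M n (hist n \<omega>), snd (\<omega> n)) \<partial>L)"
proof -
  have F': "(\<lambda>(h, u, s). F ((h, u), extended_info (predict M u (filt M n h)) s)) \<in> borel_measurable (H n \<Otimes>\<^sub>M U \<Otimes>\<^sub>M S)"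
    unfolding split_def
    using measurable_extended_prediction[of n] by (intro measurable_compose[OF _ F]) (simp add: split_def)
  have "(\<integral>\<^sup>+\<omega>. F ((hist n \<omega>, snd (\<omega> n)), info_of M (Suc n) (hist (Suc n) \<omega>)) \<partial>L) =
      (\<integral>\<^sup>+\<omega>. \<integral>\<^sup>+s. F ((hist n \<omega>, snd (\<omega> n)), extended_info (prediction n \<omega>) s) \<partial>prediction n \<omega> \<partial>L)"
    unfolding info_of_Suc using prediction_correct[OF filter_is_correct F'] by simp
  also have "\<dots> = (\<integral>\<^sup>+\<omega>. \<integral>\<^sup>+i. F ((hist n \<omega>, snd (\<omega> n)), i) \<partial>info_kernel M (info_of M n (hist n \<omega>), snd (\<omega> n)) \<partial>L)"
  proof (rule nn_integral_cong)
    fix \<omega> assume \<omega>: "\<omega> \<in> space L"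
    have "(\<lambda>i. F ((hist n \<omega>, snd (\<omega> n)), i)) \<in> borel_measurable I"
      using hist_in[OF \<omega>] action_in[OF \<omega>] by (intro measurable_compose[OF _ F]) simp
    then show "(\<integral>\<^sup>+s. F ((hist n \<omega>, snd (\<omega> n)), extended_info (prediction n \<omega>) s) \<partial>prediction n \<omega>) =
        (\<integral>\<^sup>+i. F ((hist n \<omega>, snd (\<omega> n)), i) \<partial>info_kernel M (info_of M n (hist n \<omega>), snd (\<omega> n)))"
      unfolding info_of_def info_kernel_eq_distr[OF filt_in[OF hist_in[OF \<omega>]] action_in[OF \<omega>]]
      using measurable_extended_info_right[OF prediction_in[OF \<omega>]] in_prob_algebraD(4)[OF prediction_in[OF \<omega>]]
      by (subst nn_integral_distr) auto
  qed
  finally show ?thesis .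
qed

lemma info_state_regular_cond_law:
  "regular_cond_law (obs_law M \<gamma>) (obs_act_field M \<gamma> t) I
     (\<lambda>\<omega>. info_of M (Suc t) (hist (Suc t) \<omega>))
     (\<lambda>\<omega>. info_kernel M (info_of M t (hist t \<omega>), snd (\<omega> t)))"
proof -
  have K: "(\<lambda>(h, u). info_kernel M (info_of M t h, u)) \<in> H t \<Otimes>\<^sub>M U \<rightarrow>\<^sub>M prob_algebra I"
    unfolding split_def
    by (intro measurable_compose[OF _ measurable_info_kernel] measurable_Pair measurable_snd
        measurable_compose[OF measurable_fst measurable_info_of]) simp
  have h: "(\<lambda>\<omega>. (hist t \<omega>, snd (\<omega> t))) \<in> L \<rightarrow>\<^sub>M H t \<Otimes>\<^sub>M U" by measurable
  have Z: "(\<lambda>\<omega>. info_of M (Suc t) (hist (Suc t) \<omega>)) \<in> L \<rightarrow>\<^sub>M I"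
    by (rule measurable_compose[OF measurable_hist measurable_info_of]) simp
  have "regular_cond_law L (vimage_algebra (space L) (\<lambda>\<omega>. (hist t \<omega>, snd (\<omega> t))) (H t \<Otimes>\<^sub>M U)) I
     (\<lambda>\<omega>. info_of M (Suc t) (hist (Suc t) \<omega>))
     (\<lambda>\<omega>. (\<lambda>(h, u). info_kernel M (info_of M t h, u)) (hist t \<omega>, snd (\<omega> t)))"
  proof (rule regular_cond_lawI[OF prob_space_L h Z K])
    fix B C assume B[measurable]: "B \<in> sets (H t \<Otimes>\<^sub>M U)" and C[measurable]: "C \<in> sets I"
    have "(\<lambda>(z, i). indicator B z * indicator C i :: ennreal) \<in> borel_measurable ((H t \<Otimes>\<^sub>M U) \<Otimes>\<^sub>M I)"
      unfolding split_def by measurable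
    from next_info_state[OF this]
    have "(\<integral>\<^sup>+\<omega>. indicator B (hist t \<omega>, snd (\<omega> t)) * indicator C (info_of M (Suc t) (hist (Suc t) \<omega>)) \<partial>L) =
        (\<integral>\<^sup>+\<omega>. \<integral>\<^sup>+i. indicator B (hist t \<omega>, snd (\<omega> t)) * indicator C i
          \<partial>info_kernel M (info_of M t (hist t \<omega>), snd (\<omega> t)) \<partial>L)"
      by simp
    also have "\<dots> = (\<integral>\<^sup>+\<omega>. indicator B (hist t \<omega>, snd (\<omega> t)) *
        emeasure (info_kernel M (info_of M t (hist t \<omega>), snd (\<omega> t))) C \<partial>L)"
      using in_prob_algebraD(2)[OF measurable_space[OF K measurable_space[OF h]]] C
      by (intro nn_integral_cong) (subst nn_integral_cmult_indicator, auto)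
    finally show "(\<integral>\<^sup>+\<omega>. indicator B (hist t \<omega>, snd (\<omega> t)) * indicator C (info_of M (Suc t) (hist (Suc t) \<omega>)) \<partial>L) =
        (\<integral>\<^sup>+\<omega>. indicator B (hist t \<omega>, snd (\<omega> t)) *
          emeasure (case (hist t \<omega>, snd (\<omega> t)) of (h, u) \<Rightarrow> info_kernel M (info_of M t h, u)) C \<partial>L)"
      by simp
  qed
  then show ?thesis
    by (simp add: obs_act_field_def L_eq_obs_law)
qed

section \<open>The law of the filtered process\<close>

lemma obs_info_law_eq_distr:
  "obs_info_law M \<gamma> = distr L (PiM UNIV (\<lambda>_. I \<Otimes>\<^sub>M U)) (info_path M)"
  unfolding obs_info_law_def L_eq_obs_law info_path_def[abs_def] ..

lemma measurable_info_path_L: "info_path M \<in> L \<rightarrow>\<^sub>M PiM UNIV (\<lambda>_. I \<Otimes>\<^sub>M U)"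
  unfolding measurable_L_iff by (rule measurable_info_path)

text \<open>If two policies choose the same action laws along corresponding histories, then the filtered process
is the information-state process. It suffices to check the two conditional laws that characterize a
trajectory law: the states follow the information kernel by \<open>next_info_state\<close>, and the actions follow
\<open>\<delta>\<close> because the information history is a function of the observable history.\<close>

lemma obs_info_law_eq_info_law:
  assumes \<delta>: "\<delta> \<in> info_policies M"
    and compatible: "\<And>t h. h \<in> space (H t) \<Longrightarrow> \<gamma> t h = \<delta> t (info_hist M t h)"
  shows "obs_info_law M \<gamma> = info_law M \<delta>"
proof -
  interpret Q: controlled_process "info_space M" "actions M" "info_init M" "info_kernel M" "\<lambda>I. I" "info_space M" \<delta>
    using \<delta> by unfold_locales (auto simp: info_policies_def info_init_in measurable_info_kernel)
  note distr = obs_info_law_eq_distr nn_integral_distr[OF measurable_info_path_L]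
  note PI[measurable] = measurable_past_info
  have [measurable]: "info_of M n \<in> H n \<rightarrow>\<^sub>M I" for n by (rule measurable_info_of) simp
  have comp: "(\<lambda>\<omega>. \<omega> n) \<in> Q.paths \<rightarrow>\<^sub>M I \<Otimes>\<^sub>M U" for n
    by (rule measurable_component_singleton) simp
  show ?thesis
    unfolding info_law_def
  proof (rule Q.path_law_unique)
    show "prob_space (obs_info_law M \<gamma>)"
      unfolding obs_info_law_eq_distr by (rule prob_space.prob_space_distr[OF prob_space_L measurable_info_path_L])
    show "sets (obs_info_law M \<gamma>) = sets Q.paths"
      unfolding obs_info_law_eq_distr by simp
  next
    fix n and F :: "_ \<Rightarrow> ennreal" assume F[measurable]: "F \<in> borel_measurable (Q.past n \<Otimes>\<^sub>M I)"
    note [measurable] = comp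
    have m1: "(\<lambda>\<omega>. F (restrict \<omega> {0..<n}, fst (\<omega> n))) \<in> borel_measurable Q.paths"
      by measurable
    have m2: "(\<lambda>\<omega>. \<integral>\<^sup>+s. F (restrict \<omega> {0..<n}, s) \<partial>Q.state_kernel n (restrict \<omega> {0..<n})) \<in> borel_measurable Q.paths"
      by (rule nn_integral_kernel_measurable[where B=I]) measurable
    have "(\<integral>\<^sup>+\<omega>. F (restrict (info_path M \<omega>) {0..<n}, fst (info_path M \<omega> n)) \<partial>L) =
      (\<integral>\<^sup>+\<omega>. \<integral>\<^sup>+s. F (restrict (info_path M \<omega>) {0..<n}, s) \<partial>Q.state_kernel n (restrict (info_path M \<omega>) {0..<n}) \<partial>L)"
    proof (cases n)
      case 0
      have F0: "(\<lambda>i. F ((\<lambda>_. undefined), i)) \<in> borel_measurable I"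
        using F unfolding 0 by (rule measurable_compose[rotated]) (simp add: Q.undefined_in_past0[simplified])
      have "fst (info_path M \<omega> 0) = extended_info (init_law M) (fst (\<omega> 0))" for \<omega>
        by (simp add: info_path_def info_of_def extended_info_def hist_of_def init_filter_eq)
      then have "(\<integral>\<^sup>+\<omega>. F (restrict (info_path M \<omega>) {0..<n}, fst (info_path M \<omega> n)) \<partial>L) =
          (\<integral>\<^sup>+\<omega>. F ((\<lambda>_. undefined), extended_info (init_law M) (fst (\<omega> 0))) \<partial>L)"
        by (simp add: 0 restrict_def)
      also have "\<dots> = (\<integral>\<^sup>+s. F ((\<lambda>_. undefined), extended_info (init_law M) s) \<partial>init_law M)"
        by (rule nn_integral_initial_state)
           (rule measurable_compose[OF measurable_extended_info_right[OF init_law_in] F0])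
      also have "\<dots> = (\<integral>\<^sup>+i. F ((\<lambda>_. undefined), i) \<partial>info_init M)"
        unfolding info_init_eq
        using measurable_extended_info_right[OF init_law_in] F0
        by (subst nn_integral_distr) (simp_all add: in_prob_algebraD(4)[OF init_law_in])
      finally show ?thesis
        by (simp add: 0 restrict_def Q.state_kernel_def prob_space.emeasure_space_1[OF prob_space_L])
    next
      case (Suc m)
      \<comment> \<open>The information past up to and including time \<open>m\<close>, as a function of the history and the action at time \<open>m\<close>.\<close>
      define W where "W = (\<lambda>(h, u). (past_info M m h)(m := (info_of M m h, u)))"
      have W[measurable]: "W \<in> H m \<Otimes>\<^sub>M U \<rightarrow>\<^sub>M Q.past (Suc m)"
        unfolding W_def split_def
        by (rule measurable_fun_upd[where J="{0..<m}"]) (auto simp: atLeastLessThanSuc)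
      have FW: "(\<lambda>(z, i). F (W z, i)) \<in> borel_measurable ((H m \<Otimes>\<^sub>M U) \<Otimes>\<^sub>M I)"
        using F unfolding Suc split_def by (rule measurable_compose[rotated]) measurable
      have path: "restrict (info_path M \<omega>) {0..<n} = W (hist m \<omega>, snd (\<omega> m))" for \<omega>
        unfolding Suc restrict_info_path_Suc W_def by simp
      have kern: "Q.state_kernel n (W (h, u)) = info_kernel M (info_of M m h, u)" for h u
        by (simp add: Suc Q.state_kernel_def W_def)
      show ?thesis
        using next_info_state[OF FW] unfolding path kern by (simp add: Suc info_path_def)
    qed
    then show "(\<integral>\<^sup>+\<omega>. F (restrict \<omega> {0..<n}, fst (\<omega> n)) \<partial>obs_info_law M \<gamma>) =
        (\<integral>\<^sup>+\<omega>. \<integral>\<^sup>+s. F (restrict \<omega> {0..<n}, s) \<partial>Q.state_kernel n (restrict \<omega> {0..<n}) \<partial>obs_info_law M \<gamma>)"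
      using m1 m2 by (simp add: distr)
  next
    fix n and F :: "_ \<Rightarrow> ennreal" assume F[measurable]: "F \<in> borel_measurable (Q.past n \<Otimes>\<^sub>M I \<Otimes>\<^sub>M U)"
    note [measurable] = comp
    have m1: "(\<lambda>\<omega>. F (restrict \<omega> {0..<n}, fst (\<omega> n), snd (\<omega> n))) \<in> borel_measurable Q.paths"
      by measurable
    have m2: "(\<lambda>\<omega>. \<integral>\<^sup>+u. F (restrict \<omega> {0..<n}, fst (\<omega> n), u) \<partial>\<delta> n (hist_of (\<lambda>I. I) n \<omega>)) \<in> borel_measurable Q.paths"
    proof (rule nn_integral_kernel_measurable[where B=U])
      show "(\<lambda>\<omega>. \<delta> n (hist_of (\<lambda>I. I) n \<omega>)) \<in> Q.paths \<rightarrow>\<^sub>M prob_algebra U"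
        by (rule measurable_compose[OF measurable_hist_of Q.measurable_policy]) auto
    qed measurable
    have F': "(\<lambda>(h, x, u). F (past_info M n h, info_of M n h, u)) \<in> borel_measurable (H n \<Otimes>\<^sub>M S \<Otimes>\<^sub>M U)"
      unfolding split_def by measurable
    have "(\<integral>\<^sup>+\<omega>. F (past_info M n (hist n \<omega>), info_of M n (hist n \<omega>), snd (\<omega> n)) \<partial>L) =
        (\<integral>\<^sup>+\<omega>. \<integral>\<^sup>+u. F (past_info M n (hist n \<omega>), info_of M n (hist n \<omega>), u) \<partial>\<gamma> n (hist n \<omega>) \<partial>L)"
      using nn_integral_action_hist[OF F'] by (simp add: split_beta')
    also have "\<dots> = (\<integral>\<^sup>+\<omega>. \<integral>\<^sup>+u. F (past_info M n (hist n \<omega>), info_of M n (hist n \<omega>), u)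
        \<partial>\<delta> n (hist_of (\<lambda>I. I) n (info_path M \<omega>)) \<partial>L)"
      unfolding hist_of_info_path
      by (intro nn_integral_cong) (simp add: compatible[OF hist_in])
    finally have "(\<integral>\<^sup>+\<omega>. F (restrict (info_path M \<omega>) {0..<n}, fst (info_path M \<omega> n), snd (info_path M \<omega> n)) \<partial>L) =
        (\<integral>\<^sup>+\<omega>. \<integral>\<^sup>+u. F (restrict (info_path M \<omega>) {0..<n}, fst (info_path M \<omega> n), u)
          \<partial>\<delta> n (hist_of (\<lambda>I. I) n (info_path M \<omega>)) \<partial>L)"
      unfolding restrict_info_path by (simp add: info_path_def)
    then show "(\<integral>\<^sup>+\<omega>. F (restrict \<omega> {0..<n}, fst (\<omega> n), snd (\<omega> n)) \<partial>obs_info_law M \<gamma>) =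
        (\<integral>\<^sup>+\<omega>. \<integral>\<^sup>+u. F (restrict \<omega> {0..<n}, fst (\<omega> n), u) \<partial>\<delta> n (hist_of (\<lambda>I. I) n \<omega>) \<partial>obs_info_law M \<gamma>)"
      using m1 m2 by (simp add: distr)
  qed
qed

end

section \<open>Extended integrals of weighted signed sums\<close>

text \<open>The finiteness assumptions in this section keep differences of extended numbers away from
\<open>\<infinity> - \<infinity>\<close>; one of the two parts, and always the same one, has to stay finite.\<close>

lemma enn2ereal_add_diff_swap:
  fixes p q x y :: ennreal
  assumes "p + x < \<infinity> \<or> q + y < \<infinity>"
  shows "(enn2ereal p - enn2ereal q) + (enn2ereal x - enn2ereal y) =
    enn2ereal (p + x) - enn2ereal (q + y)"
  using assms
  by (cases p; cases q; cases x; cases y)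
     (auto simp: enn2ereal_ennreal plus_ennreal.rep_eq top_ennreal.rep_eq top_ereal_def)

lemma ereal_times_diff_enn2ereal:
  fixes x y :: ennreal
  assumes "0 \<le> w" "ennreal w * x < \<infinity> \<or> ennreal w * y < \<infinity>"
  shows "ereal w * (enn2ereal x - enn2ereal y) = enn2ereal (ennreal w * x) - enn2ereal (ennreal w * y)"
  using assms
  by (cases x; cases y)
     (auto simp: enn2ereal_ennreal times_ennreal.rep_eq top_ennreal.rep_eq top_ereal_def
        ennreal_mult_top zero_ennreal.rep_eq right_diff_distrib ennreal_mult[symmetric] split: if_splits)

lemma e2ennreal_diff_enn2ereal: "e2ennreal (enn2ereal p - enn2ereal q) = p - q"
  by (cases p; cases q) (auto simp: enn2ereal_ennreal top_ennreal.rep_eq top_ereal_def ennreal_minus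
      e2ennreal_ereal e2ennreal_infty e2ennreal_neg)

lemma le_diff_add_ennreal: "p \<le> p - q + (q :: ennreal)"
  by (cases "q \<le> p") (auto simp: diff_add_cancel_ennreal not_le intro: order.trans[OF less_imp_le])

text \<open>All partial sums of one of the two parts are finite, so the signed partial sums split into
their parts, and the limits of the parts are not both infinite.\<close>

lemma weighted_signed_sums:
  fixes a b :: "nat \<Rightarrow> ennreal"
  assumes w: "\<And>t. 0 \<le> w t"
    and fin: "(\<Sum>t. ennreal (w t) * a t) < \<infinity> \<or> (\<Sum>t. ennreal (w t) * b t) < \<infinity>"
  shows "(\<Sum>t. ereal (w t) * (enn2ereal (a t) - enn2ereal (b t))) =
    enn2ereal (\<Sum>t. ennreal (w t) * a t) - enn2ereal (\<Sum>t. ennreal (w t) * b t)"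
proof -
  define x y where "x t = ennreal (w t) * a t" and "y t = ennreal (w t) * b t" for t
  have part: "(\<Sum>t<n. x t) \<le> (\<Sum>t. x t)" "(\<Sum>t<n. y t) \<le> (\<Sum>t. y t)" for n
    by (rule sum_le_suminf; simp)+
  have fin_n: "(\<Sum>t<n. x t) < \<infinity> \<or> (\<Sum>t<n. y t) < \<infinity>" for n
    using fin part[of n] unfolding x_def y_def by (meson order.strict_trans1)
  have fin_t: "x t < \<infinity> \<or> y t < \<infinity>" for t
    using fin_n[of "Suc t"] by auto
  have term_eq: "ereal (w t) * (enn2ereal (a t) - enn2ereal (b t)) = enn2ereal (x t) - enn2ereal (y t)" for t
    unfolding x_def y_def using fin_t[of t] unfolding x_def y_def by (intro ereal_times_diff_enn2ereal w)
  have partial: "(\<Sum>t<n. ereal (w t) * (enn2ereal (a t) - enn2ereal (b t))) =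
      enn2ereal (\<Sum>t<n. x t) - enn2ereal (\<Sum>t<n. y t)" for n
  proof (induction n)
    case (Suc n)
    show ?case
      unfolding sum.lessThan_Suc Suc.IH unfolding term_eq
      using fin_n[of "Suc n"] unfolding sum.lessThan_Suc by (rule enn2ereal_add_diff_swap)
  qed (simp add: zero_ennreal.rep_eq)
  have lim: "(\<lambda>n. enn2ereal (\<Sum>t<n. z t)) \<longlonglongrightarrow> enn2ereal (\<Sum>t. z t)" for z :: "nat \<Rightarrow> ennreal"
    using summable_LIMSEQ[of z] by (intro tendsto_intros) auto
  have "(\<lambda>n. \<Sum>t<n. ereal (w t) * (enn2ereal (a t) - enn2ereal (b t))) \<longlonglongrightarrow>
      enn2ereal (\<Sum>t. x t) - enn2ereal (\<Sum>t. y t)"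
    unfolding partial
    by (rule tendsto_diff_ereal_general[OF lim lim])
       (use fin in \<open>auto simp: x_def[symmetric] y_def[symmetric] less_top[symmetric]\<close>)
  then show ?thesis
    unfolding x_def y_def by (intro sums_unique[symmetric]) (simp add: sums_def)
qed

text \<open>The positive part of \<open>a - b\<close> may be smaller than \<open>a\<close>, and the negative part smaller than \<open>b\<close>, but
the identity \<open>(a - b) + b = (b - a) + a\<close> for truncated differences shows that the same amount
has been removed from both; it can be cancelled when one of the integrals is finite.\<close>

lemma ext_integral_diff:
  assumes [measurable]: "a \<in> borel_measurable L" "b \<in> borel_measurable L"
    and fin: "(\<integral>\<^sup>+\<omega>. a \<omega> \<partial>L) < \<infinity> \<or> (\<integral>\<^sup>+\<omega>. b \<omega> \<partial>L) < \<infinity>"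
    and f: "AE \<omega> in L. f \<omega> = enn2ereal (a \<omega>) - enn2ereal (b \<omega>)"
  shows "ext_integral L f = enn2ereal (\<integral>\<^sup>+\<omega>. a \<omega> \<partial>L) - enn2ereal (\<integral>\<^sup>+\<omega>. b \<omega> \<partial>L)"
proof -
  let ?A = "\<integral>\<^sup>+\<omega>. a \<omega> \<partial>L" and ?B = "\<integral>\<^sup>+\<omega>. b \<omega> \<partial>L"
  let ?P = "\<integral>\<^sup>+\<omega>. a \<omega> - b \<omega> \<partial>L" and ?N = "\<integral>\<^sup>+\<omega>. b \<omega> - a \<omega> \<partial>L"
  have AE_fin: "AE \<omega> in L. a \<omega> < \<infinity> \<or> b \<omega> < \<infinity>"
    using fin nn_integral_PInf_AE[of a L] nn_integral_PInf_AE[of b L] by (auto simp: less_top)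
  have P: "(\<integral>\<^sup>+\<omega>. e2ennreal (f \<omega>) \<partial>L) = ?P"
    using f by (intro nn_integral_cong_AE) (auto simp: e2ennreal_diff_enn2ereal)
  have N: "(\<integral>\<^sup>+\<omega>. e2ennreal (- f \<omega>) \<partial>L) = ?N"
    using f AE_fin
  proof (intro nn_integral_cong_AE, eventually_elim)
    case (elim \<omega>)
    then have "- f \<omega> = enn2ereal (b \<omega>) - enn2ereal (a \<omega>)"
      by (auto simp: less_top[symmetric] ereal_minus_diff_eq)
    then show ?case by (simp add: e2ennreal_diff_enn2ereal)
  qed
  have "p - q + q = q - p + p" for p q :: ennreal
    by (cases "p = \<infinity> \<or> q = \<infinity>"; cases "p \<le> q")
       (auto simp: diff_add_cancel_ennreal diff_eq_0_ennreal not_le less_imp_le less_top top_unique)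
  then have "(\<integral>\<^sup>+\<omega>. a \<omega> - b \<omega> + b \<omega> \<partial>L) = (\<integral>\<^sup>+\<omega>. b \<omega> - a \<omega> + a \<omega> \<partial>L)"
    by (intro nn_integral_cong) simp
  then have sum: "?P + ?B = ?N + ?A"
    by (simp add: nn_integral_add)
  \<comment> \<open>The truncated parts inherit finiteness, so the finite integral can be cancelled in the sum above.\<close>
  have "?P \<le> ?A" "?N \<le> ?B"
    by (auto intro!: nn_integral_mono diff_le_self_ennreal)
  with sum fin show ?thesis
    unfolding ext_integral_def P N
    by (cases ?A; cases ?B; cases ?P; cases ?N)
       (auto simp: enn2ereal_ennreal top_ennreal.rep_eq top_ereal_def top_unique simp flip: ennreal_plus)
qed

text \<open>The common form of finite-horizon and discounted costs: the weights are the indicator of \<open>t < N\<close> in the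
first case and \<open>\<alpha> ^ t\<close> in the second. The value depends only on the expected positive and
negative parts of the single terms.\<close>

lemma ext_integral_weighted:
  assumes w: "\<And>t. 0 \<le> w t"
    and [measurable]: "\<And>t. a t \<in> borel_measurable L" "\<And>t. b t \<in> borel_measurable L"
    and f: "\<And>t \<omega>. f t \<omega> = enn2ereal (a t \<omega>) - enn2ereal (b t \<omega>)"
    and fin: "(\<Sum>t. ennreal (w t) * (\<integral>\<^sup>+\<omega>. a t \<omega> \<partial>L)) < \<infinity> \<or>
      (\<Sum>t. ennreal (w t) * (\<integral>\<^sup>+\<omega>. b t \<omega> \<partial>L)) < \<infinity>"
  shows "ext_integral L (\<lambda>\<omega>. \<Sum>t. ereal (w t) * f t \<omega>) =
    enn2ereal (\<Sum>t. ennreal (w t) * (\<integral>\<^sup>+\<omega>. a t \<omega> \<partial>L)) -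
    enn2ereal (\<Sum>t. ennreal (w t) * (\<integral>\<^sup>+\<omega>. b t \<omega> \<partial>L))"
proof -
  define A B where "A \<omega> = (\<Sum>t. ennreal (w t) * a t \<omega>)" and "B \<omega> = (\<Sum>t. ennreal (w t) * b t \<omega>)" for \<omega>
  have [measurable]: "A \<in> borel_measurable L" "B \<in> borel_measurable L"
    unfolding A_def B_def by measurable
  have A: "(\<integral>\<^sup>+\<omega>. A \<omega> \<partial>L) = (\<Sum>t. ennreal (w t) * (\<integral>\<^sup>+\<omega>. a t \<omega> \<partial>L))"
    and B: "(\<integral>\<^sup>+\<omega>. B \<omega> \<partial>L) = (\<Sum>t. ennreal (w t) * (\<integral>\<^sup>+\<omega>. b t \<omega> \<partial>L))"
    unfolding A_def B_def by (simp_all add: nn_integral_suminf nn_integral_cmult)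
  have "AE \<omega> in L. A \<omega> < \<infinity> \<or> B \<omega> < \<infinity>"
    using fin nn_integral_PInf_AE[of A L] nn_integral_PInf_AE[of B L] by (auto simp: A B less_top)
  then have "AE \<omega> in L. (\<Sum>t. ereal (w t) * f t \<omega>) = enn2ereal (A \<omega>) - enn2ereal (B \<omega>)"
    unfolding f A_def B_def by eventually_elim (rule weighted_signed_sums[OF w])
  then show ?thesis
    using fin by (subst ext_integral_diff) (auto simp: A B)
qed

text \<open>Stages beyond the horizon get weight zero; their terms vanish even if the stage cost is infinite, since
\<open>0 * \<infinity> = 0\<close> for extended reals.\<close>

lemma finite_cost_eq_weighted:
  "finite_cost L f N = ext_integral L (\<lambda>\<omega>. \<Sum>t. ereal (if t < N then 1 else 0) * f (\<omega> t))"
proof -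
  have "(\<Sum>t. ereal (if t < N then 1 else 0) * f (\<omega> t)) = (\<Sum>t<N. f (\<omega> t))" for \<omega>
    by (subst suminf_finite[of "{..<N}"]) auto
  then show ?thesis by (simp add: finite_cost_def)
qed

text \<open>Averaging over the hidden state may cancel positive against negative costs, so the positive part of
an averaged cost can be smaller than the averaged positive part. The defect is at most the averaged
negative part; a finite expectation is therefore inherited as soon as one of the averaged parts is
integrable.\<close>

lemma positive_part_finite:
  assumes [measurable]: "a \<in> borel_measurable L" "b \<in> borel_measurable L"
    and part: "(\<integral>\<^sup>+\<omega>. e2ennreal (enn2ereal (a \<omega>) - enn2ereal (b \<omega>)) \<partial>L) < \<infinity>"
    and fin: "(\<integral>\<^sup>+\<omega>. a \<omega> \<partial>L) < \<infinity> \<or> (\<integral>\<^sup>+\<omega>. b \<omega> \<partial>L) < \<infinity>"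
  shows "(\<integral>\<^sup>+\<omega>. a \<omega> \<partial>L) < \<infinity>"
  using fin
proof
  assume b: "(\<integral>\<^sup>+\<omega>. b \<omega> \<partial>L) < \<infinity>"
  have le: "p \<le> e2ennreal (enn2ereal p - enn2ereal q) + q" for p q :: ennreal
    unfolding e2ennreal_diff_enn2ereal by (rule le_diff_add_ennreal)
  have "(\<integral>\<^sup>+\<omega>. a \<omega> \<partial>L) \<le> (\<integral>\<^sup>+\<omega>. e2ennreal (enn2ereal (a \<omega>) - enn2ereal (b \<omega>)) + b \<omega> \<partial>L)"
    by (intro nn_integral_mono le)
  also have "\<dots> < \<infinity>"
    using part b by (subst nn_integral_add) auto
  finally show ?thesis .
qed

lemma negative_part_finite:
  assumes [measurable]: "a \<in> borel_measurable L" "b \<in> borel_measurable L"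
    and part: "(\<integral>\<^sup>+\<omega>. e2ennreal (- (enn2ereal (a \<omega>) - enn2ereal (b \<omega>))) \<partial>L) < \<infinity>"
    and fin: "(\<integral>\<^sup>+\<omega>. a \<omega> \<partial>L) < \<infinity> \<or> (\<integral>\<^sup>+\<omega>. b \<omega> \<partial>L) < \<infinity>"
  shows "(\<integral>\<^sup>+\<omega>. b \<omega> \<partial>L) < \<infinity>"
  using fin
proof
  assume a: "(\<integral>\<^sup>+\<omega>. a \<omega> \<partial>L) < \<infinity>"
  have le: "q \<le> e2ennreal (- (enn2ereal p - enn2ereal q)) + p" for p q :: ennreal
  proof (cases "p = \<infinity>")
    case False
    then have "- (enn2ereal p - enn2ereal q) = enn2ereal q - enn2ereal p"
      by (intro ereal_minus_diff_eq) auto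
    then show ?thesis by (simp add: e2ennreal_diff_enn2ereal le_diff_add_ennreal)
  qed simp
  have "(\<integral>\<^sup>+\<omega>. b \<omega> \<partial>L) \<le> (\<integral>\<^sup>+\<omega>. e2ennreal (- (enn2ereal (a \<omega>) - enn2ereal (b \<omega>))) + a \<omega> \<partial>L)"
    by (intro nn_integral_mono le)
  also have "\<dots> < \<infinity>"
    using part a by (subst nn_integral_add) auto
  finally show ?thesis .
qed

section \<open>Corresponding policies and averaged costs\<close>

lemma measurable_policy_projection:
  "(\<lambda>h. ((\<lambda>i\<in>{..t}. fst (fst h i)), snd h)) \<in> hist_space (info_space M) A t \<rightarrow>\<^sub>M hist_space (obs_space M) A t"
proof -
  have "fst \<in> info_space M \<rightarrow>\<^sub>M obs_space M"
    unfolding info_space_def by (rule measurable_restrict_space1) simp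
  then have "(\<lambda>h. fst (fst h i)) \<in> hist_space (info_space M) A t \<rightarrow>\<^sub>M obs_space M" if "i \<in> {..t}" for i
    unfolding hist_space_def using that
    by (intro measurable_compose[OF measurable_compose[OF measurable_fst measurable_component_singleton]])
  then show ?thesis
    unfolding hist_space_def[of "obs_space M"]
    by (intro measurable_Pair measurable_restrict) (auto simp: hist_space_def)
qed

lemma induced_in_info_policies:
  assumes "\<gamma> \<in> obs_policies M" shows "induced \<gamma> \<in> info_policies M"
proof -
  have "\<gamma> t \<in> hist_space (obs_space M) (actions M) t \<rightarrow>\<^sub>M prob_algebra (actions M)" for t
    using assms by (simp add: obs_policies_def policies_def)
  from measurable_compose[OF measurable_policy_projection this] show ?thesis
    by (simp add: info_policies_def policies_def induced_def[abs_def])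
qed

text \<open>Applied to the positive and to the negative part of the cost separately; \<open>info_cost\<close> is the difference
of the two results.\<close>

definition mean_cost :: "('x \<times> 'u \<Rightarrow> ennreal) \<Rightarrow> 'x info \<times> 'u \<Rightarrow> ennreal" where
  "mean_cost G = (\<lambda>((j, \<mu>), u). \<integral>\<^sup>+x. G (x, u) \<partial>\<mu>)"

context observed_model begin

lemma implement_eq: "implement M \<delta> t h = \<delta> t (info_hist M t h)"
  by (simp add: implement_def info_hist_def)

lemma implement_in_obs_policies:
  assumes "\<delta> \<in> info_policies M" shows "implement M \<delta> \<in> obs_policies M"
proof -
  have "info_hist M t \<in> H t \<rightarrow>\<^sub>M hist_space I U t" for t
    unfolding info_hist_def[abs_def] hist_space_def[of I]
    by (intro measurable_Pair measurable_restrict measurable_info_of) (auto simp: hist_space_def)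
  moreover have "\<delta> t \<in> hist_space I U t \<rightarrow>\<^sub>M prob_algebra U" for t
    using assms by (simp add: info_policies_def policies_def)
  ultimately have "(\<lambda>h. \<delta> t (info_hist M t h)) \<in> H t \<rightarrow>\<^sub>M prob_algebra U" for t
    by (rule measurable_compose)
  then show ?thesis
    by (simp add: obs_policies_def policies_def implement_eq[abs_def])
qed

text \<open>Labels can be recovered from information states, so inserting the filter and then forgetting it returns
the original policy.\<close>

lemma induced_info_hist:
  assumes "h \<in> space (H t)" shows "induced \<gamma> t (info_hist M t h) = \<gamma> t h"
proof -
  have "(\<lambda>i\<in>{..t}. fst (fst (info_hist M t h) i)) = fst h"
    using assms by (auto simp: info_hist_def info_of_def hist_space_def space_pair_measure space_PiM
        PiE_iff extensional_def fun_eq_iff)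
  then show ?thesis by (simp add: induced_def info_hist_def)
qed

lemma obs_info_law_induced:
  assumes "\<gamma> \<in> obs_policies M" shows "obs_info_law M \<gamma> = info_law M (induced \<gamma>)"
proof -
  interpret observed_process M \<gamma> by unfold_locales fact
  show ?thesis
    using induced_in_info_policies[OF assms] by (rule obs_info_law_eq_info_law) (simp add: induced_info_hist)
qed

lemma obs_info_law_implement:
  assumes "\<delta> \<in> info_policies M" shows "obs_info_law M (implement M \<delta>) = info_law M \<delta>"
proof -
  interpret observed_process M "implement M \<delta>"
    by unfold_locales (rule implement_in_obs_policies[OF assms])
  show ?thesis
    using assms by (rule obs_info_law_eq_info_law) (rule implement_eq)
qed

lemma induced_admissible:
  assumes "\<gamma> \<in> obs_admissible M"
  shows "induced \<gamma> \<in> info_admissible M" "info_law M (induced \<gamma>) = obs_info_law M \<gamma>"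
  using assms obs_info_law_induced induced_in_info_policies
  by (auto simp: obs_admissible_def info_admissible_def)

lemma implement_admissible:
  assumes "\<delta> \<in> info_admissible M"
  shows "implement M \<delta> \<in> obs_admissible M" "obs_info_law M (implement M \<delta>) = info_law M \<delta>"
  using assms obs_info_law_implement implement_in_obs_policies
  by (auto simp: obs_admissible_def info_admissible_def)

lemma correspondingD:
  assumes "corresponding M \<gamma> \<delta>"
  shows "\<gamma> \<in> obs_admissible M" "\<delta> \<in> info_admissible M" "obs_info_law M \<gamma> = info_law M \<delta>"
  using assms induced_admissible implement_admissible by (auto simp: corresponding_def)

lemma measurable_mean_cost:
  assumes G: "G \<in> borel_measurable (S \<Otimes>\<^sub>M U)"
  shows "mean_cost G \<in> borel_measurable (I \<Otimes>\<^sub>M U)"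
  unfolding mean_cost_def split_def
proof (rule nn_integral_kernel_measurable[where B=S])
  show "(\<lambda>(z, x). G (x, snd z)) \<in> borel_measurable ((I \<Otimes>\<^sub>M U) \<Otimes>\<^sub>M S)"
    unfolding split_def by (rule measurable_compose[OF _ G]) measurable
  show "(\<lambda>z. snd (fst z)) \<in> I \<Otimes>\<^sub>M U \<rightarrow>\<^sub>M prob_algebra S"
    by measurable
qed

lemma info_cost_eq:
  "info_cost c z = enn2ereal (mean_cost (\<lambda>y. e2ennreal (ereal (c y))) z) -
     enn2ereal (mean_cost (\<lambda>y. e2ennreal (- ereal (c y))) z)"
  by (simp add: info_cost_def mean_cost_def ext_integral_def split_def)

end

text \<open>The tower property: the cost is first averaged over the hidden state given the history and the
action, which is an integral with respect to the filter.\<close>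

lemma (in observed_process) nn_integral_mean_cost:
  assumes G: "G \<in> borel_measurable (S \<Otimes>\<^sub>M U)"
  shows "(\<integral>\<^sup>+\<omega>. G (\<omega> t) \<partial>obs_law M \<gamma>) = (\<integral>\<^sup>+\<omega>. mean_cost G (\<omega> t) \<partial>obs_info_law M \<gamma>)"
proof -
  have "(\<lambda>(h, u, x). G (x, u)) \<in> borel_measurable (H t \<Otimes>\<^sub>M U \<Otimes>\<^sub>M S)"
    unfolding split_def by (rule measurable_compose[OF _ G]) measurable
  from filter_with_action[OF filter_is_correct this]
  have "(\<integral>\<^sup>+\<omega>. G (\<omega> t) \<partial>L) = (\<integral>\<^sup>+\<omega>. \<integral>\<^sup>+x. G (x, snd (\<omega> t)) \<partial>filt M t (hist t \<omega>) \<partial>L)"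
    by (simp add: split_beta')
  also have "\<dots> = (\<integral>\<^sup>+\<omega>. mean_cost G (info_path M \<omega> t) \<partial>L)"
    by (simp add: mean_cost_def info_path_def info_of_def)
  also have "\<dots> = (\<integral>\<^sup>+\<omega>. mean_cost G (\<omega> t) \<partial>obs_info_law M \<gamma>)"
    unfolding obs_info_law_eq_distr
    by (rule nn_integral_distr[symmetric, OF measurable_info_path_L])
       (simp, rule measurable_compose[OF _ measurable_mean_cost[OF G]], rule measurable_component_singleton, simp)
  finally show ?thesis by (simp add: L_eq_obs_law)
qed

section \<open>Equality of expected costs\<close>

text \<open>The signed cost is treated through its positive and negative parts, whose expectations are the
same in both models. Every cost comparison reduces to these two sequences of numbers.\<close>

locale corresponding_processes = observed_process M \<gamma>
  for M :: "('x, 'u, 'e, 'v) po_model" and \<gamma> +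
  fixes \<delta> :: "('x info, 'u) policy" and c :: "'x \<times> 'u \<Rightarrow> real"
  assumes laws: "obs_info_law M \<gamma> = info_law M \<delta>"
    and cost: "c \<in> borel_measurable (states M \<Otimes>\<^sub>M actions M)"
begin

definition cost_pos :: "'x \<times> 'u \<Rightarrow> ennreal" where "cost_pos z = e2ennreal (ereal (c z))"
definition cost_neg :: "'x \<times> 'u \<Rightarrow> ennreal" where "cost_neg z = e2ennreal (- ereal (c z))"

definition expected_pos :: "nat \<Rightarrow> ennreal" where "expected_pos t = (\<integral>\<^sup>+\<omega>. cost_pos (\<omega> t) \<partial>L)"
definition expected_neg :: "nat \<Rightarrow> ennreal" where "expected_neg t = (\<integral>\<^sup>+\<omega>. cost_neg (\<omega> t) \<partial>L)"

lemma measurable_cost_parts[measurable]: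
  "cost_pos \<in> borel_measurable (S \<Otimes>\<^sub>M U)" "cost_neg \<in> borel_measurable (S \<Otimes>\<^sub>M U)"
  using cost unfolding cost_pos_def[abs_def] cost_neg_def[abs_def] by measurable

lemma cost_eq: "ereal (c z) = enn2ereal (cost_pos z) - enn2ereal (cost_neg z)"
  unfolding cost_pos_def cost_neg_def
  by (cases "0 \<le> c z") (auto simp: e2ennreal_ereal e2ennreal_neg enn2ereal_ennreal ennreal_neg zero_ennreal.rep_eq)

lemma info_cost_parts: "info_cost c z = enn2ereal (mean_cost cost_pos z) - enn2ereal (mean_cost cost_neg z)"
  unfolding info_cost_eq cost_pos_def cost_neg_def ..

lemma expected_parts_info:
  "(\<integral>\<^sup>+\<omega>. mean_cost cost_pos (\<omega> t) \<partial>info_law M \<delta>) = expected_pos t"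
  "(\<integral>\<^sup>+\<omega>. mean_cost cost_neg (\<omega> t) \<partial>info_law M \<delta>) = expected_neg t"
  using nn_integral_mean_cost[of cost_pos t] nn_integral_mean_cost[of cost_neg t]
  by (simp_all add: laws expected_pos_def expected_neg_def L_eq_obs_law)

lemma measurable_info_law_component: "(\<lambda>\<omega>. \<omega> t) \<in> info_law M \<delta> \<rightarrow>\<^sub>M I \<Otimes>\<^sub>M U"
  unfolding laws[symmetric] obs_info_law_eq_distr by (simp add: measurable_component_singleton)

lemma measurable_cost_path[measurable]:
  "(\<lambda>\<omega>. cost_pos (\<omega> t)) \<in> borel_measurable L" "(\<lambda>\<omega>. cost_neg (\<omega> t)) \<in> borel_measurable L"
  "(\<lambda>\<omega>. mean_cost cost_pos (\<omega> t)) \<in> borel_measurable (info_law M \<delta>)"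
  "(\<lambda>\<omega>. mean_cost cost_neg (\<omega> t)) \<in> borel_measurable (info_law M \<delta>)"
  by (rule measurable_compose[OF measurable_L_component] measurable_cost_parts
      measurable_compose[OF measurable_info_law_component] measurable_mean_cost)+

lemma weighted_costs_agree:
  assumes w: "\<And>t. 0 \<le> w t"
    and fin: "(\<Sum>t. ennreal (w t) * expected_pos t) < \<infinity> \<or> (\<Sum>t. ennreal (w t) * expected_neg t) < \<infinity>"
  shows "ext_integral (obs_law M \<gamma>) (\<lambda>\<omega>. \<Sum>t. ereal (w t) * ereal (c (\<omega> t))) =
    ext_integral (info_law M \<delta>) (\<lambda>\<omega>. \<Sum>t. ereal (w t) * info_cost c (\<omega> t))"
proof -
  have "ext_integral L (\<lambda>\<omega>. \<Sum>t. ereal (w t) * ereal (c (\<omega> t))) =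
      enn2ereal (\<Sum>t. ennreal (w t) * expected_pos t) - enn2ereal (\<Sum>t. ennreal (w t) * expected_neg t)"
    using fin unfolding expected_pos_def expected_neg_def
    by (intro ext_integral_weighted[OF w] measurable_cost_path cost_eq)
  moreover have "ext_integral (info_law M \<delta>) (\<lambda>\<omega>. \<Sum>t. ereal (w t) * info_cost c (\<omega> t)) =
      enn2ereal (\<Sum>t. ennreal (w t) * expected_pos t) - enn2ereal (\<Sum>t. ennreal (w t) * expected_neg t)"
    using fin unfolding expected_parts_info[symmetric]
    by (intro ext_integral_weighted[OF w] measurable_cost_path info_cost_parts)
  ultimately show ?thesis by (simp add: L_eq_obs_law)
qed

text \<open>If the total cost is known to be well defined only in the information-state model, the finiteness of
one accumulated part concerns averaged costs and has to be transferred to the hidden costs stage by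
stage, which is possible because the expectation of each stage cost is well defined.\<close>

lemma finite_condition_parts:
  assumes "finite_condition M c N \<gamma> \<delta>"
  shows "(\<forall>t<N. expected_pos t < \<infinity>) \<or> (\<forall>t<N. expected_neg t < \<infinity>)"
proof -
  have each: "expected_pos t < \<infinity> \<or> expected_neg t < \<infinity>" if "t < N" for t
    using assms that unfolding finite_condition_def ext_integral_defined_def expected_pos_def
      expected_neg_def cost_pos_def cost_neg_def L_eq_obs_law by simp
  consider
      "(\<integral>\<^sup>+\<omega>. (\<Sum>t<N. cost_pos (\<omega> t)) \<partial>L) < \<infinity>" | "(\<integral>\<^sup>+\<omega>. (\<Sum>t<N. cost_neg (\<omega> t)) \<partial>L) < \<infinity>"
    | "(\<integral>\<^sup>+\<omega>. (\<Sum>t<N. e2ennreal (info_cost c (\<omega> t))) \<partial>info_law M \<delta>) < \<infinity>"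
    | "(\<integral>\<^sup>+\<omega>. (\<Sum>t<N. e2ennreal (- info_cost c (\<omega> t))) \<partial>info_law M \<delta>) < \<infinity>"
    using assms unfolding finite_condition_def finite_cost_defined_def cost_pos_def cost_neg_def L_eq_obs_law by blast
  then show ?thesis
  proof cases
    case 1
    then have "(\<Sum>t<N. expected_pos t) < \<infinity>" by (simp add: nn_integral_sum expected_pos_def)
    then show ?thesis by simp
  next
    case 2
    then have "(\<Sum>t<N. expected_neg t) < \<infinity>" by (simp add: nn_integral_sum expected_neg_def)
    then show ?thesis by simp
  next
    case 3
    have "expected_pos t < \<infinity>" if t: "t < N" for t
    proof -
      have "e2ennreal (info_cost c (\<omega> t)) \<le> (\<Sum>t<N. e2ennreal (info_cost c (\<omega> t)))" for \<omega>
        using t by (intro member_le_sum) auto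
      then have "(\<integral>\<^sup>+\<omega>. e2ennreal (info_cost c (\<omega> t)) \<partial>info_law M \<delta>) < \<infinity>"
        by (rule le_less_trans[OF nn_integral_mono 3])
      then show ?thesis
        using positive_part_finite[OF measurable_cost_path(3,4)] each[OF t]
        by (simp only: info_cost_parts expected_parts_info)
    qed
    then show ?thesis by blast
  next
    case 4
    have "expected_neg t < \<infinity>" if t: "t < N" for t
    proof -
      have "e2ennreal (- info_cost c (\<omega> t)) \<le> (\<Sum>t<N. e2ennreal (- info_cost c (\<omega> t)))" for \<omega>
        using t by (intro member_le_sum) auto
      then have "(\<integral>\<^sup>+\<omega>. e2ennreal (- info_cost c (\<omega> t)) \<partial>info_law M \<delta>) < \<infinity>"
        by (rule le_less_trans[OF nn_integral_mono 4])
      then show ?thesis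
        using negative_part_finite[OF measurable_cost_path(3,4)] each[OF t]
        by (simp only: info_cost_parts expected_parts_info)
    qed
    then show ?thesis by blast
  qed
qed

lemma finite_costs_agree:
  assumes "finite_condition M c N \<gamma> \<delta>"
  shows "finite_cost (obs_law M \<gamma>) (\<lambda>z. ereal (c z)) N = finite_cost (info_law M \<delta>) (info_cost c) N"
  unfolding finite_cost_eq_weighted
proof (rule weighted_costs_agree)
  have "(\<Sum>t. ennreal (if t < N then 1 else 0) * z t) = (\<Sum>t<N. z t)" for z :: "nat \<Rightarrow> ennreal"
    by (subst suminf_finite[of "{..<N}"]) auto
  then show "(\<Sum>t. ennreal (if t < N then 1 else 0) * expected_pos t) < \<infinity> \<or>
      (\<Sum>t. ennreal (if t < N then 1 else 0) * expected_neg t) < \<infinity>"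
    using finite_condition_parts[OF assms] by auto
qed simp

text \<open>Each of the three conditions makes the discounted expected negative part finite: by assumption, by
comparison with a geometric series, or because it vanishes.\<close>

lemma discounted_costs_agree:
  assumes \<alpha>: "\<alpha> \<in> {0<..<1}" and cond: "discounted_condition M c \<alpha> \<gamma>"
  shows "discounted_cost (obs_law M \<gamma>) (\<lambda>z. ereal (c z)) \<alpha> = discounted_cost (info_law M \<delta>) (info_cost c) \<alpha>"
  unfolding discounted_cost_def
proof (rule weighted_costs_agree)
  show "0 \<le> \<alpha> ^ t" for t using \<alpha> by simp
  have in_space: "\<omega> t \<in> space (S \<Otimes>\<^sub>M U)" if "\<omega> \<in> space L" for \<omega> t
    using measurable_space[OF measurable_L_component that] .
  have "(\<Sum>t. ennreal (\<alpha> ^ t) * expected_neg t) < \<infinity>"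
    using cond unfolding discounted_condition_def
  proof (elim disjE exE)
    assume "discounted_parts_integrable (obs_law M \<gamma>) (\<lambda>z. ereal (c z)) \<alpha>"
    then have "(\<integral>\<^sup>+\<omega>. (\<Sum>t. ennreal (\<alpha> ^ t) * cost_neg (\<omega> t)) \<partial>L) < \<infinity>"
      by (simp add: discounted_parts_integrable_def L_eq_obs_law cost_neg_def)
    then show ?thesis
      by (simp add: nn_integral_suminf nn_integral_cmult expected_neg_def)
  next
    fix B assume B: "\<forall>z\<in>space (S \<Otimes>\<^sub>M U). \<bar>c z\<bar> \<le> B"
    have "expected_neg t \<le> ennreal B" for t
    proof -
      have "expected_neg t \<le> (\<integral>\<^sup>+\<omega>. ennreal B \<partial>L)"
        unfolding expected_neg_def cost_neg_def using B in_space
        by (intro nn_integral_mono) (simp add: e2ennreal_ereal ennreal_leI abs_le_iff)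
      then show ?thesis using prob_space.emeasure_space_1[OF prob_space_L] by simp
    qed
    then have "(\<Sum>t. ennreal (\<alpha> ^ t) * expected_neg t) \<le> (\<Sum>t. ennreal (\<alpha> ^ t) * ennreal B)"
      by (intro suminf_le mult_left_mono) auto
    also have "\<dots> = (\<Sum>t. ennreal (\<alpha> ^ t)) * ennreal B" by simp
    also have "(\<Sum>t. ennreal (\<alpha> ^ t)) = ennreal (\<Sum>t. \<alpha> ^ t)"
      using \<alpha> by (intro suminf_ennreal2 summable_geometric) auto
    also have "ennreal (\<Sum>t. \<alpha> ^ t) * ennreal B < \<infinity>"
      by (simp add: ennreal_mult_less_top)
    finally show ?thesis .
  next
    assume nonneg: "\<forall>z\<in>space (S \<Otimes>\<^sub>M U). 0 \<le> c z"
    have "expected_neg t = 0" for t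
      unfolding expected_neg_def cost_neg_def using nonneg in_space
      by (subst nn_integral_cong[where v="\<lambda>_. 0"]) (auto simp: e2ennreal_neg ennreal_neg)
    then show ?thesis by simp
  qed
  then show "(\<Sum>t. ennreal (\<alpha> ^ t) * expected_pos t) < \<infinity> \<or> (\<Sum>t. ennreal (\<alpha> ^ t) * expected_neg t) < \<infinity>" ..
qed

end

lemma (in observed_model) corresponding_processesI:
  assumes "c \<in> borel_measurable (S \<Otimes>\<^sub>M U)" "corresponding M \<gamma> \<delta>"
  shows "corresponding_processes M \<gamma> \<delta> c"
  using assms correspondingD[OF assms(2)] by unfold_locales (auto simp: obs_admissible_def)

section \<open>Optimal values\<close>

lemma INF_correspondence:
  fixes J :: "'a \<Rightarrow> 'c::complete_lattice" and J' :: "'b \<Rightarrow> 'c"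
  assumes "\<And>x. x \<in> A \<Longrightarrow> \<exists>y\<in>B. J x = J' y" "\<And>y. y \<in> B \<Longrightarrow> \<exists>x\<in>A. J x = J' y"
  shows "(INF x\<in>A. J x) = (INF y\<in>B. J' y)"
proof -
  have "J ` A = J' ` B"
  proof (intro equalityI image_subsetI)
    show "J x \<in> J' ` B" if "x \<in> A" for x using assms(1)[OF that] by auto
    show "J' y \<in> J ` A" if "y \<in> B" for y using assms(2)[OF that] by (metis imageI)
  qed
  then show ?thesis by simp
qed

text \<open>Every admissible policy of one model has a corresponding admissible policy of the other, so equal
costs of corresponding policies make the two infima range over the same set of values.\<close>

lemma (in observed_model) optimal_values_agree:
  fixes J :: "(nat, 'u) policy \<Rightarrow> ereal" and J' :: "('x info, 'u) policy \<Rightarrow> ereal"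
  assumes J: "\<And>\<gamma> \<delta>. corresponding M \<gamma> \<delta> \<Longrightarrow> J \<gamma> = J' \<delta>"
  shows "let V = (INF \<gamma>\<in>obs_admissible M. J \<gamma>); V' = (INF \<delta>\<in>info_admissible M. J' \<delta>)
    in V = V' \<and> (\<forall>\<gamma> \<delta>. corresponding M \<gamma> \<delta> \<longrightarrow> (J \<gamma> = V \<longleftrightarrow> J' \<delta> = V'))"
proof -
  have "(INF \<gamma>\<in>obs_admissible M. J \<gamma>) = (INF \<delta>\<in>info_admissible M. J' \<delta>)"
  proof (rule INF_correspondence)
    show "\<exists>\<delta>\<in>info_admissible M. J \<gamma> = J' \<delta>" if "\<gamma> \<in> obs_admissible M" for \<gamma>
      using that induced_admissible J by (force simp: corresponding_def)
    show "\<exists>\<gamma>\<in>obs_admissible M. J \<gamma> = J' \<delta>" if "\<delta> \<in> info_admissible M" for \<delta>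
      using that implement_admissible J by (force simp: corresponding_def)
  qed
  then show ?thesis using J by (simp add: Let_def)
qed

theorem theorem5:
  fixes M :: "('x, 'u, 'e, 'v) po_model" and c :: "'x \<times> 'u \<Rightarrow> real"
  assumes model: "valid_po_model M"
    and cost: "c \<in> borel_measurable (states M \<Otimes>\<^sub>M actions M)"
  shows "\<comment> \<open>the recursive filter is the regular conditional law of the hidden state\<close>
    (\<forall>\<gamma>\<in>obs_policies M. \<forall>t.
       regular_cond_law (obs_law M \<gamma>) (obs_field M \<gamma> t) (states M) (\<lambda>\<omega>. fst (\<omega> t))
         (\<lambda>\<omega>. filt M t (hist_of (obs M) t \<omega>))) \<and>
    \<comment> \<open>correspondence of policies\<close>
    (\<forall>\<gamma>\<in>obs_admissible M.
       induced \<gamma> \<in> info_admissible M \<and> info_law M (induced \<gamma>) = obs_info_law M \<gamma>) \<and>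
    (\<forall>\<delta>\<in>info_admissible M.
       implement M \<delta> \<in> obs_admissible M \<and> obs_info_law M (implement M \<delta>) = info_law M \<delta>) \<and>
    \<comment> \<open>evolution of the information state, finite-horizon costs\<close>
    (\<forall>\<gamma> \<delta>. corresponding M \<gamma> \<delta> \<longrightarrow>
       (\<forall>t. regular_cond_law (obs_law M \<gamma>) (obs_act_field M \<gamma> t) (info_space M)
          (\<lambda>\<omega>. info_of M (Suc t) (hist_of (obs M) (Suc t) \<omega>))
          (\<lambda>\<omega>. info_kernel M (info_of M t (hist_of (obs M) t \<omega>), snd (\<omega> t))))) \<and>
    (\<forall>\<gamma> \<delta> N. corresponding M \<gamma> \<delta> \<longrightarrow> finite_condition M c N \<gamma> \<delta> \<longrightarrow>
       finite_cost (obs_law M \<gamma>) (\<lambda>z. ereal (c z)) N = finite_cost (info_law M \<delta>) (info_cost c) N) \<and>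
    \<comment> \<open>discounted costs\<close>
    (\<forall>\<gamma> \<delta>. \<forall>\<alpha>\<in>{0<..<1}. corresponding M \<gamma> \<delta> \<longrightarrow> discounted_condition M c \<alpha> \<gamma> \<longrightarrow>
       discounted_cost (obs_law M \<gamma>) (\<lambda>z. ereal (c z)) \<alpha> =
       discounted_cost (info_law M \<delta>) (info_cost c) \<alpha>) \<and>
    \<comment> \<open>optimal values, finite horizon\<close>
    (\<forall>N. (\<forall>\<gamma> \<delta>. corresponding M \<gamma> \<delta> \<longrightarrow> finite_condition M c N \<gamma> \<delta>) \<longrightarrow>
       (let J = (\<lambda>\<gamma>. finite_cost (obs_law M \<gamma>) (\<lambda>z. ereal (c z)) N);
            J' = (\<lambda>\<delta>. finite_cost (info_law M \<delta>) (info_cost c) N);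
            V = (INF \<gamma>\<in>obs_admissible M. J \<gamma>);
            V' = (INF \<delta>\<in>info_admissible M. J' \<delta>)
        in V = V' \<and> (\<forall>\<gamma> \<delta>. corresponding M \<gamma> \<delta> \<longrightarrow> (J \<gamma> = V \<longleftrightarrow> J' \<delta> = V')))) \<and>
    \<comment> \<open>optimal values, discounted\<close>
    (\<forall>\<alpha>\<in>{0<..<1}. (\<forall>\<gamma>\<in>obs_admissible M. discounted_condition M c \<alpha> \<gamma>) \<longrightarrow>
       (let J = (\<lambda>\<gamma>. discounted_cost (obs_law M \<gamma>) (\<lambda>z. ereal (c z)) \<alpha>);
            J' = (\<lambda>\<delta>. discounted_cost (info_law M \<delta>) (info_cost c) \<alpha>);
            V = (INF \<gamma>\<in>obs_admissible M. J \<gamma>);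
            V' = (INF \<delta>\<in>info_admissible M. J' \<delta>)
        in V = V' \<and> (\<forall>\<gamma> \<delta>. corresponding M \<gamma> \<delta> \<longrightarrow> (J \<gamma> = V \<longleftrightarrow> J' \<delta> = V'))))"
proof -
  interpret observed_model M by unfold_locales (rule model)
  have process: "observed_process M \<gamma>" if "\<gamma> \<in> obs_policies M" for \<gamma>
    using that by unfold_locales
  have filter: "\<forall>\<gamma>\<in>obs_policies M. \<forall>t.
      regular_cond_law (obs_law M \<gamma>) (obs_field M \<gamma> t) (states M) (\<lambda>\<omega>. fst (\<omega> t))
        (\<lambda>\<omega>. filt M t (hist_of (obs M) t \<omega>))"
    by (intro ballI allI observed_process.filter_regular_cond_law process)
  have evolution: "regular_cond_law (obs_law M \<gamma>) (obs_act_field M \<gamma> t) (info_space M)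
      (\<lambda>\<omega>. info_of M (Suc t) (hist_of (obs M) (Suc t) \<omega>))
      (\<lambda>\<omega>. info_kernel M (info_of M t (hist_of (obs M) t \<omega>), snd (\<omega> t)))"
    if "corresponding M \<gamma> \<delta>" for \<gamma> \<delta> t
    using correspondingD(1)[OF that]
    by (intro observed_process.info_state_regular_cond_law process) (simp add: obs_admissible_def)
  have finite: "finite_cost (obs_law M \<gamma>) (\<lambda>z. ereal (c z)) N = finite_cost (info_law M \<delta>) (info_cost c) N"
    if "corresponding M \<gamma> \<delta>" "finite_condition M c N \<gamma> \<delta>" for \<gamma> \<delta> N
    by (rule corresponding_processes.finite_costs_agree[OF corresponding_processesI[OF cost that(1)] that(2)])
  have discounted: "discounted_cost (obs_law M \<gamma>) (\<lambda>z. ereal (c z)) \<alpha> =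
      discounted_cost (info_law M \<delta>) (info_cost c) \<alpha>"
    if "\<alpha> \<in> {0<..<1}" "corresponding M \<gamma> \<delta>" "discounted_condition M c \<alpha> \<gamma>" for \<gamma> \<delta> \<alpha>
    by (rule corresponding_processes.discounted_costs_agree[OF corresponding_processesI[OF cost that(2)] that(1,3)])
  show ?thesis
  proof (intro conjI)
    show "\<forall>\<gamma>\<in>obs_admissible M. induced \<gamma> \<in> info_admissible M \<and> info_law M (induced \<gamma>) = obs_info_law M \<gamma>"
      using induced_admissible by blast
    show "\<forall>\<delta>\<in>info_admissible M.
        implement M \<delta> \<in> obs_admissible M \<and> obs_info_law M (implement M \<delta>) = info_law M \<delta>"
      using implement_admissible by blast
    show "\<forall>N. (\<forall>\<gamma> \<delta>. corresponding M \<gamma> \<delta> \<longrightarrow> finite_condition M c N \<gamma> \<delta>) \<longrightarrow>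
       (let J = (\<lambda>\<gamma>. finite_cost (obs_law M \<gamma>) (\<lambda>z. ereal (c z)) N);
            J' = (\<lambda>\<delta>. finite_cost (info_law M \<delta>) (info_cost c) N);
            V = (INF \<gamma>\<in>obs_admissible M. J \<gamma>);
            V' = (INF \<delta>\<in>info_admissible M. J' \<delta>)
        in V = V' \<and> (\<forall>\<gamma> \<delta>. corresponding M \<gamma> \<delta> \<longrightarrow> (J \<gamma> = V \<longleftrightarrow> J' \<delta> = V')))"
      unfolding Let_def by (intro allI impI optimal_values_agree[unfolded Let_def]) (simp add: finite)
    show "\<forall>\<alpha>\<in>{0<..<1}. (\<forall>\<gamma>\<in>obs_admissible M. discounted_condition M c \<alpha> \<gamma>) \<longrightarrow>
       (let J = (\<lambda>\<gamma>. discounted_cost (obs_law M \<gamma>) (\<lambda>z. ereal (c z)) \<alpha>);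
            J' = (\<lambda>\<delta>. discounted_cost (info_law M \<delta>) (info_cost c) \<alpha>);
            V = (INF \<gamma>\<in>obs_admissible M. J \<gamma>);
            V' = (INF \<delta>\<in>info_admissible M. J' \<delta>)
        in V = V' \<and> (\<forall>\<gamma> \<delta>. corresponding M \<gamma> \<delta> \<longrightarrow> (J \<gamma> = V \<longleftrightarrow> J' \<delta> = V')))"
      unfolding Let_def
      by (intro ballI impI optimal_values_agree[unfolded Let_def] discounted)
         (auto dest: correspondingD(1))
  qed (use filter evolution finite discounted in blast)+
qed

end
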